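(* Let $D>1$ be a square-free integer with $D\equiv1\pmod4$, let $n\ge1$ and let $\nu\bmod n$ satisfy $\nu^2\equiv D\pmod n$. Then there exist $h=h_1^+(D)$ oriented geodesics $\mathbf{c}'_1,\dots,\mathbf{c}'_h$ in $\mathbb{H}$, each projecting to a closed geodesic in $\Gamma_0(n)\backslash\mathbb{H}$, all of these closed geodesics having the same length, such that: (i) for every positive integer $m$ and residue class $\mu\bmod m$ with $\mu^2\equiv D\pmod m$, $m\equiv0\pmod n$, $\mu\equiv\nu\pmod n$, and with $m$ odd or $\frac{D-\mu^2}{m}$ odd, there exist a unique $k$ and a unique double coset $\Gamma_\infty\gamma\Gamma'_k\in\Gamma_\infty\backslash\Gamma_0(n)/\Gamma'_k$ (with $\gamma\mathbf{c}'_k$ positively oriented) such that $z_{\gamma\mathbf{c}'_k}\equiv\frac{\mu}{m}+\mathrm{i}\frac{\sqrt D}{m}\pmod{\Gamma_\infty}$; (ii) conversely, for every $k$ and every double coset $\Gamma_\infty\gamma\Gamma'_k\in\Gamma_\infty\backslash\Gamma_0(n)/\Gamma'_k$ with $\gamma\mathbf{c}'_k$ positively oriented, there exist a unique positive integer $m$ and a unique residue class $\mu\bmod m$ with $z_{\gamma\mathbf{c}'_k}\equiv\frac{\mu}{m}+\mathrm{i}\frac{\sqrt D}{m}\pmod{\Gamma_\infty}$, $\mu^2\equiv D\pmod m$, $m\equiv0\pmod n$, $\mu\equiv\nu\pmod n$, and $m$ odd or $\frac{D-\mu^2}{m}$ odd.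
   Context: "$m$ odd or $\frac{D-\mu^2}{m}$ odd" means: $m$ is odd, or $m$ is even and $\frac{D-\mu^2}{m}$ is odd. $h_1^+(D)$ is the narrow class number of $\mathbb{Z}[\sqrt D]$: the order of the group of invertible fractional ideals of $\mathbb{Z}[\sqrt D]$ modulo principal ideals $\xi\mathbb{Z}[\sqrt D]$ with $\xi\in\mathbb{Q}(\sqrt D)$ totally positive ($\xi=a+b\sqrt D$ is totally positive if $a+b\sqrt D>0$ and $a-b\sqrt D>0$). $\mathbb{H}$ is the upper half-plane with $\operatorname{SL}(2,\mathbb{R})$ acting by Möbius transformations. An oriented geodesic is $\mathbf{c}=\{g\,\mathrm{diag}(s,s^{-1})\mathrm{i}:s>0\}$ ($g\in\operatorname{SL}(2,\mathbb{R})$), oriented by increasing $s$, with endpoints $\mathbf{c}^-$ ($s\to0$) and $\mathbf{c}^+$ ($s\to\infty$); it is positively oriented if both endpoints are real and $\mathbf{c}^-<\mathbf{c}^+$, and then $z_{\mathbf{c}}$ is its point with largest imaginary part. $\Gamma_\infty=\{\pm\begin{pmatrix}1&k\\0&1\end{pmatrix}:k\in\mathbb{Z}\}$; $z\equiv w\pmod{\Gamma_\infty}$ means $w-z\in\mathbb{Z}$. $\Gamma_0(n)=\{\begin{pmatrix}a&b\\c&d\end{pmatrix}\in\operatorname{SL}(2,\mathbb{Z}):n\mid c\}$. $\Gamma'_k=\Gamma_0(n)\cap\{\pm g_k\mathrm{diag}(s,s^{-1})g_k^{-1}:s>0\}$ is the stabilizer in $\Gamma_0(n)$ of $\mathbf{c}'_k=g_k\{\mathrm{diag}(s,s^{-1})\mathrm{i}\}$.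 *)

theory Defs
  imports
    "HOL-Analysis.Analysis"
    "HOL-Algebra.Coset"
    "HOL-Number_Theory.Cong"
    "HOL-Computational_Algebra.Squarefree"
begin

section \<open>The narrow class number of \<open>\<int>[\<surd>D]\<close>\<close>

text \<open>
  For a positive non-square \<open>D\<close> the field \<open>\<rat>(\<surd>D)\<close> and its order \<open>\<int>[\<surd>D]\<close> are realised as
  sets of real numbers.
\<close>

definition quad_field :: "int \<Rightarrow> real set" where
  "quad_field D = {of_rat a + of_rat b * sqrt (of_int D) | a b. True}"

definition quad_order :: "int \<Rightarrow> real set" where
  "quad_order D = {of_int x + of_int y * sqrt (of_int D) | x y. True}"

definition totally_positive :: "int \<Rightarrow> real \<Rightarrow> bool" where
  "totally_positive D \<xi> \<longleftrightarrow>
     (\<exists>a b. \<xi> = of_rat a + of_rat b * sqrt (of_int D) \<and>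
            of_rat a + of_rat b * sqrt (of_int D) > 0 \<and>
            of_rat a - of_rat b * sqrt (of_int D) > 0)"

definition fractional_ideal :: "int \<Rightarrow> real set \<Rightarrow> bool" where
  "fractional_ideal D I \<longleftrightarrow>
     I \<subseteq> quad_field D \<and> 0 \<in> I \<and> I \<noteq> {0} \<and>
     (\<forall>x\<in>I. \<forall>y\<in>I. x + y \<in> I) \<and>
     (\<forall>r\<in>quad_order D. \<forall>x\<in>I. r * x \<in> I) \<and>
     (\<exists>d\<in>quad_order D. d \<noteq> 0 \<and> (\<forall>x\<in>I. d * x \<in> quad_order D))"

definition ideal_mult :: "real set \<Rightarrow> real set \<Rightarrow> real set" where
  "ideal_mult I J =
     {\<Sum>i<N. a i * b i | (N::nat) a b. \<forall>i<N. a i \<in> I \<and> b i \<in> J}"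

definition invertible_ideal :: "int \<Rightarrow> real set \<Rightarrow> bool" where
  "invertible_ideal D I \<longleftrightarrow>
     fractional_ideal D I \<and> (\<exists>J. fractional_ideal D J \<and> ideal_mult I J = quad_order D)"

definition ideal_group :: "int \<Rightarrow> real set monoid" where
  "ideal_group D =
     \<lparr>carrier = {I. invertible_ideal D I}, mult = ideal_mult, one = quad_order D\<rparr>"

definition narrow_principal_ideals :: "int \<Rightarrow> real set set" where
  "narrow_principal_ideals D =
     {(\<lambda>x. \<xi> * x) ` quad_order D | \<xi>. totally_positive D \<xi>}"

definition narrow_class_number :: "int \<Rightarrow> nat" where
  "narrow_class_number D = Coset.order (ideal_group D Mod narrow_principal_ideals D)"


section \<open>Oriented geodesics in the upper half-plane\<close>

definition mat2 :: "real \<Rightarrow> real \<Rightarrow> real \<Rightarrow> real \<Rightarrow> real^2^2" where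
  "mat2 a b c d = vector [vector [a, b], vector [c, d]]"

definition moebius :: "real^2^2 \<Rightarrow> complex \<Rightarrow> complex" where
  "moebius A z = (of_real (A $ 1 $ 1) * z + of_real (A $ 1 $ 2)) /
                 (of_real (A $ 2 $ 1) * z + of_real (A $ 2 $ 2))"

text \<open>
  An oriented geodesic is given by a matrix \<open>g \<in> SL(2,\<real>)\<close> through its parametrisation by
  \<open>s > 0\<close>; its translate by \<open>\<gamma> \<in> SL(2,\<real>)\<close> is then the oriented geodesic given by \<open>\<gamma> ** g\<close>.
\<close>

definition geodesic_point :: "real^2^2 \<Rightarrow> real \<Rightarrow> complex" where
  "geodesic_point g s = moebius (g ** mat2 s 0 0 (inverse s)) \<i>"

definition geodesic :: "real^2^2 \<Rightarrow> complex set" where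
  "geodesic g = geodesic_point g ` {0<..}"

definition positively_oriented :: "real^2^2 \<Rightarrow> bool" where
  "positively_oriented g \<longleftrightarrow>
     (\<exists>x y :: real. (geodesic_point g \<longlongrightarrow> of_real x) (at_right 0) \<and>
                    (geodesic_point g \<longlongrightarrow> of_real y) at_top \<and> x < y)"

definition apex :: "real^2^2 \<Rightarrow> complex" where
  "apex g = arg_max_on Im (geodesic g)"

definition orbit :: "(real^2^2) set \<Rightarrow> complex \<Rightarrow> complex set" where
  "orbit G z = (\<lambda>A. moebius A z) ` G"

text \<open>
  With respect to the hyperbolic metric \<open>|dz| / Im z\<close>, the curve
  \<open>t \<mapsto> geodesic_point g (exp (t / 2))\<close> has unit speed.  The geodesic projects to a closed
  geodesic in the quotient by \<open>G\<close> iff the projection of this curve is periodic, and the length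
  of the closed geodesic is then the smallest period.
\<close>

definition projection_period :: "(real^2^2) set \<Rightarrow> real^2^2 \<Rightarrow> real \<Rightarrow> bool" where
  "projection_period G g T \<longleftrightarrow>
     T > 0 \<and> (\<forall>t. orbit G (geodesic_point g (exp ((t + T) / 2))) =
                  orbit G (geodesic_point g (exp (t / 2))))"

definition projects_to_closed_geodesic :: "(real^2^2) set \<Rightarrow> real^2^2 \<Rightarrow> bool" where
  "projects_to_closed_geodesic G g \<longleftrightarrow> (\<exists>T. projection_period G g T)"

definition closed_geodesic_length :: "(real^2^2) set \<Rightarrow> real^2^2 \<Rightarrow> real" where
  "closed_geodesic_length G g = Inf {T. projection_period G g T}"


section \<open>Subgroups and double cosets\<close>

definition Gamma0 :: "int \<Rightarrow> (real^2^2) set" where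
  "Gamma0 n = {mat2 (of_int a) (of_int b) (of_int c) (of_int d) | a b c d.
                 a * d - b * c = 1 \<and> n dvd c}"

definition Gamma_inf :: "(real^2^2) set" where
  "Gamma_inf = {mat2 1 (of_int k) 0 1 | k. True} \<union> {- mat2 1 (of_int k) 0 1 | k. True}"

definition geodesic_stabilizer :: "int \<Rightarrow> real^2^2 \<Rightarrow> (real^2^2) set" where
  "geodesic_stabilizer n g =
     Gamma0 n \<inter> ({g ** mat2 s 0 0 (inverse s) ** matrix_inv g | s. s > 0} \<union>
                  {- (g ** mat2 s 0 0 (inverse s) ** matrix_inv g) | s. s > 0})"

definition double_coset :: "(real^2^2) set \<Rightarrow> real^2^2 \<Rightarrow> (real^2^2) set \<Rightarrow> (real^2^2) set" where
  "double_coset H \<gamma> K = {A ** \<gamma> ** B | A B. A \<in> H \<and> B \<in> K}"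

definition cong_Gamma_inf :: "complex \<Rightarrow> complex \<Rightarrow> bool" where
  "cong_Gamma_inf z w \<longleftrightarrow> w - z \<in> \<int>"


section \<open>Roots of the congruence\<close>

definition residue_class :: "int \<Rightarrow> int \<Rightarrow> int set" where
  "residue_class m \<mu> = {x. [x = \<mu>] (mod m)}"

text \<open>
  When \<open>m\<close> is even, the parity of the exact quotient \<open>(D - \<mu>\<^sup>2) div m\<close> depends only on the
  class of \<open>\<mu>\<close> modulo \<open>m\<close>.
\<close>

definition admissible_root :: "int \<Rightarrow> int \<Rightarrow> int \<Rightarrow> int \<Rightarrow> int \<Rightarrow> bool" where
  "admissible_root D n \<nu> m \<mu> \<longleftrightarrow>
     m > 0 \<and> [\<mu>\<^sup>2 = D] (mod m) \<and> [m = 0] (mod n) \<and> [\<mu> = \<nu>] (mod n) \<and>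
     (odd m \<or> even m \<and> odd ((D - \<mu>\<^sup>2) div m))"

definition root_point :: "int \<Rightarrow> int \<Rightarrow> int \<Rightarrow> complex" where
  "root_point D m \<mu> =
     of_int \<mu> / of_int m + \<i> * (of_real (sqrt (of_int D)) / of_int m)"

end

theory Submission
  imports Defs
begin

text \<open>
  Solutions of \<open>\<mu>\<^sup>2 \<equiv> D\<close> modulo \<open>m\<close> are integral matrices \<open>M = (B, -C; A, -B)\<close> with \<open>M\<^sup>2 = D\<close>, \<open>A = m > 0\<close> and
  \<open>B = \<mu>\<close>, i.e. forms \<open>(A, 2B, C)\<close> of discriminant \<open>4D\<close>; the parity condition says that the form is
  primitive. Writing \<open>M = g diag(\<surd>D, -\<surd>D) g\<^sup>-\<^sup>1\<close> attaches to \<open>M\<close> the oriented geodesic with end points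
  \<open>(B \<plusminus> \<surd>D) / A\<close>, with apex \<open>(B + \<i>\<surd>D) / A\<close> if \<open>A > 0\<close>, and \<open>SL(2,\<int>)\<close> acts by conjugation of \<open>M\<close>.
  Multiplication by \<open>\<surd>D\<close> on oriented bases of invertible ideals identifies the narrow ideal classes of
  \<open>\<int>[\<surd>D]\<close> with the \<open>SL(2,\<int>)\<close>-classes of primitive forms. Each of these contains a form with \<open>n | A\<close> and
  \<open>B \<equiv> \<nu>\<close> modulo \<open>n\<close>, and any two such forms in one class are already \<open>\<Gamma>\<^sub>0(n)\<close>-equivalent.
  The stabilizer of a primitive \<open>M\<close> consists of the \<open>x + y M\<close> with \<open>x\<^sup>2 - D y\<^sup>2 = 1\<close>, whence all closed
  geodesics have the same length.
\<close>

section \<open>Binary quadratic forms of discriminant \<open>4D\<close>\<close>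

text \<open>Square-freeness of \<open>D\<close> makes the parity condition the whole of primitivity:
  the square of an odd prime dividing \<open>A\<close>, \<open>B\<close> and \<open>C\<close> would
  divide \<open>D\<close>, so 2 is the only possible common prime factor of \<open>A\<close>,
  \<open>2 * B\<close> and \<open>C\<close>. The prime 2 is also the exceptional one for ideals,
  since \<int>[\<surd>D] has index 2 in the maximal order: when \<open>A\<close> and
  \<open>C\<close> are even, the lattice of the form has the larger multiplier ring and no inverse
  over \<int>[\<surd>D]. The delicate point of the class correspondence is orientation. The forms
  are indefinite, so both signs of \<open>A\<close> occur, whereas the lattice spanned by
  \<open>A\<close> and \<open>B\<close> + \<surd>D sees \<open>A\<close> only up to sign. Signs of
  norms carry the missing information and force base changes to have determinant 1 instead of -1.
  The two sides of the double coset have separate origins. A root modulo \<open>m\<close> fixes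
  \<open>B\<close> only modulo \<open>A\<close>, and changing \<open>B\<close> by a multiple of
  \<open>A\<close> is the action of \<open>Gamma_inf\<close>; changing the group element without
  changing the form is multiplication by the stabilizer on the right.\<close>

type_synonym form = "int \<times> int \<times> int"

text \<open>
  The triple \<open>(A, B, C)\<close> stands for the matrix \<open>(B, -C; A, -B)\<close>, which \<open>(a, b; c, d)\<close> acts on by conjugation.
\<close>

definition form_act :: "int \<Rightarrow> int \<Rightarrow> int \<Rightarrow> int \<Rightarrow> form \<Rightarrow> form" where
  "form_act a b c d = (\<lambda>(A, B, C).
     (A * d\<^sup>2 + 2 * B * c * d + C * c\<^sup>2,
      A * b * d + B * (a * d + b * c) + C * a * c,
      A * b\<^sup>2 + 2 * B * a * b + C * a\<^sup>2))"

definition form_equiv :: "form \<Rightarrow> form \<Rightarrow> bool" where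
  "form_equiv Q Q' \<longleftrightarrow> (\<exists>a b c d. a * d - b * c = 1 \<and> Q' = form_act a b c d Q)"

text \<open>For square-free \<open>D\<close> the parity condition is equivalent to \<open>A\<close>,
  \<open>2 * B\<close>, \<open>C\<close> having greatest common divisor 1.\<close>

definition primitive_forms :: "int \<Rightarrow> form set" where
  "primitive_forms D = {(A, B, C). B\<^sup>2 - A * C = D \<and> (odd A \<or> odd C)}"

text \<open>These are the primitive forms whose matrix is upper triangular modulo \<open>n\<close>
  with diagonal (\<nu>, -\<nu>), a shape that conjugation by \<open>\<Gamma>\<^sub>0(n)\<close>
  preserves.\<close>

definition level_forms :: "int \<Rightarrow> int \<Rightarrow> int \<Rightarrow> form set" where
  "level_forms D n \<nu> = {(A, B, C) \<in> primitive_forms D. n dvd A \<and> [B = \<nu>] (mod n)}"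

lemma form_act_id [simp]: "form_act 1 0 0 1 Q = Q"
  by (cases Q) (simp add: form_act_def)

lemma form_act_act:
  "form_act a b c d (form_act a' b' c' d' Q) =
   form_act (a * a' + b * c') (a * b' + b * d') (c * a' + d * c') (c * b' + d * d') Q"
  by (cases Q) (simp add: form_act_def power2_eq_square algebra_simps)

lemma form_act_inverse:
  assumes "a * d - b * c = 1"
  shows "form_act d (- b) (- c) a (form_act a b c d Q) = Q"
  using assms by (simp add: form_act_act mult.commute)

lemma form_equiv_refl: "form_equiv Q Q"
  unfolding form_equiv_def by (rule exI[of _ 1], rule exI[of _ 0], rule exI[of _ 0], rule exI[of _ 1]) simp

lemma form_equiv_sym:
  assumes "form_equiv Q Q'"
  shows "form_equiv Q' Q"
proof -
  obtain a b c d where h: "a * d - b * c = 1" "Q' = form_act a b c d Q"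
    using assms unfolding form_equiv_def by blast
  have "d * a - (- b) * (- c) = 1" "Q = form_act d (- b) (- c) a Q'"
    using h form_act_inverse[OF h(1), of Q] by (simp_all add: mult.commute)
  thus ?thesis unfolding form_equiv_def by blast
qed

lemma form_equiv_trans:
  assumes "form_equiv Q Q'" "form_equiv Q' Q''"
  shows "form_equiv Q Q''"
proof -
  obtain a b c d where h: "a * d - b * c = 1" "Q' = form_act a b c d Q"
    using assms unfolding form_equiv_def by blast
  obtain a' b' c' d' where h': "a' * d' - b' * c' = 1" "Q'' = form_act a' b' c' d' Q'"
    using assms unfolding form_equiv_def by blast
  have "(a' * a + b' * c) * (c' * b + d' * d) - (a' * b + b' * d) * (c' * a + d' * c)
      = (a' * d' - b' * c') * (a * d - b * c)"
    by (simp add: algebra_simps)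
  hence "(a' * a + b' * c) * (c' * b + d' * d) - (a' * b + b' * d) * (c' * a + d' * c) = 1"
    using h h' by simp
  moreover have "Q'' = form_act (a' * a + b' * c) (a' * b + b' * d) (c' * a + d' * c) (c' * b + d' * d) Q"
    using h h' by (simp add: form_act_act)
  ultimately show ?thesis unfolding form_equiv_def by blast
qed

text \<open>Up to sign both sides are determinants of matrices of forms. The action multiplies by
  the adjugate on the right, which produces the squared determinant.\<close>

lemma form_act_discriminant:
  fixes A B C a b c d :: int
  shows "(A * b * d + B * (a * d + b * c) + C * a * c)\<^sup>2
     - (A * d\<^sup>2 + 2 * B * c * d + C * c\<^sup>2) * (A * b\<^sup>2 + 2 * B * a * b + C * a\<^sup>2)
    = (B\<^sup>2 - A * C) * (a * d - b * c)\<^sup>2"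
  by (simp add: power2_eq_square algebra_simps)

lemma form_act_primitive:
  assumes Q: "Q \<in> primitive_forms D" and det: "a * d - b * c = 1"
  shows "form_act a b c d Q \<in> primitive_forms D"
proof -
  \<comment> \<open>Evenness of both outer coefficients survives any action; applied to the inverse
    matrix, this shows that primitivity survives too.\<close>
  have even: "even A' \<and> even C'"
    if "even A" "even C" "form_act a b c d (A, B, C) = (A', B', C')" for a b c d A B C A' B' C'
    using that by (auto simp: form_act_def)
  obtain A B C where ABC: "Q = (A, B, C)" by (cases Q)
  obtain A' B' C' where ABC': "form_act a b c d Q = (A', B', C')" by (cases "form_act a b c d Q")
  have "B'\<^sup>2 - A' * C' = D"
    using ABC ABC' Q det form_act_discriminant[of A b d B a c C]
    by (auto simp: form_act_def primitive_forms_def)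
  moreover have "odd A' \<or> odd C'"
    using form_act_inverse[OF det, of Q] even[of A' C' d "-b" "-c" a B' A B C] ABC ABC' Q
    by (auto simp: primitive_forms_def)
  ultimately show ?thesis by (simp add: ABC' primitive_forms_def)
qed

lemma form_equiv_primitive:
  "form_equiv Q Q' \<Longrightarrow> Q \<in> primitive_forms D \<Longrightarrow> Q' \<in> primitive_forms D"
  using form_act_primitive unfolding form_equiv_def by blast

lemma form_act_level:
  assumes Q: "Q \<in> level_forms D n \<nu>" and det: "a * d - b * c = 1" and "n dvd c"
  shows "form_act a b c d Q \<in> level_forms D n \<nu>"
proof -
  obtain A B C where ABC: "Q = (A, B, C)" by (cases Q)
  have h: "Q \<in> primitive_forms D" "n dvd A" "[B = \<nu>] (mod n)"
    using Q by (auto simp: level_forms_def ABC)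
  \<comment> \<open>With determinant 1, \<open>B * (a * d + b * c)\<close> equals
    \<open>B + 2 * B * b * c\<close>, so every correction to \<open>B\<close> contains
    \<open>A\<close> or \<open>c\<close>.\<close>
  have "A * b * d + B * (a * d + b * c) + C * a * c = B + (A * b * d + (2 * B * b + C * a) * c)"
    using arg_cong[OF det, of "\<lambda>x. B * x"] by (simp add: algebra_simps)
  moreover have "n dvd A * b * d + (2 * B * b + C * a) * c"
    using h assms by simp
  ultimately have "[A * b * d + B * (a * d + b * c) + C * a * c = B] (mod n)"
    unfolding cong_iff_dvd_diff by (metis add_diff_cancel_left')
  hence "[A * b * d + B * (a * d + b * c) + C * a * c = \<nu>] (mod n)"
    using h(3) cong_trans by blast
  moreover have "n dvd A * d\<^sup>2 + 2 * B * c * d + C * c\<^sup>2"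
    using h assms(3) by (simp add: power2_eq_square)
  ultimately show ?thesis
    using form_act_primitive[OF h(1) det] by (auto simp: level_forms_def ABC form_act_def)
qed

section \<open>Primitive forms for square-free \<open>D\<close>: common divisors, represented
  values, reduction\<close>

locale squarefree_1_mod_4 =
  fixes D :: int
  assumes D_gt_1: "D > 1" and squarefree_D: "squarefree D" and D_cong_1: "[D = 1] (mod 4)"
begin

lemma D_pos: "D > 0"
  using D_gt_1 by simp

lemma odd_D: "odd D"
proof -
  have "4 dvd D - 1" using D_cong_1 by (simp add: cong_iff_dvd_diff)
  thus ?thesis by presburger
qed

text \<open>Irrationality of \<surd>D in integral form: a nonzero \<open>y\<close> would make
  \<open>D\<close> a square \<open>k^2\<close>, and square-freeness makes \<open>k\<close> a unit,
  against \<open>D > 1\<close>.\<close>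

lemma square_eq_D_mult_square:
  fixes x y :: int
  assumes "x\<^sup>2 = D * y\<^sup>2"
  shows "y = 0"
proof (rule ccontr)
  assume y: "y \<noteq> 0"
  have "y\<^sup>2 dvd x\<^sup>2" using assms by simp
  hence "y dvd x" by simp
  then obtain k where "x = y * k" by blast
  hence k: "k\<^sup>2 = D" using assms y by (simp add: power_mult_distrib)
  hence "k dvd 1" by (intro squarefreeD[OF squarefree_D]) simp
  hence "\<bar>k\<bar> = 1" by simp
  hence "k\<^sup>2 = 1" by (metis one_power2 power2_abs)
  thus False using k D_gt_1 by simp
qed

text \<open>A vanishing outer coefficient would make \<open>D\<close> the square of
  \<open>B\<close>.\<close>

lemma primitive_form_nz:
  assumes "(A, B, C) \<in> primitive_forms D"
  shows "A \<noteq> 0" "C \<noteq> 0"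
  using square_eq_D_mult_square[of B 1] assms by (auto simp: primitive_forms_def)

text \<open>The parity condition excludes \<open>p = 2\<close>. An odd \<open>p\<close> divides
  \<open>B\<close> itself, so its square divides \<open>D\<close>.\<close>

lemma primitive_form_no_common_prime:
  assumes Q: "(A, B, C) \<in> primitive_forms D"
    and p: "prime p" "p dvd A" "p dvd 2 * B" "p dvd C"
  shows False
proof -
  have D: "D = B\<^sup>2 - A * C" and AC: "odd A \<or> odd C"
    using Q by (auto simp: primitive_forms_def)
  have "p \<noteq> 2" using AC p by auto
  moreover have "prime (2 :: int)" by simp
  ultimately have "\<not> p dvd 2" using p(1) primes_dvd_imp_eq by blast
  hence "p dvd B" using p by (metis prime_dvd_multD)
  hence "p\<^sup>2 dvd D" unfolding D using p by (simp add: power2_eq_square mult_dvd_mono)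
  hence "p dvd 1" by (rule squarefreeD[OF squarefree_D])
  thus False using p(1) by (meson not_prime_unit)
qed

lemma primitive_form_gcd:
  assumes "(A, B, C) \<in> primitive_forms D"
  shows "gcd A (gcd (2 * B) C) = 1"
proof (rule ccontr)
  assume "gcd A (gcd (2 * B) C) \<noteq> 1"
  moreover have "gcd A (gcd (2 * B) C) \<noteq> 0" using primitive_form_nz[OF assms] by simp
  ultimately obtain p where "prime p" "p dvd gcd A (gcd (2 * B) C)"
    by (metis gcd_ge_0_int abs_of_nonneg prime_factor_int)
  thus False using primitive_form_no_common_prime[OF assms] by auto
qed

text \<open>Primitivity is used in this shape three times: for equivalence under
  \<open>\<Gamma>\<^sub>0(n)\<close>, for inverting the lattice of a form, and for integrality of
  the parameters of the stabilizer.\<close>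

lemma primitive_form_bezout:
  assumes "(A, B, C) \<in> primitive_forms D"
  obtains u v w where "u * A + v * (2 * B) + w * C = 1"
proof -
  obtain v w where "v * (2 * B) + w * C = gcd (2 * B) C" using bezout_int by blast
  moreover obtain s t where "s * A + t * gcd (2 * B) C = gcd A (gcd (2 * B) C)" using bezout_int by blast
  ultimately have "s * A + (t * v) * (2 * B) + (t * w) * C = 1"
    using primitive_form_gcd[OF assms] by (metis (no_types, lifting) add.assoc distrib_left mult.assoc)
  thus ?thesis using that by blast
qed

text \<open>
  Equality of the conjugated matrices modulo \<open>n\<close> gives \<open>2\<nu>c \<equiv> 0\<close> and \<open>Cc \<equiv> 0\<close>, while \<open>n\<close>, \<open>2\<nu>\<close>
  and \<open>C\<close> have no common prime factor.
\<close>

lemma level_forms_equiv_dvd: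
  assumes Q: "Q \<in> level_forms D n \<nu>" and Q': "form_act a b c d Q \<in> level_forms D n \<nu>"
    and det: "a * d - b * c = 1"
  shows "n dvd c"
proof -
  obtain A B C where ABC: "Q = (A, B, C)" by (cases Q)
  obtain A' B' C' where ABC': "form_act a b c d Q = (A', B', C')" by (cases "form_act a b c d Q")
  have h: "(A, B, C) \<in> primitive_forms D" "n dvd A" "[B = \<nu>] (mod n)"
    using Q by (auto simp: level_forms_def ABC)
  have h': "n dvd A'" "[B' = \<nu>] (mod n)"
    using Q' by (auto simp: level_forms_def ABC')
  have e: "A' = A * d\<^sup>2 + 2 * B * c * d + C * c\<^sup>2" "B' = A * b * d + B * (a * d + b * c) + C * a * c"
    using ABC ABC' by (auto simp: form_act_def)
  have BB': "n dvd B' - B" using h(3) h'(2) by (metis cong_iff_dvd_diff cong_sym cong_trans)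
  \<comment> \<open>This identity and the one for \<open>C * c\<close> below are the two lower
    entries of the relation M' g = g M, where M and M' are the matrices of the two forms and g = (a,
    b; c, d).\<close>
  have "(B + B') * c = a * A' - d * A"
    using det unfolding e by algebra
  hence "2 * B * c = a * A' - d * A - (B' - B) * c" by (simp add: algebra_simps)
  hence B: "n dvd c * (2 * B)" using h h' BB' by (simp add: mult.commute)
  have "C * c = d * (B' - B) - A' * b"
    using det unfolding e by algebra
  hence C: "n dvd c * C" using h h' BB' by (simp add: mult.commute)
  obtain u v w where uvw: "u * A + v * (2 * B) + w * C = 1"
    using primitive_form_bezout[OF h(1)] .
  have "c = u * c * A + v * (c * (2 * B)) + w * (c * C)"
    using arg_cong[OF uvw, of "\<lambda>x. c * x"] by (simp add: algebra_simps)
  also have "n dvd \<dots>"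
    by (rule dvd_add[OF dvd_add[OF dvd_mult[OF h(2)] dvd_mult[OF B]] dvd_mult[OF C]])
  finally show ?thesis .
qed

text \<open>
  The primes are treated one at a time: modulo the new prime the vector is moved to one of \<open>(1,0)\<close>,
  \<open>(0,1)\<close>, \<open>(1,1)\<close>, modulo the earlier ones it is kept.
\<close>

lemma form_value_avoiding_primes:
  fixes A B C :: int
  assumes Q: "(A, B, C) \<in> primitive_forms D" and S: "finite S" "\<And>p. p \<in> S \<Longrightarrow> prime p"
  shows "\<exists>x y. \<forall>p\<in>S. \<not> p dvd A * x\<^sup>2 + 2 * B * x * y + C * y\<^sup>2"
  using S
proof (induction S rule: finite_induct)
  case empty
  show ?case by simp
next
  case (insert p S)
  have p: "prime p" using insert.prems by simp
  obtain x y where xy: "\<forall>q\<in>S. \<not> q dvd A * x\<^sup>2 + 2 * B * x * y + C * y\<^sup>2"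
    using insert by auto
  define P where "P = \<Prod>S"
  have "coprime p P" unfolding P_def
  proof (rule prod_coprime_right)
    fix q assume "q \<in> S"
    thus "coprime p q" using insert.prems insert.hyps by (metis insertCI primes_coprime)
  qed
  then obtain R where R: "[P * R = 1] (mod p)" using cong_solve_coprime_int by (metis coprime_commute)
  have "\<exists>x0 y0. \<not> p dvd A * x0\<^sup>2 + 2 * B * x0 * y0 + C * y0\<^sup>2"
  proof (rule ccontr)
    assume "\<not> ?thesis"
    hence all: "p dvd A * x0\<^sup>2 + 2 * B * x0 * y0 + C * y0\<^sup>2" for x0 y0 by blast
    have "p dvd A" "p dvd C" using all[of 1 0] all[of 0 1] by simp_all
    moreover from this have "p dvd 2 * B" using all[of 1 1]
      by (metis dvd_add_left_iff dvd_add_right_iff mult.right_neutral one_power2)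
    ultimately show False using primitive_form_no_common_prime[OF Q p] by blast
  qed
  then obtain x0 y0 where xy0: "\<not> p dvd A * x0\<^sup>2 + 2 * B * x0 * y0 + C * y0\<^sup>2" by blast
  \<comment> \<open>Chinese remaindering: \<open>P * R\<close> is 1 modulo \<open>p\<close> and 0
    modulo every prime in \<open>S\<close>.\<close>
  define x1 y1 where "x1 = x + P * (R * (x0 - x))" and "y1 = y + P * (R * (y0 - y))"
  have "[x1 = x + 1 * (x0 - x)] (mod p)" "[y1 = y + 1 * (y0 - y)] (mod p)"
    unfolding x1_def y1_def mult.assoc[symmetric] using R by (intro cong_add cong_mult cong_refl; simp)+
  hence c: "[x1 = x0] (mod p)" "[y1 = y0] (mod p)" by simp_all
  have "[A * x1\<^sup>2 + 2 * B * x1 * y1 + C * y1\<^sup>2 = A * x0\<^sup>2 + 2 * B * x0 * y0 + C * y0\<^sup>2] (mod p)"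
    using c by (intro cong_add cong_mult cong_pow cong_refl)
  hence 1: "\<not> p dvd A * x1\<^sup>2 + 2 * B * x1 * y1 + C * y1\<^sup>2" using xy0 cong_dvd_iff by blast
  have 2: "\<not> q dvd A * x1\<^sup>2 + 2 * B * x1 * y1 + C * y1\<^sup>2" if q: "q \<in> S" for q
  proof -
    have "q dvd P" unfolding P_def using insert.hyps q dvd_prodI[of S q "\<lambda>x. x"] by simp
    hence c: "[x1 = x] (mod q)" "[y1 = y] (mod q)"
      by (simp_all add: x1_def y1_def cong_iff_dvd_diff)
    have "[A * x1\<^sup>2 + 2 * B * x1 * y1 + C * y1\<^sup>2 = A * x\<^sup>2 + 2 * B * x * y + C * y\<^sup>2] (mod q)"
      using c by (intro cong_add cong_mult cong_pow cong_refl)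
    thus ?thesis using xy q cong_dvd_iff by blast
  qed
  show ?case using 1 2 by blast
qed

text \<open>A value of the form at a coprime pair becomes its last coefficient once the pair is
  completed to a matrix of determinant 1. Dividing a vector by its gcd divides the value by a
  square, so a value avoiding the primes of \<open>n\<close> still avoids them.\<close>

lemma form_equiv_coprime_coefficient:
  assumes Q: "Q \<in> primitive_forms D" and n: "n \<ge> 1"
  obtains A B C where "form_equiv Q (A, B, C)" "coprime C n"
proof -
  obtain A B C where ABC: "Q = (A, B, C)" by (cases Q)
  \<comment> \<open>The prime 2 is added so that the value is nonzero, hence \<open>x\<close> and
    \<open>y\<close> are not both 0, even if \<open>n\<close> has no prime factor.\<close>
  have "prime p" if "p \<in> insert 2 (prime_factors n)" for p
    using that by auto
  then obtain x y where xy: "\<forall>p\<in>insert 2 (prime_factors n). \<not> p dvd A * x\<^sup>2 + 2 * B * x * y + C * y\<^sup>2"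
    using form_value_avoiding_primes[of A B C "insert 2 (prime_factors n)"] Q
    unfolding ABC by (metis finite_insert finite_set_mset)
  define g where "g = gcd x y"
  have "\<not> (x = 0 \<and> y = 0)" using xy by auto
  then obtain b a where ba: "x = b * g" "y = a * g" "coprime b a"
    unfolding g_def using gcd_coprime_exists[of x y] by auto
  have e: "A * x\<^sup>2 + 2 * B * x * y + C * y\<^sup>2 = g\<^sup>2 * (A * b\<^sup>2 + 2 * B * a * b + C * a\<^sup>2)"
    unfolding ba by (simp add: power2_eq_square algebra_simps)
  obtain u v where uv: "u * b + v * a = 1" using ba(3) bezout_int[of b a] by auto
  have "a * v - b * (- u) = 1" using uv by (simp add: algebra_simps)
  hence "form_equiv Q (form_act a b (- u) v Q)" unfolding form_equiv_def by blast
  moreover have "coprime (A * b\<^sup>2 + 2 * B * a * b + C * a\<^sup>2) n"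
  proof (rule ccontr)
    assume "\<not> ?thesis"
    moreover have "n \<noteq> 0" using n by simp
    ultimately obtain p where "prime p" "p dvd A * b\<^sup>2 + 2 * B * a * b + C * a\<^sup>2" "p dvd n"
      using prime_factor_int[of "gcd (A * b\<^sup>2 + 2 * B * a * b + C * a\<^sup>2) n"]
      by (auto simp: coprime_iff_gcd_eq_1)
    thus False using xy n unfolding e by (auto simp: prime_factors_dvd)
  qed
  ultimately show ?thesis using that by (auto simp: form_act_def ABC)
qed

text \<open>Once \<open>C\<close> is invertible modulo \<open>n\<close>, adding a multiple of
  \<open>C\<close> to \<open>B\<close> reaches the residue \<nu>. The discriminant relation then
  makes \<open>n\<close> divide the product of the outer coefficients, hence the first one.\<close>

lemma form_equiv_level_form:
  assumes Q: "Q \<in> primitive_forms D" and n: "n \<ge> 1" and \<nu>: "[\<nu>\<^sup>2 = D] (mod n)"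
  shows "\<exists>Q'\<in>level_forms D n \<nu>. form_equiv Q Q'"
proof -
  obtain A B C where 1: "form_equiv Q (A, B, C)" and co: "coprime C n"
    using form_equiv_coprime_coefficient[OF Q n] .
  obtain R where R: "[C * R = 1] (mod n)" using co cong_solve_coprime_int by blast
  define t where "t = R * (\<nu> - B)"
  define A' B' where "A' = A + 2 * B * t + C * t\<^sup>2" and "B' = B + C * t"
  have 2: "form_equiv (A, B, C) (A', B', C)"
    unfolding form_equiv_def
    by (rule exI[of _ 1], rule exI[of _ 0], rule exI[of _ t], rule exI[of _ 1])
       (simp add: form_act_def A'_def B'_def)
  have eq: "form_equiv Q (A', B', C)" using form_equiv_trans[OF 1 2] .
  have P: "(A', B', C) \<in> primitive_forms D" using form_equiv_primitive[OF eq Q] .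
  have "[B + (C * R) * (\<nu> - B) = B + 1 * (\<nu> - B)] (mod n)"
    using R by (intro cong_add cong_mult cong_refl)
  hence B': "[B' = \<nu>] (mod n)" by (simp add: B'_def t_def mult.assoc)
  have "[B'\<^sup>2 = D] (mod n)" using cong_trans[OF cong_pow[OF B'] \<nu>] .
  hence "n dvd B'\<^sup>2 - D" by (simp add: cong_iff_dvd_diff)
  hence "n dvd A' * C" using P by (auto simp: primitive_forms_def)
  hence "n dvd A'" using co by (simp add: coprime_commute coprime_dvd_mult_left_iff)
  thus ?thesis using eq P B' by (auto simp: level_forms_def)
qed

text \<open>Choosing the least absolute value of the first coefficient in the class gives
  \<open>2 * |B| \<le> |A| \<le> |C|\<close>, which bounds all three coefficients by
  \<open>D\<close>. This yields finiteness of the number of classes.\<close>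

lemma form_equiv_reduced:
  assumes Q: "Q \<in> primitive_forms D"
  shows "\<exists>Q'\<in>{-D..D} \<times> {-D..D} \<times> {-D..D}. form_equiv Q Q'"
proof -
  obtain A B C where min: "form_equiv Q (A, B, C)"
    and least: "\<And>A' B' C'. form_equiv Q (A', B', C') \<Longrightarrow> nat \<bar>A\<bar> \<le> nat \<bar>A'\<bar>"
    using ex_has_least_nat[of "form_equiv Q" Q "\<lambda>q. nat \<bar>fst q\<bar>"] form_equiv_refl[of Q]
    by (metis fst_conv prod.exhaust_sel)
  have "A \<noteq> 0" using form_equiv_primitive[OF min Q] primitive_form_nz by blast
  \<comment> \<open>\<open>q\<close> is the integer nearest to \<open>B / |A|\<close>; the sign in
    \<open>k\<close> makes \<open>A * k = - q * |A|\<close>.\<close>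
  define q where "q = (2 * B + \<bar>A\<bar>) div (2 * \<bar>A\<bar>)"
  define k where "k = - q * sgn A"
  define B' C' where "B' = B + A * k" and "C' = A * k\<^sup>2 + 2 * B * k + C"
  have "2 * (A * k) = - (q * (2 * \<bar>A\<bar>))"
    unfolding k_def by (simp add: abs_if sgn_if)
  moreover have "2 * B + \<bar>A\<bar> = q * (2 * \<bar>A\<bar>) + (2 * B + \<bar>A\<bar>) mod (2 * \<bar>A\<bar>)"
    unfolding q_def by (rule div_mult_mod_eq[symmetric])
  moreover have "0 \<le> (2 * B + \<bar>A\<bar>) mod (2 * \<bar>A\<bar>)" "(2 * B + \<bar>A\<bar>) mod (2 * \<bar>A\<bar>) < 2 * \<bar>A\<bar>"
    using \<open>A \<noteq> 0\<close> by simp_all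
  moreover have "2 * \<bar>B + x\<bar> \<le> \<bar>A\<bar>"
    if "2 * x = - y" "2 * B + \<bar>A\<bar> = y + r" "0 \<le> r" "r < 2 * \<bar>A\<bar>" for x y r
    using that by arith
  ultimately have B': "2 * \<bar>B'\<bar> \<le> \<bar>A\<bar>" unfolding B'_def by blast
  have "form_equiv (A, B, C) (A, B', C')"
    unfolding form_equiv_def
    by (rule exI[of _ 1], rule exI[of _ k], rule exI[of _ 0], rule exI[of _ 1])
       (simp add: form_act_def B'_def C'_def)
  hence 1: "form_equiv Q (A, B', C')" using form_equiv_trans[OF min] by blast
  \<comment> \<open>The matrix (0, -1; 1, 0) exchanges the outer coefficients, so minimality applies
    to \<open>C'\<close> as well.\<close>
  have "form_equiv (A, B', C') (C', - B', A)"
    unfolding form_equiv_def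
    by (rule exI[of _ 0], rule exI[of _ "-1"], rule exI[of _ 1], rule exI[of _ 0])
       (simp add: form_act_def)
  hence "nat \<bar>A\<bar> \<le> nat \<bar>C'\<bar>" using form_equiv_trans[OF 1] least by blast
  hence AC: "\<bar>A\<bar> \<le> \<bar>C'\<bar>" by simp
  have P: "(A, B', C') \<in> primitive_forms D" using form_equiv_primitive[OF 1 Q] .
  have nz: "A \<noteq> 0" "C' \<noteq> 0" using primitive_form_nz[OF P] by auto
  have D: "D = B'\<^sup>2 - A * C'" using P by (auto simp: primitive_forms_def)
  have "4 * B'\<^sup>2 \<le> \<bar>A\<bar> * \<bar>A\<bar>" using mult_mono[OF B' B'] by (simp add: power2_eq_square)
  also have "\<dots> \<le> \<bar>A\<bar> * \<bar>C'\<bar>" using AC by (rule mult_left_mono) simp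
  finally have 4: "4 * B'\<^sup>2 \<le> \<bar>A * C'\<bar>" by (simp add: abs_mult)
  \<comment> \<open>A positive product \<open>A * C'\<close> would make \<open>D\<close> negative,
    because \<open>B'^2\<close> is at most a quarter of it.\<close>
  have D': "D = B'\<^sup>2 + \<bar>A * C'\<bar>" using 4 D D_gt_1 by (simp add: abs_if split: if_splits)
  have "\<bar>A\<bar> * 1 \<le> \<bar>A\<bar> * \<bar>C'\<bar>" "1 * \<bar>C'\<bar> \<le> \<bar>A\<bar> * \<bar>C'\<bar>"
    using nz by (intro mult_mono; simp)+
  hence AC_le: "\<bar>A\<bar> \<le> D" "\<bar>C'\<bar> \<le> D" using D' zero_le_power2[of B'] unfolding abs_mult by linarith+
  have "\<bar>B'\<bar> \<le> D" using B' AC_le by linarith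
  thus ?thesis using 1 AC_le by (intro bexI[of _ "(A, B', C')"]) auto
qed

end

section \<open>Ideal classes of \<open>\<int>[\<surd>D]\<close> and form classes\<close>

text \<open>The quotient (B + \<surd>D) / A of the two generators is an end point of the geodesic
  attached to the form.\<close>

definition form_lattice :: "int \<Rightarrow> int \<Rightarrow> int \<Rightarrow> real set" where
  "form_lattice D A B = {of_int x * of_int A + of_int y * (of_int B + sqrt (of_int D)) | x y. True}"

text \<open>Forms with \<open>A < 0\<close> need the factor \<open>\<surd>D\<close>, of negative norm, to get the correct narrow class.\<close>

definition form_ideal :: "int \<Rightarrow> form \<Rightarrow> real set" where
  "form_ideal D = (\<lambda>(A, B, C). (*) (if A > 0 then 1 else sqrt (of_int D)) ` form_lattice D A B)"

text \<open>This is the coset of \<open>I\<close> modulo the narrow principal ideals, described by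
  scaling instead of by ideal products.\<close>

definition narrow_ideal_class :: "int \<Rightarrow> real set \<Rightarrow> real set set" where
  "narrow_ideal_class D I = {(*) \<xi> ` I | \<xi>. totally_positive D \<xi>}"

lemma image_mult_image_mult: "(*) a ` (*) b ` S = (*) (a * b) ` S" for a b :: real
  by (simp add: image_image mult.assoc)

lemma image_mult_one [simp]: "(*) 1 ` S = S" for S :: "real set"
  by simp

lemma image_mult_cancel:
  fixes a :: real
  assumes "a \<noteq> 0" "(*) a ` S = T"
  shows "S = (*) (inverse a) ` T"
  using assms image_mult_image_mult[of "inverse a" a S] by simp

lemma image_uminus_mult:
  fixes a :: real
  assumes "\<And>x. x \<in> S \<Longrightarrow> - x \<in> S"
  shows "(*) (- a) ` S = (*) a ` S"
proof -
  have "\<exists>y\<in>S. - (a * x) = a * y" "\<exists>y\<in>S. a * x = - (a * y)" if "x \<in> S" for x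
    using assms[OF that] by (auto intro: bexI[of _ "- x"])
  thus ?thesis by auto
qed

lemma ideal_mult_sum_closed:
  fixes S :: "real set"
  assumes "0 \<in> S" "\<And>x y. x \<in> S \<Longrightarrow> y \<in> S \<Longrightarrow> x + y \<in> S"
    and "\<And>x y. x \<in> I \<Longrightarrow> y \<in> J \<Longrightarrow> x * y \<in> S"
  shows "ideal_mult I J \<subseteq> S"
proof -
  have "(\<Sum>i<N. a i * b i) \<in> S" if "\<forall>i<N. a i \<in> I \<and> b i \<in> J" for N :: nat and a b
    using that by (induction N) (auto intro: assms)
  thus ?thesis unfolding ideal_mult_def by blast
qed

lemma ideal_multI:
  "\<forall>i<N. a i \<in> I \<and> b i \<in> J \<Longrightarrow> (\<Sum>i<(N::nat). a i * b i) \<in> ideal_mult I J"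
  unfolding ideal_mult_def by blast

lemma ideal_mult_image_mult_subset:
  assumes "\<kappa> \<noteq> 0"
  shows "ideal_mult ((*) \<kappa> ` I) ((*) (inverse \<kappa>) ` J) \<subseteq> ideal_mult I J"
proof
  fix x assume "x \<in> ideal_mult ((*) \<kappa> ` I) ((*) (inverse \<kappa>) ` J)"
  then obtain N :: nat and a b where x: "x = (\<Sum>i<N. a i * b i)"
    and ab: "\<forall>i<N. a i \<in> (*) \<kappa> ` I \<and> b i \<in> (*) (inverse \<kappa>) ` J"
    unfolding ideal_mult_def by blast
  have "\<forall>i<N. inverse \<kappa> * a i \<in> I \<and> \<kappa> * b i \<in> J"
  proof (intro allI impI)
    fix i assume "i < N"
    with ab obtain u v where "u \<in> I" "v \<in> J" "a i = \<kappa> * u" "b i = inverse \<kappa> * v" by blast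
    thus "inverse \<kappa> * a i \<in> I \<and> \<kappa> * b i \<in> J" using assms by (simp add: mult.assoc[symmetric])
  qed
  hence "(\<Sum>i<N. (inverse \<kappa> * a i) * (\<kappa> * b i)) \<in> ideal_mult I J" by (rule ideal_multI)
  moreover have "(inverse \<kappa> * a i) * (\<kappa> * b i) = a i * b i" for i
    using assms by (simp add: field_simps)
  ultimately show "x \<in> ideal_mult I J" using x by simp
qed

lemma ideal_mult_image_mult:
  assumes "\<kappa> \<noteq> 0"
  shows "ideal_mult ((*) \<kappa> ` I) ((*) (inverse \<kappa>) ` J) = ideal_mult I J"
proof (rule antisym[OF ideal_mult_image_mult_subset[OF assms]])
  show "ideal_mult I J \<subseteq> ideal_mult ((*) \<kappa> ` I) ((*) (inverse \<kappa>) ` J)"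
    using ideal_mult_image_mult_subset[of "inverse \<kappa>" "(*) \<kappa> ` I" "(*) (inverse \<kappa>) ` J"] assms
    by (simp add: image_mult_image_mult)
qed

context squarefree_1_mod_4
begin

section \<open>Arithmetic and conjugation of \<rat>(\<surd>D) inside the reals\<close>

definition r :: real where "r = sqrt (of_int D)"

abbreviation K :: "real set" where "K \<equiv> quad_field D"

abbreviation \<O> :: "real set" where "\<O> \<equiv> quad_order D"

lemma r_pos: "r > 0"
  using D_gt_1 by (simp add: r_def)

lemma r_sq: "r * r = of_int D"
  using D_gt_1 by (simp add: r_def)

lemma mem_K_iff: "x \<in> K \<longleftrightarrow> (\<exists>a\<in>\<rat>. \<exists>b\<in>\<rat>. x = a + b * r)"
  unfolding quad_field_def Rats_def r_def by auto

lemma rat_independent: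
  fixes a b a' b' :: real
  assumes "a \<in> \<rat>" "b \<in> \<rat>" "a' \<in> \<rat>" "b' \<in> \<rat>" and eq: "a + b * r = a' + b' * r"
  shows "a = a' \<and> b = b'"
proof -
  have "b = b'"
  proof (rule ccontr)
    assume ne: "b \<noteq> b'"
    have "r = (a' - a) / (b - b')" using eq ne by (simp add: field_simps)
    hence "r \<in> \<rat>" using assms by simp
    then obtain p q :: int where pq: "q \<noteq> 0" "r = of_int p / of_int q"
      by (elim Rats_cases') (metis less_irrefl)
    have "of_int p = r * of_int q" using pq by simp
    hence "(of_int p :: real)\<^sup>2 = of_int D * (of_int q)\<^sup>2"
      using r_sq by (simp add: power2_eq_square algebra_simps)
    hence "(of_int (p\<^sup>2) :: real) = of_int (D * q\<^sup>2)" by simp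
    hence "p\<^sup>2 = D * q\<^sup>2" by (simp only: of_int_eq_iff)
    thus False using square_eq_D_mult_square pq(1) by blast
  qed
  thus ?thesis using eq by simp
qed

lemma int_independent:
  fixes x y x' y' :: int
  assumes "of_int x + of_int y * r = of_int x' + of_int y' * r"
  shows "x = x'" "y = y'"
  using rat_independent[of "of_int x" "of_int y" "of_int x'" "of_int y'"] assms by auto

text \<open>Field elements are plain real numbers here, so the conjugate has to be read off from
  their rational coordinates; linear independence of 1 and \<surd>D over \<rat> makes it well
  defined on \<open>K\<close>.\<close>

definition qconj :: "real \<Rightarrow> real" where
  "qconj x = (THE y. \<exists>a\<in>\<rat>. \<exists>b\<in>\<rat>. x = a + b * r \<and> y = a - b * r)"

lemma qconj_eq:
  assumes "a \<in> \<rat>" "b \<in> \<rat>"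
  shows "qconj (a + b * r) = a - b * r"
  unfolding qconj_def
proof (rule the_equality)
  fix y assume "\<exists>a'\<in>\<rat>. \<exists>b'\<in>\<rat>. a + b * r = a' + b' * r \<and> y = a' - b' * r"
  thus "y = a - b * r" using rat_independent assms by metis
qed (use assms in blast)

lemma K_mult_aux: "(a + b * r) * (c + d * r) = (a * c + b * d * of_int D) + (a * d + b * c) * r"
  using r_sq by (simp add: algebra_simps)

lemma K_add: "x \<in> K \<Longrightarrow> y \<in> K \<Longrightarrow> x + y \<in> K"
proof -
  assume "x \<in> K" "y \<in> K"
  then obtain a b c d where h: "a \<in> \<rat>" "b \<in> \<rat>" "c \<in> \<rat>" "d \<in> \<rat>" "x = a + b * r" "y = c + d * r"
    unfolding mem_K_iff by metis
  hence "x + y = (a + c) + (b + d) * r" by (simp add: algebra_simps)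
  thus ?thesis unfolding mem_K_iff using h by (meson Rats_add)
qed

lemma K_mult: "x \<in> K \<Longrightarrow> y \<in> K \<Longrightarrow> x * y \<in> K"
  and qconj_mult: "x \<in> K \<Longrightarrow> y \<in> K \<Longrightarrow> qconj (x * y) = qconj x * qconj y"
proof -
  assume "x \<in> K" "y \<in> K"
  then obtain a b c d where h: "a \<in> \<rat>" "b \<in> \<rat>" "c \<in> \<rat>" "d \<in> \<rat>" "x = a + b * r" "y = c + d * r"
    unfolding mem_K_iff by metis
  have e: "x * y = (a * c + b * d * of_int D) + (a * d + b * c) * r"
    unfolding h by (rule K_mult_aux)
  have R: "a * c + b * d * of_int D \<in> \<rat>" "a * d + b * c \<in> \<rat>" using h by simp_all
  show "x * y \<in> K" unfolding mem_K_iff using e R by blast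
  show "qconj (x * y) = qconj x * qconj y"
  proof -
    have "qconj (x * y) = (a * c + b * d * of_int D) - (a * d + b * c) * r"
      unfolding e by (rule qconj_eq[OF R])
    also have "\<dots> = (a - b * r) * (c - d * r)" by (simp add: r_sq[symmetric] algebra_simps)
    finally show ?thesis using h by (simp add: qconj_eq)
  qed
qed

lemma K_of_int [simp]: "of_int x \<in> K" and K_r [simp]: "r \<in> K"
proof -
  show "of_int x \<in> K" unfolding mem_K_iff by (rule bexI[of _ "of_int x"], rule bexI[of _ 0]) auto
  show "r \<in> K" unfolding mem_K_iff by (rule bexI[of _ 0], rule bexI[of _ 1]) auto
qed

lemma qconj_int [simp]: "qconj (of_int x + of_int y * r) = of_int x - of_int y * r"
  by (rule qconj_eq) auto

lemma qconj_of_int [simp]: "qconj (of_int x) = of_int x" and qconj_r [simp]: "qconj r = - r"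
  using qconj_int[of x 0] qconj_int[of 0 1] by simp_all

lemma qconj_one [simp]: "qconj 1 = 1"
  using qconj_of_int[of 1] by simp

lemma K_one [simp]: "1 \<in> K"
  using K_of_int[of 1] by simp

lemma K_inverse: "x \<in> K \<Longrightarrow> inverse x \<in> K"
proof -
  assume "x \<in> K"
  then obtain a b where h: "a \<in> \<rat>" "b \<in> \<rat>" "x = a + b * r" unfolding mem_K_iff by blast
  show ?thesis
  proof (cases "x = 0")
    case True
    thus ?thesis using K_of_int[of 0] by simp
  next
    case False
    define N where "N = a * a - b * b * of_int D"
    have N: "x * (a - b * r) = N" unfolding h N_def using r_sq by (simp add: algebra_simps)
    have "a - b * r \<noteq> 0"
    proof
      assume "a - b * r = 0"
      hence "a + (- b) * r = 0 + 0 * r" by simp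
      hence "a = 0 \<and> - b = 0" using h by (intro rat_independent) auto
      thus False using False h by simp
    qed
    hence "N \<noteq> 0" using False N by auto
    hence "inverse x = a / N + (- b / N) * r" using N False by (simp add: field_simps)
    moreover have "a / N \<in> \<rat>" "- b / N \<in> \<rat>" using h by (simp_all add: N_def)
    ultimately show ?thesis unfolding mem_K_iff by blast
  qed
qed

lemma K_divide: "x \<in> K \<Longrightarrow> y \<in> K \<Longrightarrow> x / y \<in> K"
  using K_mult K_inverse by (simp add: divide_inverse)

lemma qconj_inverse:
  assumes "x \<in> K" "x \<noteq> 0"
  shows "qconj (inverse x) = inverse (qconj x)"
proof -
  have "qconj x * qconj (inverse x) = 1"
    using qconj_mult[OF assms(1) K_inverse[OF assms(1)]] assms(2) by simp
  thus ?thesis by (simp add: inverse_unique)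
qed

lemma qconj_divide: "x \<in> K \<Longrightarrow> y \<in> K \<Longrightarrow> y \<noteq> 0 \<Longrightarrow> qconj (x / y) = qconj x / qconj y"
  by (simp add: divide_inverse qconj_mult qconj_inverse K_inverse)

lemma norm_rat: "x \<in> K \<Longrightarrow> x * qconj x \<in> \<rat>"
proof -
  assume "x \<in> K"
  then obtain a b where h: "a \<in> \<rat>" "b \<in> \<rat>" "x = a + b * r" unfolding mem_K_iff by blast
  have "x * qconj x = a * a - b * b * of_int D"
    unfolding h(3) qconj_eq[OF h(1,2)] by (simp add: r_sq[symmetric] algebra_simps)
  thus ?thesis using h by simp
qed

lemma totally_positive_iff: "totally_positive D \<xi> \<longleftrightarrow> \<xi> \<in> K \<and> \<xi> > 0 \<and> qconj \<xi> > 0"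
proof
  assume "totally_positive D \<xi>"
  thus "\<xi> \<in> K \<and> \<xi> > 0 \<and> qconj \<xi> > 0"
    unfolding totally_positive_def quad_field_def r_def[symmetric] using qconj_eq by fastforce
next
  assume h: "\<xi> \<in> K \<and> \<xi> > 0 \<and> qconj \<xi> > 0"
  then obtain a b where "\<xi> = of_rat a + of_rat b * r"
    unfolding quad_field_def r_def[symmetric] by blast
  thus "totally_positive D \<xi>"
    unfolding totally_positive_def r_def[symmetric] using h qconj_eq[of "of_rat a" "of_rat b"] by auto
qed

lemma totally_positive_one: "totally_positive D 1"
  by (simp add: totally_positive_iff)

lemma totally_positive_mult:
  "totally_positive D x \<Longrightarrow> totally_positive D y \<Longrightarrow> totally_positive D (x * y)"
  by (simp add: totally_positive_iff K_mult qconj_mult)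

lemma totally_positive_inverse: "totally_positive D x \<Longrightarrow> totally_positive D (inverse x)"
  by (simp add: totally_positive_iff K_inverse qconj_inverse)

text \<open>A positive norm means that \<eta> and its conjugate have the same sign. If both are
  negative, then -\<eta> is totally positive and scales a symmetric set to the same image, so only
  the sign of the norm has to be controlled.\<close>

lemma totally_positive_image:
  assumes "\<eta> \<in> K" "\<eta> * qconj \<eta> > 0" "\<And>x. x \<in> S \<Longrightarrow> - x \<in> S"
  obtains \<xi> where "totally_positive D \<xi>" "(*) \<eta> ` S = (*) \<xi> ` S"
proof (cases "\<eta> > 0")
  case True
  hence "totally_positive D \<eta>" using assms by (simp add: totally_positive_iff zero_less_mult_iff)
  thus ?thesis using that by blast
next
  case False
  have "- \<eta> = of_int (- 1) * \<eta>" by simp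
  hence "- \<eta> \<in> K" "qconj (- \<eta>) = - qconj \<eta>"
    using K_mult[OF K_of_int[of "-1"] assms(1)] qconj_mult[OF K_of_int[of "-1"] assms(1)]
      qconj_of_int[of "-1"]
    by simp_all
  hence "totally_positive D (- \<eta>)"
    using assms False by (simp add: totally_positive_iff zero_less_mult_iff)
  thus ?thesis using that image_uminus_mult[OF assms(3), of \<eta>] by blast
qed

lemma narrow_ideal_class_eq_iff:
  "narrow_ideal_class D I = narrow_ideal_class D J \<longleftrightarrow> (\<exists>\<xi>. totally_positive D \<xi> \<and> J = (*) \<xi> ` I)"
proof
  assume "narrow_ideal_class D I = narrow_ideal_class D J"
  moreover have "J \<in> narrow_ideal_class D J"
    unfolding narrow_ideal_class_def using totally_positive_one image_mult_one[of J] by blast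
  ultimately have "J \<in> narrow_ideal_class D I" by simp
  thus "\<exists>\<xi>. totally_positive D \<xi> \<and> J = (*) \<xi> ` I"
    unfolding narrow_ideal_class_def by auto
next
  assume "\<exists>\<xi>. totally_positive D \<xi> \<and> J = (*) \<xi> ` I"
  then obtain \<xi> where \<xi>: "totally_positive D \<xi>" "J = (*) \<xi> ` I" by blast
  have "\<xi> \<noteq> 0" using \<xi> by (auto simp: totally_positive_iff)
  hence I: "I = (*) (inverse \<xi>) ` J" using \<xi> image_mult_cancel by metis
  have sub: "narrow_ideal_class D ((*) \<zeta> ` L) \<subseteq> narrow_ideal_class D L"
    if \<zeta>: "totally_positive D \<zeta>" for \<zeta> L
  proof
    fix S assume "S \<in> narrow_ideal_class D ((*) \<zeta> ` L)"
    then obtain \<eta> where \<eta>: "totally_positive D \<eta>" "S = (*) (\<eta> * \<zeta>) ` L"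
      unfolding narrow_ideal_class_def image_mult_image_mult by auto
    thus "S \<in> narrow_ideal_class D L"
      unfolding narrow_ideal_class_def using totally_positive_mult[OF \<eta>(1) \<zeta>] by auto
  qed
  show "narrow_ideal_class D I = narrow_ideal_class D J"
    using sub[OF \<xi>(1), of I, folded \<xi>(2)]
      sub[OF totally_positive_inverse[OF \<xi>(1)], of J, folded I] by (rule antisym[rotated])
qed

section \<open>Fractional ideals of \<int>[\<surd>D] and their narrow classes\<close>

lemma mem_O_iff: "x \<in> \<O> \<longleftrightarrow> (\<exists>a b. x = of_int a + of_int b * r)"
  unfolding quad_order_def r_def by simp

lemma O_I: "of_int a + of_int b * r \<in> \<O>"
  unfolding mem_O_iff by blast

lemma O_one: "1 \<in> \<O>" and O_zero: "0 \<in> \<O>" and O_of_int: "of_int a \<in> \<O>" and O_r: "r \<in> \<O>"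
  using O_I[of 1 0] O_I[of 0 0] O_I[of a 0] O_I[of 0 1] by simp_all

lemma O_add: "x \<in> \<O> \<Longrightarrow> y \<in> \<O> \<Longrightarrow> x + y \<in> \<O>"
proof -
  assume "x \<in> \<O>" "y \<in> \<O>"
  then obtain a b c d where h: "x = of_int a + of_int b * r" "y = of_int c + of_int d * r"
    unfolding mem_O_iff by metis
  have "x + y = of_int (a + c) + of_int (b + d) * r" unfolding h by (simp add: algebra_simps)
  thus ?thesis unfolding mem_O_iff by blast
qed

lemma O_mult: "x \<in> \<O> \<Longrightarrow> y \<in> \<O> \<Longrightarrow> x * y \<in> \<O>"
proof -
  assume "x \<in> \<O>" "y \<in> \<O>"
  then obtain a b c d where h: "x = of_int a + of_int b * r" "y = of_int c + of_int d * r"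
    unfolding mem_O_iff by metis
  have "x * y = of_int (a * c + b * d * D) + of_int (a * d + b * c) * r"
    unfolding h K_mult_aux by simp
  thus ?thesis unfolding mem_O_iff by blast
qed

lemma O_subset_K: "\<O> \<subseteq> K"
  unfolding mem_O_iff subset_iff using K_add K_mult by auto

lemma K_common_denominator:
  assumes "x \<in> K"
  shows "\<exists>N::int. N > 0 \<and> of_int N * x \<in> \<O>"
proof -
  obtain a b where h: "a \<in> \<rat>" "b \<in> \<rat>" "x = a + b * r" using assms unfolding mem_K_iff by blast
  obtain p q where a: "q > 0" "a = of_int p / of_int q" using h(1) by (elim Rats_cases') auto
  obtain p' q' where b: "q' > 0" "b = of_int p' / of_int q'" using h(2) by (elim Rats_cases') auto
  have "of_int (q * q') * x = of_int (p * q') + of_int (p' * q) * r"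
    unfolding h a(2) b(2) using a(1) b(1) by (simp add: field_simps)
  hence "of_int (q * q') * x \<in> \<O>" unfolding mem_O_iff by blast
  thus ?thesis using a b by (intro exI[of _ "q * q'"]) auto
qed

lemma fractional_ideal_zero: "fractional_ideal D I \<Longrightarrow> 0 \<in> I"
  and fractional_ideal_add: "fractional_ideal D I \<Longrightarrow> x \<in> I \<Longrightarrow> y \<in> I \<Longrightarrow> x + y \<in> I"
  and fractional_ideal_mult: "fractional_ideal D I \<Longrightarrow> s \<in> \<O> \<Longrightarrow> x \<in> I \<Longrightarrow> s * x \<in> I"
  unfolding fractional_ideal_def by auto

lemma fractional_ideal_of_int_mult: "fractional_ideal D I \<Longrightarrow> x \<in> I \<Longrightarrow> of_int a * x \<in> I"
  using fractional_ideal_mult O_of_int by blast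

lemma fractional_ideal_uminus: "fractional_ideal D I \<Longrightarrow> x \<in> I \<Longrightarrow> - x \<in> I"
  using fractional_ideal_of_int_mult[of I x "-1"] by simp

lemma fractional_ideal_image_mult:
  assumes I: "fractional_ideal D I" and \<kappa>: "\<kappa> \<in> K" "\<kappa> \<noteq> 0"
  shows "fractional_ideal D ((*) \<kappa> ` I)"
proof -
  obtain d where d: "d \<in> \<O>" "d \<noteq> 0" "\<forall>x\<in>I. d * x \<in> \<O>"
    using I unfolding fractional_ideal_def by blast
  obtain M :: int where M: "M > 0" "of_int M * \<kappa> \<in> \<O>"
    using K_common_denominator[OF \<kappa>(1)] by blast
  obtain x where x: "x \<in> I" "x \<noteq> 0" using I unfolding fractional_ideal_def by blast
  have "(of_int M * d) * (\<kappa> * y) \<in> \<O>" if "y \<in> I" for y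
    using O_mult[OF M(2)] d(3) that by (metis mult.assoc mult.left_commute)
  hence "\<exists>d\<in>\<O>. d \<noteq> 0 \<and> (\<forall>x\<in>(*) \<kappa> ` I. d * x \<in> \<O>)"
    using M(1) d O_mult[OF O_of_int d(1), of M] by (intro bexI[of _ "of_int M * d"]) auto
  moreover have "(*) \<kappa> ` I \<subseteq> K" using I K_mult[OF \<kappa>(1)] unfolding fractional_ideal_def by blast
  moreover have "0 \<in> (*) \<kappa> ` I" using fractional_ideal_zero[OF I] by force
  moreover have "(*) \<kappa> ` I \<noteq> {0}" using x \<kappa>(2) by (metis image_eqI mult_eq_0_iff singletonD)
  moreover have "u + v \<in> (*) \<kappa> ` I" if "u \<in> (*) \<kappa> ` I" "v \<in> (*) \<kappa> ` I" for u v
    using that fractional_ideal_add[OF I] by (auto simp: distrib_left[symmetric])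
  moreover have "s * u \<in> (*) \<kappa> ` I" if "s \<in> \<O>" "u \<in> (*) \<kappa> ` I" for s u
    using that fractional_ideal_mult[OF I] by (auto simp: mult.left_commute)
  ultimately show ?thesis unfolding fractional_ideal_def by simp
qed

lemma invertible_ideal_image_mult:
  assumes I: "invertible_ideal D I" and \<kappa>: "\<kappa> \<in> K" "\<kappa> \<noteq> 0"
  shows "invertible_ideal D ((*) \<kappa> ` I)"
proof -
  obtain J where J: "fractional_ideal D J" "ideal_mult I J = \<O>"
    using I unfolding invertible_ideal_def by blast
  have "fractional_ideal D ((*) (inverse \<kappa>) ` J)"
    using fractional_ideal_image_mult[OF J(1)] K_inverse \<kappa> by simp
  moreover have "ideal_mult ((*) \<kappa> ` I) ((*) (inverse \<kappa>) ` J) = \<O>"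
    using ideal_mult_image_mult[OF \<kappa>(2)] J(2) by simp
  ultimately show ?thesis
    using I fractional_ideal_image_mult[OF _ \<kappa>] unfolding invertible_ideal_def by blast
qed

text \<open>Multiplying by a principal ideal amounts to scaling by its generator.\<close>

lemma narrow_coset_eq:
  assumes I: "fractional_ideal D I"
  shows "narrow_principal_ideals D #>\<^bsub>ideal_group D\<^esub> I = narrow_ideal_class D I"
proof -
  have "ideal_mult ((*) \<xi> ` \<O>) I = (*) \<xi> ` I" for \<xi>
  proof
    show "ideal_mult ((*) \<xi> ` \<O>) I \<subseteq> (*) \<xi> ` I"
      using fractional_ideal_zero[OF I] fractional_ideal_add[OF I] fractional_ideal_mult[OF I]
      by (intro ideal_mult_sum_closed) (force, auto simp: distrib_left[symmetric] mult.assoc)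
    show "(*) \<xi> ` I \<subseteq> ideal_mult ((*) \<xi> ` \<O>) I"
    proof
      fix z assume "z \<in> (*) \<xi> ` I"
      then obtain x where x: "x \<in> I" "z = \<xi> * x" by blast
      have "\<xi> * 1 \<in> (*) \<xi> ` \<O>" using O_one by blast
      hence "(\<Sum>i<(1::nat). (\<xi> * 1) * x) \<in> ideal_mult ((*) \<xi> ` \<O>) I"
        using x(1) by (intro ideal_multI[where a = "\<lambda>_. \<xi> * 1" and b = "\<lambda>_. x"]) simp
      thus "z \<in> ideal_mult ((*) \<xi> ` \<O>) I" using x by simp
    qed
  qed
  thus ?thesis
    unfolding r_coset_def narrow_principal_ideals_def narrow_ideal_class_def ideal_group_def
    by (auto simp: fun_eq_iff)
qed

text \<open>The order of the quotient is its number of cosets, so that the class number is a count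
  of classes as sets.\<close>

lemma narrow_class_number_eq:
  "narrow_class_number D = card (narrow_ideal_class D ` {I. invertible_ideal D I})"
proof -
  have "rcosets\<^bsub>ideal_group D\<^esub> narrow_principal_ideals D
      = (\<lambda>I. narrow_principal_ideals D #>\<^bsub>ideal_group D\<^esub> I) ` {I. invertible_ideal D I}"
    unfolding RCOSETS_def by (auto simp: ideal_group_def)
  also have "\<dots> = narrow_ideal_class D ` {I. invertible_ideal D I}"
    by (rule image_cong) (auto simp: narrow_coset_eq invertible_ideal_def)
  finally show ?thesis
    unfolding narrow_class_number_def Coset.order_def FactGroup_def by simp
qed

section \<open>Lattices of forms as ideals\<close>

lemma mem_form_lattice_iff:
  "z \<in> form_lattice D A B \<longleftrightarrow> (\<exists>x y. z = of_int x * of_int A + of_int y * (of_int B + r))"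
  unfolding form_lattice_def r_def by auto

lemma form_lattice_generators: "of_int A \<in> form_lattice D A B" "of_int B + r \<in> form_lattice D A B"
proof -
  show "of_int A \<in> form_lattice D A B"
    unfolding mem_form_lattice_iff by (rule exI[of _ 1], rule exI[of _ 0]) simp
  show "of_int B + r \<in> form_lattice D A B"
    unfolding mem_form_lattice_iff by (rule exI[of _ 0], rule exI[of _ 1]) simp
qed

lemma form_lattice_subset_O: "form_lattice D A B \<subseteq> \<O>"
proof
  fix z assume "z \<in> form_lattice D A B"
  then obtain x y where "z = of_int x * of_int A + of_int y * (of_int B + r)"
    unfolding mem_form_lattice_iff by blast
  hence "z = of_int (x * A + y * B) + of_int y * r" by (simp add: algebra_simps)
  thus "z \<in> \<O>" unfolding mem_O_iff by blast
qed

lemma form_lattice_fractional_ideal: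
  assumes "B\<^sup>2 - A * C = D"
  shows "fractional_ideal D (form_lattice D A B)"
proof -
  have rr: "r * r = of_int B * of_int B - of_int A * of_int C"
    using r_sq assms[symmetric] by (simp add: power2_eq_square)
  have add: "u + v \<in> form_lattice D A B" if uv: "u \<in> form_lattice D A B" "v \<in> form_lattice D A B" for u v
  proof -
    obtain x y x' y' where "u = of_int x * of_int A + of_int y * (of_int B + r)"
      "v = of_int x' * of_int A + of_int y' * (of_int B + r)"
      using uv unfolding mem_form_lattice_iff by metis
    hence "u + v = of_int (x + x') * of_int A + of_int (y + y') * (of_int B + r)"
      by (simp add: algebra_simps)
    thus ?thesis unfolding mem_form_lattice_iff by blast
  qed
  have mult: "s * u \<in> form_lattice D A B" if su: "s \<in> \<O>" "u \<in> form_lattice D A B" for s u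
  proof -
    obtain a b where s: "s = of_int a + of_int b * r" using su(1) unfolding mem_O_iff by blast
    obtain x y where u: "u = of_int x * of_int A + of_int y * (of_int B + r)"
      using su(2) unfolding mem_form_lattice_iff by blast
    have "s * u = of_int a * u + of_int b * (of_int x * of_int A * r + of_int y * (of_int B * r + r * r))"
      unfolding s u by (simp add: algebra_simps)
    \<comment> \<open>The coefficients of \<open>b\<close> express multiplication by \<surd>D in the
      basis \<open>A\<close>, \<open>B + r\<close>: \<open>r * A\<close> is
      \<open>A * (B + r) - B * A\<close>, and \<open>r * (B + r)\<close> is
      \<open>B * (B + r) - C * A\<close>.\<close>
    also have "\<dots> = of_int (a * x - b * (x * B + y * C)) * of_int A
                + of_int (a * y + b * (x * A + y * B)) * (of_int B + r)"
      unfolding u rr by (simp add: algebra_simps)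
    finally show ?thesis unfolding mem_form_lattice_iff by blast
  qed
  have zero: "0 \<in> form_lattice D A B"
    unfolding mem_form_lattice_iff by (rule exI[of _ 0], rule exI[of _ 0]) simp
  have "of_int B + r \<noteq> 0" using int_independent(2)[of B 1 0 0] by auto
  hence "form_lattice D A B \<noteq> {0}" using form_lattice_generators(2)[of B A] by auto
  moreover have "\<exists>d\<in>\<O>. d \<noteq> 0 \<and> (\<forall>x\<in>form_lattice D A B. d * x \<in> \<O>)"
    using form_lattice_subset_O[of A B] O_one by (intro bexI[of _ 1]) auto
  ultimately show ?thesis
    unfolding fractional_ideal_def
    using add mult zero form_lattice_subset_O[of A B] O_subset_K by blast
qed

text \<open>The inverse is the conjugate lattice divided by \<open>A\<close>. The product of the two
  contains \<open>A\<close>, \<open>2 * B\<close> and \<open>C\<close>, which by primitivity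
  generate 1.\<close>

lemma form_lattice_invertible:
  assumes Q: "(A, B, C) \<in> primitive_forms D"
  shows "invertible_ideal D (form_lattice D A B)"
proof -
  have D: "B\<^sup>2 - A * C = D" "(- B)\<^sup>2 - A * C = D" using Q by (auto simp: primitive_forms_def)
  have A: "A \<noteq> 0" using primitive_form_nz[OF Q] by blast
  have rr: "r * r = of_int B * of_int B - of_int A * of_int C"
    using r_sq D(1)[symmetric] by (simp add: power2_eq_square)
  define \<alpha> \<beta> where "\<alpha> = inverse (of_int A :: real)" and "\<beta> = \<alpha> * (of_int (- B) + r)"
  define J where "J = (*) \<alpha> ` form_lattice D A (- B)"
  have \<alpha>: "\<alpha> * of_int A = 1" "of_int A * \<alpha> = 1" using A by (simp_all add: \<alpha>_def)
  have J: "fractional_ideal D J"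
    unfolding J_def \<alpha>_def using A form_lattice_fractional_ideal[OF D(2)] K_inverse[OF K_of_int]
    by (intro fractional_ideal_image_mult) auto
  have I: "fractional_ideal D (form_lattice D A B)" by (rule form_lattice_fractional_ideal[OF D(1)])
  have "ideal_mult (form_lattice D A B) J \<subseteq> \<O>"
  proof (rule ideal_mult_sum_closed[OF O_zero O_add])
    fix u v assume u: "u \<in> form_lattice D A B" and "v \<in> J"
    then obtain v' where "v' \<in> form_lattice D A (- B)" "v = \<alpha> * v'" unfolding J_def by blast
    with u obtain x y x' y' where u: "u = of_int x * of_int A + of_int y * (of_int B + r)"
      and v: "v = \<alpha> * (of_int x' * of_int A + of_int y' * (of_int (- B) + r))"
      unfolding mem_form_lattice_iff by blast
    have "u * v = \<alpha> * (of_int A * (of_int x * of_int x' * of_int A + of_int x * of_int y' * (r - of_int B)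
            + of_int y * of_int x' * (of_int B + r)) + of_int y * of_int y' * (r * r - of_int B * of_int B))"
      unfolding u v by (simp add: algebra_simps)
    also have "\<dots> = (\<alpha> * of_int A) * (of_int x * of_int x' * of_int A + of_int x * of_int y' * (r - of_int B)
            + of_int y * of_int x' * (of_int B + r) - of_int y * of_int y' * of_int C)"
      unfolding rr by (simp add: algebra_simps)
    also have "\<dots> = of_int (x * x' * A - x * y' * B + y * x' * B - y * y' * C) + of_int (x * y' + y * x') * r"
      unfolding \<alpha> by (simp add: algebra_simps)
    finally show "u * v \<in> \<O>" unfolding mem_O_iff by blast
  qed
  moreover have "\<O> \<subseteq> ideal_mult (form_lattice D A B) J"
  proof
    fix z assume z: "z \<in> \<O>"
    obtain s t w where stw: "s * A + t * (2 * B) + w * C = 1" using primitive_form_bezout[OF Q] .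
    \<comment> \<open>The summands realise the Bezout relation: the generators times 1 give
      \<open>A\<close> and \<open>B + r\<close>, and times \<beta> they give \<open>r - B\<close>
      and \<open>- C\<close>. The second minus the third is \<open>2 * B\<close>.\<close>
    define a :: "nat \<Rightarrow> real" where
      "a i = (if i = 0 then z * (of_int s * of_int A) else if i = 1 then z * (of_int t * (of_int B + r))
         else if i = 2 then z * (of_int (- t) * of_int A) else z * (of_int (- w) * (of_int B + r)))" for i
    define b :: "nat \<Rightarrow> real" where "b i = (if i < 2 then 1 else \<beta>)" for i
    have "\<alpha> * of_int A \<in> J" "\<beta> \<in> J"
      unfolding J_def \<beta>_def using form_lattice_generators[of A "- B"] form_lattice_generators[of "- B" A] by auto
    hence "b i \<in> J" for i unfolding b_def \<alpha> by simp
    moreover have "a i \<in> form_lattice D A B" for i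
      unfolding a_def using form_lattice_generators[of A B] form_lattice_generators[of B A]
      by (auto intro!: fractional_ideal_mult[OF I z] fractional_ideal_of_int_mult[OF I]
            simp del: of_int_minus)
    ultimately have "(\<Sum>i<4. a i * b i) \<in> ideal_mult (form_lattice D A B) J"
      by (intro ideal_multI) blast
    moreover have "(\<Sum>i<4. a i * b i) = z"
    proof -
      have "(\<Sum>i<4. a i * b i) = z * (of_int s * of_int A + of_int t * (of_int B + r)
          - of_int t * (of_int A * \<alpha>) * (r - of_int B) - of_int w * \<alpha> * (r * r - of_int B * of_int B))"
        by (simp add: a_def b_def \<beta>_def eval_nat_numeral algebra_simps)
      also have "\<dots> = z * (of_int s * of_int A + of_int t * (2 * of_int B) + of_int w * of_int C * (of_int A * \<alpha>))"
        unfolding rr by (simp add: \<alpha> algebra_simps)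
      also have "\<dots> = z * of_int (s * A + t * (2 * B) + w * C)" unfolding \<alpha> by simp
      finally show ?thesis unfolding stw by simp
    qed
    ultimately show "z \<in> ideal_mult (form_lattice D A B) J" by simp
  qed
  ultimately show ?thesis unfolding invertible_ideal_def using I J by blast
qed

text \<open>If \<open>A\<close> and \<open>C\<close> are even, then the lattice is stable under \<open>(1 + \<surd>D) / 2\<close>, which is not in \<open>\<int>[\<surd>D]\<close>.\<close>

lemma invertible_form_lattice_primitive:
  assumes inv: "invertible_ideal D (form_lattice D A B)" and D: "B\<^sup>2 - A * C = D"
  shows "(A, B, C) \<in> primitive_forms D"
proof (rule ccontr)
  assume "(A, B, C) \<notin> primitive_forms D"
  hence "even A" "even C" using D by (auto simp: primitive_forms_def)
  moreover from this have "odd B" using D odd_D by auto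
  ultimately obtain A' B' C' where e: "A = 2 * A'" "B = 2 * B' + 1" "C = 2 * C'"
    by (elim evenE oddE)
  have rr: "r * r = of_int B * of_int B - of_int A * of_int C"
    using r_sq D[symmetric] by (simp add: power2_eq_square)
  define w where "w = (1 + r) / 2"
  have w2: "2 * w = 1 + r" by (simp add: w_def)
  obtain J where J: "fractional_ideal D J" "ideal_mult (form_lattice D A B) J = \<O>"
    using inv unfolding invertible_ideal_def by blast
  have stable: "w * u \<in> form_lattice D A B" if mem: "u \<in> form_lattice D A B" for u
  proof -
    obtain x y where u: "u = of_int x * of_int A + of_int y * (of_int B + r)"
      using mem unfolding mem_form_lattice_iff by blast
    have "2 * (w * u) = (of_int x * of_int A + of_int y * of_int B) + (of_int x * of_int A + of_int y * of_int B + of_int y) * r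
        + of_int y * (r * r)"
      unfolding mult.assoc[symmetric] w2 u by (simp add: algebra_simps)
    also have "\<dots> = 2 * (of_int (- x * B' - y * C') * of_int A + of_int (x * A' + y * (B' + 1)) * (of_int B + r))"
      unfolding rr e by (simp add: algebra_simps)
    finally have "w * u = of_int (- x * B' - y * C') * of_int A + of_int (x * A' + y * (B' + 1)) * (of_int B + r)"
      by simp
    thus ?thesis unfolding mem_form_lattice_iff by blast
  qed
  obtain N :: nat and a b where ab: "1 = (\<Sum>i<N. a i * b i)" "\<forall>i<N. a i \<in> form_lattice D A B \<and> b i \<in> J"
    using O_one unfolding J(2)[symmetric] ideal_mult_def by blast
  \<comment> \<open>The lattice absorbs \<open>w\<close> and 1 lies in its product with
    \<open>J\<close>, so \<open>w\<close> lies in the product too, that is, in \<int>[\<surd>D]; but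
    its coordinates are halves.\<close>
  have "w = (\<Sum>i<N. w * a i * b i)"
    using arg_cong[OF ab(1), of "\<lambda>x. w * x"] by (simp add: sum_distrib_left mult.assoc)
  also have "\<dots> \<in> ideal_mult (form_lattice D A B) J"
    using ab(2) stable by (intro ideal_multI) blast
  finally have "w \<in> \<O>" unfolding J(2) .
  then obtain x y where "w = of_int x + of_int y * r" unfolding mem_O_iff by blast
  hence "of_int 1 + of_int 1 * r = of_int (2 * x) + of_int (2 * y) * r" using w2 by simp
  hence "1 = 2 * x" using int_independent by blast
  thus False by presburger
qed

text \<open>After clearing denominators, a Hermite basis is chosen: \<open>a\<close> is the least
  positive integer in the lattice and \<open>b\<close> the least positive coefficient of \<surd>D.
  Stability under \<surd>D makes \<open>b\<close> divide both \<open>a\<close> and the rational part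
  \<open>c\<close>, so \<open>b\<close> factors out and leaves the basis of a form.\<close>

lemma fractional_ideal_eq_form_lattice:
  assumes I: "fractional_ideal D I"
  obtains \<kappa> A B C where "\<kappa> \<in> K" "\<kappa> \<noteq> 0" "A > 0" "B\<^sup>2 - A * C = D" "I = (*) \<kappa> ` form_lattice D A B"
proof -
  obtain d where d: "d \<in> \<O>" "d \<noteq> 0" "\<forall>x\<in>I. d * x \<in> \<O>"
    using I unfolding fractional_ideal_def by blast
  define L where "L = (*) d ` I"
  have dK: "d \<in> K" using d O_subset_K by blast
  have L: "fractional_ideal D L" unfolding L_def by (rule fractional_ideal_image_mult[OF I dK d(2)])
  have L_O: "L \<subseteq> \<O>" unfolding L_def using d by blast
  have L_sub: "x - y \<in> L" if "x \<in> L" "y \<in> L" for x y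
    using fractional_ideal_add[OF L that(1) fractional_ideal_uminus[OF L that(2)]] by simp
  note L_int = fractional_ideal_of_int_mult[OF L]
  obtain x where x: "x \<in> L" "x \<noteq> 0" using L unfolding fractional_ideal_def by blast
  obtain p q where pq: "x = of_int p + of_int q * r" using x L_O unfolding subset_iff mem_O_iff by blast
  \<comment> \<open>Multiplying a nonzero element by its conjugate puts its norm, a nonzero integer,
    into \<open>L\<close>.\<close>
  have "(of_int p + of_int (- q) * r) * x \<in> L" using fractional_ideal_mult[OF L O_I x(1)] .
  also have "(of_int p + of_int (- q) * r) * x = of_int (p\<^sup>2 - D * q\<^sup>2)"
    unfolding pq by (simp add: r_sq[symmetric] algebra_simps power2_eq_square)
  finally have pL: "of_int (p\<^sup>2 - D * q\<^sup>2) \<in> L" .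
  have "p\<^sup>2 - D * q\<^sup>2 \<noteq> 0"
    using square_eq_D_mult_square[of p q] x(2) pq by auto
  hence "\<exists>a::nat. a > 0 \<and> of_nat a \<in> L"
    using pL fractional_ideal_uminus[OF L pL]
    by (intro exI[of _ "nat \<bar>p\<^sup>2 - D * q\<^sup>2\<bar>"]) (auto simp: abs_if)
  then obtain a :: nat where a: "a > 0" "of_nat a \<in> L"
    and a_least: "\<And>a'. a' > 0 \<Longrightarrow> of_nat a' \<in> L \<Longrightarrow> a \<le> a'"
    using exists_least_iff[of "\<lambda>a. a > 0 \<and> real a \<in> L"] by (metis not_less)
  have a_dvd: "int a dvd u" if "of_int u \<in> L" for u
  proof -
    have "of_int u - of_int (u div int a) * of_int (int a) \<in> L"
      using L_sub[OF that L_int[OF a(2), of "u div int a"]] by simp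
    also have "of_int u - of_int (u div int a) * of_int (int a) = real_of_int (u mod int a)"
      by (simp add: minus_div_mult_eq_mod[symmetric])
    finally have "real (nat (u mod int a)) \<in> L" using a(1) by simp
    hence "\<not> nat (u mod int a) > 0" using a_least[of "nat (u mod int a)"] a(1)
      by (metis not_less pos_mod_bound pos_mod_sign nat_less_iff of_nat_0_less_iff)
    hence "u mod int a = 0" using pos_mod_sign[of "int a" u] a(1) by linarith
    thus ?thesis by (simp add: dvd_eq_mod_eq_0)
  qed
  have ar: "of_int 0 + of_int (int a) * r \<in> L"
    using fractional_ideal_mult[OF L O_r a(2)] by (simp add: mult.commute)
  hence "\<exists>b::nat. b > 0 \<and> (\<exists>u. of_int u + of_nat b * r \<in> L)"
    using a(1) by (metis of_int_of_nat_eq)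
  then obtain b :: nat where b: "b > 0" "\<exists>u. of_int u + of_nat b * r \<in> L"
    and b_least: "\<And>b'. b' > 0 \<Longrightarrow> \<exists>u. of_int u + of_nat b' * r \<in> L \<Longrightarrow> b \<le> b'"
    using exists_least_iff[of "\<lambda>b. b > 0 \<and> (\<exists>u. of_int u + real b * r \<in> L)"] by (metis not_less)
  obtain c where c: "of_int c + of_nat b * r \<in> L" using b(2) by blast
  have b_dvd: "int b dvd v" if "of_int u + of_int v * r \<in> L" for u v
  proof -
    have "(of_int u + of_int v * r) - of_int (v div int b) * (of_int c + of_nat b * r) \<in> L"
      using L_sub[OF that L_int[OF c]] .
    also have "(of_int u + of_int v * r) - of_int (v div int b) * (of_int c + of_nat b * r)
      = of_int (u - v div int b * c) + real_of_int (v mod int b) * r"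
      by (simp add: minus_div_mult_eq_mod[symmetric] algebra_simps)
    finally have "of_int (u - v div int b * c) + real (nat (v mod int b)) * r \<in> L" using b(1) by simp
    hence "\<not> nat (v mod int b) > 0" using b_least[of "nat (v mod int b)"] b(1)
      by (metis not_less pos_mod_bound pos_mod_sign nat_less_iff of_nat_0_less_iff)
    hence "v mod int b = 0" using pos_mod_sign[of "int b" v] b(1) by linarith
    thus ?thesis by (simp add: dvd_eq_mod_eq_0)
  qed
  obtain A where A: "int a = int b * A" using b_dvd[OF ar] by blast
  have "A > 0" using A a(1) b(1) by (metis of_nat_0_less_iff zero_less_mult_pos)
  have "r * (of_int c + of_nat b * r) \<in> L" using fractional_ideal_mult[OF L O_r c] .
  also have "r * (of_int c + of_nat b * r) = of_int (int b * D) + of_int c * r"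
    by (simp add: r_sq[symmetric] algebra_simps)
  finally obtain B where B: "c = int b * B" using b_dvd by blast
  \<comment> \<open>The second basis element is \<open>b * (B + r)\<close>; multiplied by
    \<open>B - r\<close> it becomes an integer in \<open>L\<close>, hence a multiple of
    \<open>a = b * A\<close>. This is the divisibility that defines \<open>C\<close>.\<close>
  have "(of_int B + of_int (- 1) * r) * (of_int c + of_nat b * r) \<in> L"
    using fractional_ideal_mult[OF L O_I c] .
  also have "(of_int B + of_int (- 1) * r) * (of_int c + of_nat b * r) = of_int (int b * (B\<^sup>2 - D))"
    unfolding B by (simp add: r_sq[symmetric] algebra_simps power2_eq_square)
  finally have "int b * A dvd int b * (B\<^sup>2 - D)" using a_dvd A by metis
  hence "A dvd B\<^sup>2 - D" using b(1) by simp
  then obtain C where "B\<^sup>2 - D = A * C" by blast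
  hence C: "B\<^sup>2 - A * C = D" by simp
  have L_eq: "L = (*) (of_nat b) ` form_lattice D A B"
  proof
    show "(*) (of_nat b) ` form_lattice D A B \<subseteq> L"
    proof
      fix z assume "z \<in> (*) (of_nat b) ` form_lattice D A B"
      then obtain w where "w \<in> form_lattice D A B" "z = of_nat b * w" by blast
      then obtain s t where "z = of_nat b * (of_int s * of_int A + of_int t * (of_int B + r))"
        unfolding mem_form_lattice_iff by blast
      hence "z = of_int s * of_int (int b * A) + of_int t * (of_int (int b * B) + of_nat b * r)"
        by (simp add: algebra_simps)
      hence "z = of_int s * of_nat a + of_int t * (of_int c + of_nat b * r)"
        unfolding A[symmetric] B[symmetric] by simp
      thus "z \<in> L" using fractional_ideal_add[OF L L_int[OF a(2)] L_int[OF c]] by simp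
    qed
    show "L \<subseteq> (*) (of_nat b) ` form_lattice D A B"
    proof
      fix z assume z: "z \<in> L"
      then obtain u v where uv: "z = of_int u + of_int v * r" using L_O unfolding subset_iff mem_O_iff by blast
      obtain t where t: "v = int b * t" using b_dvd z uv by blast
      have "z - of_int t * (of_int c + of_nat b * r) \<in> L" using L_sub[OF z L_int[OF c]] .
      also have "z - of_int t * (of_int c + of_nat b * r) = of_int (u - t * c)"
        unfolding uv t by (simp add: algebra_simps)
      finally obtain s where s: "u - t * c = int a * s" using a_dvd by blast
      hence "u = int b * (A * s + t * B)" unfolding A B by (simp add: algebra_simps)
      hence "z = of_nat b * (of_int s * of_int A + of_int t * (of_int B + r))"
        unfolding uv t by (simp add: algebra_simps)
      moreover have "of_int s * of_int A + of_int t * (of_int B + r) \<in> form_lattice D A B"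
        unfolding mem_form_lattice_iff by blast
      ultimately show "z \<in> (*) (of_nat b) ` form_lattice D A B" by blast
    qed
  qed
  have "I = (*) (inverse d) ` L" using image_mult_cancel[OF d(2) L_def[symmetric]] .
  hence "I = (*) (inverse d * of_int (int b)) ` form_lattice D A B"
    unfolding L_eq image_mult_image_mult by simp
  moreover have "inverse d * of_int (int b) \<in> K" using K_mult K_inverse dK K_of_int by blast
  moreover have "inverse d * of_int (int b) \<noteq> 0" using d(2) b(1) by simp
  ultimately show ?thesis using that \<open>A > 0\<close> C by metis
qed

section \<open>Form classes and narrow ideal classes correspond\<close>

abbreviation orientation_factor :: "int \<Rightarrow> real" where
  "orientation_factor A \<equiv> (if A > 0 then 1 else r)"

lemma form_ideal_eq: "form_ideal D (A, B, C) = (*) (orientation_factor A) ` form_lattice D A B"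
  by (simp add: form_ideal_def r_def)

lemma orientation_factor_K: "orientation_factor A \<in> K"
  by simp

lemma orientation_factor_nz: "orientation_factor A \<noteq> 0"
  using r_pos by simp

text \<open>\<surd>D has norm -D, so the norm of the factor has the sign of \<open>A\<close>. This
  restores the orientation that the lattice forgets.\<close>

lemma orientation_factor_norm:
  "A \<noteq> 0 \<Longrightarrow> orientation_factor A * qconj (orientation_factor A) * of_int A > 0"
  using r_pos by (auto simp: mult_pos_neg)

lemma form_ideal_fractional_ideal:
  assumes "B\<^sup>2 - A * C = D"
  shows "fractional_ideal D (form_ideal D (A, B, C))"
  unfolding form_ideal_eq
  by (intro fractional_ideal_image_mult form_lattice_fractional_ideal[OF assms]
      orientation_factor_K orientation_factor_nz)

lemma qconj_nz: "x \<in> K \<Longrightarrow> x \<noteq> 0 \<Longrightarrow> qconj x \<noteq> 0"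
  using qconj_mult[of x "inverse x"] K_inverse[of x] by auto

text \<open>
  Multiplication by \<open>\<surd>D\<close> on the lattice has the matrix \<open>(B, -C; A, -B)\<close> of the form, so that a base
  change conjugates this matrix.
\<close>

lemma form_equiv_imp_lattice:
  assumes Q: "(A, B, C) \<in> primitive_forms D" and eq: "form_equiv (A, B, C) (A', B', C')"
  obtains \<xi> where "\<xi> \<in> K" "\<xi> \<noteq> 0" "\<xi> * qconj \<xi> * of_int A' = of_int A"
    "form_lattice D A B = (*) \<xi> ` form_lattice D A' B'"
proof -
  obtain a b c d where det: "a * d - b * c = 1" and act: "(A', B', C') = form_act a b c d (A, B, C)"
    using eq unfolding form_equiv_def by blast
  have A'_def: "A' = A * d\<^sup>2 + 2 * B * c * d + C * c\<^sup>2"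
    and B'_def: "B' = A * b * d + B * (a * d + b * c) + C * a * c"
    using act by (auto simp: form_act_def)
  have Q': "(A', B', C') \<in> primitive_forms D" using form_equiv_primitive[OF eq Q] .
  have nz: "A \<noteq> 0" "A' \<noteq> 0" using primitive_form_nz Q Q' by blast+
  have D: "B\<^sup>2 - A * C = D" using Q by (auto simp: primitive_forms_def)
  have rr: "r * r = of_int B * of_int B - of_int A * of_int C"
    using r_sq D[symmetric] by (simp add: power2_eq_square)
  have detr: "of_int a * of_int d - of_int b * of_int c = (1::real)"
    using arg_cong[OF det, of real_of_int] by simp
  \<comment> \<open>\<open>w1\<close>, \<open>w2\<close> is the image of the basis
    \<open>B + r\<close>, \<open>A\<close> under the matrix (a, b; c, d). The factor \<xi> is chosen
    to carry \<open>A'\<close> to \<open>w2\<close>; it must then carry \<open>B' + r\<close> to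
    \<open>w1\<close>.\<close>
  define w2 where "w2 = of_int c * (of_int B + r) + of_int d * of_int A"
  define w1 where "w1 = of_int a * (of_int B + r) + of_int b * of_int A"
  define \<xi> where "\<xi> = w2 / of_int A'"
  have w2_eq: "w2 = of_int (c * B + d * A) + of_int c * r" by (simp add: w2_def algebra_simps)
  have w2K: "w2 \<in> K" unfolding w2_eq using O_I O_subset_K by blast
  have w2': "qconj w2 = of_int (c * B + d * A) - of_int c * r" unfolding w2_eq by (rule qconj_int)
  have N: "w2 * qconj w2 = of_int A * of_int A'"
  proof -
    have "w2 * qconj w2 = (of_int (c * B + d * A))\<^sup>2 - (of_int c)\<^sup>2 * (r * r)"
      unfolding w2' unfolding w2_eq by (simp add: power2_eq_square algebra_simps)
    also have "\<dots> = of_int A * of_int A'"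
      unfolding rr A'_def by (simp add: power2_eq_square algebra_simps)
    finally show ?thesis .
  qed
  have w2_nz: "w2 \<noteq> 0" using N nz by auto
  have \<xi>K: "\<xi> \<in> K" "\<xi> \<noteq> 0" unfolding \<xi>_def using w2K w2_nz nz K_divide by auto
  have "\<xi> * qconj \<xi> = (w2 * qconj w2) / (of_int A' * of_int A')"
    unfolding \<xi>_def using w2K nz by (simp add: qconj_divide)
  hence norm: "\<xi> * qconj \<xi> * of_int A' = of_int A"
    unfolding N using nz by (simp add: field_simps)
  have \<xi>A: "\<xi> * of_int A' = w2" unfolding \<xi>_def using nz by simp
  \<comment> \<open>This is the lower row of the action of \<surd>D on \<open>w1\<close>,
    \<open>w2\<close>, whose matrix is the conjugated one.\<close>
  have "w2 * (of_int B' + r) = of_int A' * w1"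
  proof -
    have "w2 * (of_int B' + r) - of_int A' * w1
      = (of_int c * of_int B + of_int d * of_int A) * of_int B' + of_int c * (r * r) - of_int A' * (of_int a * of_int B + of_int b * of_int A)
        + (of_int c * of_int B' + of_int c * of_int B + of_int d * of_int A - of_int a * of_int A') * r"
      unfolding w1_def w2_def by (simp add: algebra_simps)
    moreover have "c * B' + c * B + d * A - a * A' = 0"
      using det unfolding A'_def B'_def by algebra
    from arg_cong[OF this, of real_of_int]
    have "of_int c * of_int B' + of_int c * of_int B + of_int d * of_int A - of_int a * of_int A' = (0::real)"
      by simp
    moreover have "(c * B + d * A) * B' + c * (B * B - A * C) - A' * (a * B + b * A) = 0"
      using det unfolding A'_def B'_def by algebra
    from arg_cong[OF this, of real_of_int]
    have "(of_int c * of_int B + of_int d * of_int A) * of_int B' + of_int c * (of_int B * of_int B - of_int A * of_int C)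
        - of_int A' * (of_int a * of_int B + of_int b * of_int A) = (0::real)"
      by simp
    ultimately show ?thesis unfolding rr by simp
  qed
  hence \<xi>B: "\<xi> * (of_int B' + r) = w1" unfolding \<xi>_def using nz by (simp add: field_simps)
  have A_eq: "of_int A = of_int a * w2 - of_int c * w1"
  proof -
    have "of_int a * w2 - of_int c * w1 = (of_int a * of_int d - of_int b * of_int c) * of_int A"
      unfolding w1_def w2_def by (simp add: algebra_simps)
    thus ?thesis using detr by simp
  qed
  have B_eq: "of_int B + r = of_int d * w1 - of_int b * w2"
  proof -
    have "of_int d * w1 - of_int b * w2 = (of_int a * of_int d - of_int b * of_int c) * (of_int B + r)"
      unfolding w1_def w2_def by (simp add: algebra_simps)
    thus ?thesis using detr by simp
  qed
  have "form_lattice D A B = (*) \<xi> ` form_lattice D A' B'"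
  proof
    show "form_lattice D A B \<subseteq> (*) \<xi> ` form_lattice D A' B'"
    proof
      fix z assume "z \<in> form_lattice D A B"
      then obtain x y where "z = of_int x * of_int A + of_int y * (of_int B + r)"
        unfolding mem_form_lattice_iff by blast
      hence "z = of_int (a * x - b * y) * w2 + of_int (d * y - c * x) * w1"
        unfolding A_eq B_eq by (simp add: algebra_simps)
      hence "z = \<xi> * (of_int (a * x - b * y) * of_int A' + of_int (d * y - c * x) * (of_int B' + r))"
        unfolding \<xi>A[symmetric] \<xi>B[symmetric] by (simp only: distrib_left mult.left_commute)
      moreover have "of_int (a * x - b * y) * of_int A' + of_int (d * y - c * x) * (of_int B' + r) \<in> form_lattice D A' B'"
        unfolding mem_form_lattice_iff by blast
      ultimately show "z \<in> (*) \<xi> ` form_lattice D A' B'" by blast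
    qed
    show "(*) \<xi> ` form_lattice D A' B' \<subseteq> form_lattice D A B"
    proof
      fix z assume "z \<in> (*) \<xi> ` form_lattice D A' B'"
      then obtain u where "u \<in> form_lattice D A' B'" and z: "z = \<xi> * u" by blast
      then obtain x y where "u = of_int x * of_int A' + of_int y * (of_int B' + r)"
        unfolding mem_form_lattice_iff by blast
      hence "z = of_int x * (\<xi> * of_int A') + of_int y * (\<xi> * (of_int B' + r))"
        unfolding z by (simp only: distrib_left mult.left_commute)
      hence "z = of_int (x * d + y * b) * of_int A + of_int (x * c + y * a) * (of_int B + r)"
        unfolding \<xi>A \<xi>B w1_def w2_def by (simp add: algebra_simps)
      thus "z \<in> form_lattice D A B" unfolding mem_form_lattice_iff by blast
    qed
  qed
  thus ?thesis using that \<xi>K norm by blast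
qed

text \<open>The lattices differ by a factor of norm \<open>A / A'\<close>. The orientation factors
  have norms with the signs of \<open>A\<close> and \<open>A'\<close>, so the ideals differ by a
  factor of positive norm, which may be taken totally positive.\<close>

lemma form_equiv_imp_narrow_ideal_class_eq:
  assumes Q: "Q \<in> primitive_forms D" and eq: "form_equiv Q Q'"
  shows "narrow_ideal_class D (form_ideal D Q') = narrow_ideal_class D (form_ideal D Q)"
proof -
  obtain A B C where ABC: "Q = (A, B, C)" by (cases Q)
  obtain A' B' C' where ABC': "Q' = (A', B', C')" by (cases Q')
  have Q': "(A', B', C') \<in> primitive_forms D" using form_equiv_primitive[OF eq Q] ABC' by simp
  have nz: "A \<noteq> 0" "A' \<noteq> 0" using primitive_form_nz Q Q' ABC by blast+
  obtain \<xi> where \<xi>: "\<xi> \<in> K" "\<xi> \<noteq> 0" "\<xi> * qconj \<xi> * of_int A' = of_int A"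
    "form_lattice D A B = (*) \<xi> ` form_lattice D A' B'"
    using form_equiv_imp_lattice[of A B C A' B' C'] Q eq ABC ABC' by blast
  define s s' where "s = orientation_factor A" and "s' = orientation_factor A'"
  have s: "s \<in> K" "s \<noteq> 0" "s' \<in> K" "s' \<noteq> 0"
    unfolding s_def s'_def using orientation_factor_K orientation_factor_nz by blast+
  define \<eta> where "\<eta> = s * \<xi> / s'"
  have \<eta>: "\<eta> \<in> K" unfolding \<eta>_def using \<xi> s K_mult K_divide by blast
  have F: "form_ideal D Q = (*) \<eta> ` form_ideal D Q'"
    unfolding ABC ABC' form_ideal_eq s_def[symmetric] s'_def[symmetric] \<xi>(4) image_mult_image_mult \<eta>_def
    using s by simp
  have c: "qconj s' \<noteq> 0" using qconj_nz s by blast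
  have "\<eta> * qconj \<eta> * (s' * qconj s') = (s * qconj s) * (\<xi> * qconj \<xi>)"
    unfolding \<eta>_def using s \<xi> c by (simp add: qconj_divide qconj_mult K_mult)
  hence "\<eta> * qconj \<eta> * (s' * qconj s' * of_int A') = (s * qconj s) * (\<xi> * qconj \<xi> * of_int A')"
    by (simp only: mult.assoc[symmetric])
  also have "\<dots> > 0" unfolding \<xi>(3) s_def by (rule orientation_factor_norm[OF nz(1)])
  finally have "\<eta> * qconj \<eta> > 0"
    using orientation_factor_norm[OF nz(2)] unfolding s'_def[symmetric]
    by (simp only: zero_less_mult_pos2)
  moreover have "fractional_ideal D (form_ideal D Q')"
    unfolding ABC' using Q' by (intro form_ideal_fractional_ideal) (auto simp: primitive_forms_def)
  ultimately obtain \<zeta> where "totally_positive D \<zeta>" "(*) \<eta> ` form_ideal D Q' = (*) \<zeta> ` form_ideal D Q'"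
    using totally_positive_image[OF \<eta>, of "form_ideal D Q'"] fractional_ideal_uminus by blast
  thus ?thesis unfolding narrow_ideal_class_eq_iff F by blast
qed

text \<open>A scaling between the two lattices gives integral base changes in both directions, whose
  determinants multiply to 1. The sign of the norm excludes -1, and the base change then carries one
  form to the other.\<close>

lemma narrow_ideal_class_eq_imp_form_equiv:
  assumes Q: "Q \<in> primitive_forms D" and Q': "Q' \<in> primitive_forms D"
    and eq: "narrow_ideal_class D (form_ideal D Q) = narrow_ideal_class D (form_ideal D Q')"
  shows "form_equiv Q Q'"
proof -
  obtain A B C where ABC: "Q = (A, B, C)" by (cases Q)
  obtain A' B' C' where ABC': "Q' = (A', B', C')" by (cases Q')
  have nz: "A \<noteq> 0" "A' \<noteq> 0" using primitive_form_nz Q Q' ABC ABC' by blast+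
  have D: "B\<^sup>2 - A * C = D" "B'\<^sup>2 - A' * C' = D"
    using Q Q' unfolding ABC ABC' by (auto simp: primitive_forms_def)
  obtain \<xi> where \<xi>: "totally_positive D \<xi>" "form_ideal D Q' = (*) \<xi> ` form_ideal D Q"
    using eq unfolding narrow_ideal_class_eq_iff by blast
  have \<xi>': "\<xi> \<in> K" "\<xi> \<noteq> 0" "\<xi> * qconj \<xi> > 0" using \<xi>(1) by (auto simp: totally_positive_iff)
  define s s' where "s = orientation_factor A" and "s' = orientation_factor A'"
  have s: "s \<in> K" "s \<noteq> 0" "s' \<in> K" "s' \<noteq> 0"
    unfolding s_def s'_def using orientation_factor_K orientation_factor_nz by blast+
  define \<zeta> where "\<zeta> = \<xi> * s / s'"
  have \<zeta>: "\<zeta> \<in> K" "\<zeta> \<noteq> 0" unfolding \<zeta>_def using \<xi>' s K_mult K_divide by auto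
  have lat: "form_lattice D A' B' = (*) \<zeta> ` form_lattice D A B"
  proof -
    have "(*) s' ` form_lattice D A' B' = (*) (\<xi> * s) ` form_lattice D A B"
      using \<xi>(2) unfolding ABC ABC' form_ideal_eq s_def[symmetric] s'_def[symmetric] image_mult_image_mult .
    from image_mult_cancel[OF s(4) this] show ?thesis
      unfolding image_mult_image_mult \<zeta>_def by (simp add: divide_inverse mult.commute)
  qed
  define N where "N = \<zeta> * qconj \<zeta>"
  \<comment> \<open>Total positivity of \<xi> and the orientation factors fix the sign of the norm
    of \<zeta>; this later makes the determinant positive.\<close>
  have N_pos: "N * of_int A * of_int A' > 0"
  proof -
    have c: "qconj s' \<noteq> 0" using qconj_nz s by blast
    have "N * (s' * qconj s') = (s * qconj s) * (\<xi> * qconj \<xi>)"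
      unfolding N_def \<zeta>_def using s \<xi>' c by (simp add: qconj_divide qconj_mult K_mult)
    hence "N * of_int A * (s' * qconj s') = (s * qconj s * of_int A) * (\<xi> * qconj \<xi>)"
      by (simp add: ac_simps)
    also have "\<dots> > 0" using orientation_factor_norm[OF nz(1)] \<xi>'(3) unfolding s_def[symmetric] by simp
    finally have "N * of_int A * (s' * qconj s') > 0" .
    moreover have "s' * qconj s' * of_int A' > 0" using orientation_factor_norm[OF nz(2)] unfolding s'_def .
    ultimately show ?thesis by (smt (verit) zero_less_mult_iff)
  qed
  have "of_int A' \<in> (*) \<zeta> ` form_lattice D A B" "of_int B' + r \<in> (*) \<zeta> ` form_lattice D A B"
    unfolding lat[symmetric] by (rule form_lattice_generators)+
  then obtain c d a b where cd: "of_int A' = \<zeta> * (of_int d * of_int A + of_int c * (of_int B + r))"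
    and ab: "of_int B' + r = \<zeta> * (of_int b * of_int A + of_int a * (of_int B + r))"
    unfolding image_iff mem_form_lattice_iff Bex_def by metis
  have lat': "form_lattice D A B = (*) (inverse \<zeta>) ` form_lattice D A' B'"
    using image_mult_cancel[OF \<zeta>(2) lat[symmetric]] .
  have "of_int A \<in> (*) (inverse \<zeta>) ` form_lattice D A' B'" "of_int B + r \<in> (*) (inverse \<zeta>) ` form_lattice D A' B'"
    unfolding lat'[symmetric] by (rule form_lattice_generators)+
  then obtain c' d' a' b' where cd': "of_int A = inverse \<zeta> * (of_int d' * of_int A' + of_int c' * (of_int B' + r))"
    and ab': "of_int B + r = inverse \<zeta> * (of_int b' * of_int A' + of_int a' * (of_int B' + r))"
    unfolding image_iff mem_form_lattice_iff Bex_def by metis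
  have conj: "of_int Y = qconj z * (of_int y * of_int X + of_int x * (of_int E - r))"
    if "z \<in> K" "of_int Y = z * (of_int y * of_int X + of_int x * (of_int E + r))" for z X Y E x y
  proof -
    have e: "of_int y * of_int X + of_int x * (of_int E + r) = of_int (y * X + x * E) + of_int x * r"
      by (simp add: algebra_simps)
    have "of_int Y = qconj (z * (of_int (y * X + x * E) + of_int x * r))"
      using that(2) unfolding e by (metis qconj_of_int)
    also have "\<dots> = qconj z * (of_int (y * X + x * E) - of_int x * r)"
      using O_I O_subset_K by (subst qconj_mult[OF that(1)]) (auto simp del: of_int_add)
    also have "of_int (y * X + x * E) - of_int x * r = of_int y * of_int X + of_int x * (of_int E - r)"
      by (simp add: algebra_simps)
    finally show ?thesis .
  qed
  \<comment> \<open>Since \<open>Y\<close> is its own conjugate, \<open>e * Y\<close> is the product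
    of \<open>e\<close> with a conjugate. Its coefficient of \<surd>D exhibits the determinant of
    the base change.\<close>
  have conj2: "e * of_int Y = (z * qconj z * of_int X) *
       of_int (v * y * X + (v * x + u * y) * E + u * x * F) + (z * qconj z * of_int X) * of_int (u * y - v * x) * r"
    if z: "z \<in> K" and Y: "of_int Y = z * (of_int y * of_int X + of_int x * (of_int E + r))"
      and e: "e = z * (of_int v * of_int X + of_int u * (of_int E + r))"
      and F: "E\<^sup>2 - X * F = D"
    for z X Y E F e x y u v
  proof -
    have rr: "r * r = of_int E * of_int E - of_int X * of_int F"
      using r_sq F[symmetric] by (simp add: power2_eq_square)
    have "e * of_int Y = (z * (of_int v * of_int X + of_int u * (of_int E + r)))
        * (qconj z * (of_int y * of_int X + of_int x * (of_int E - r)))"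
      unfolding e using conj[OF z Y] by metis
    also have "\<dots> = (z * qconj z) * (of_int v * of_int y * of_int X * of_int X
      + of_int v * of_int x * of_int X * (of_int E - r) + of_int u * of_int y * of_int X * (of_int E + r)
      + of_int u * of_int x * (of_int E * of_int E - r * r))"
      by (simp add: algebra_simps)
    also have "\<dots> = (z * qconj z * of_int X) *
       of_int (v * y * X + (v * x + u * y) * E + u * x * F) + (z * qconj z * of_int X) * of_int (u * y - v * x) * r"
      unfolding rr by (simp add: algebra_simps)
    finally show ?thesis .
  qed
  define N' where "N' = inverse \<zeta> * qconj (inverse \<zeta>)"
  have NN': "N * N' = 1"
    unfolding N_def N'_def qconj_inverse[OF \<zeta>] using \<zeta> qconj_nz[OF \<zeta>] by (simp add: field_simps)
  have N_rat: "N \<in> \<rat>" "N' \<in> \<rat>"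
    unfolding N_def N'_def using norm_rat \<zeta> K_inverse by blast+
  define \<delta> \<delta>' where "\<delta> = a * d - b * c" and "\<delta>' = a' * d' - b' * c'"
  define \<beta> where "\<beta> = b * d * A + (b * c + a * d) * B + a * c * C"
  have "of_int (A' * B') + of_int A' * r = (N * of_int A) * of_int \<beta> + (N * of_int A * of_int \<delta>) * r"
    using conj2[OF \<zeta>(1) cd ab D(1)] unfolding N_def \<beta>_def \<delta>_def by (simp add: algebra_simps)
  hence 1: "of_int (A' * B') = N * of_int A * of_int \<beta> \<and> of_int A' = N * of_int A * of_int \<delta>"
    using N_rat by (intro rat_independent) auto
  have "of_int (A * B) + of_int A * r = (N' * of_int A') * of_int (b' * d' * A' + (b' * c' + a' * d') * B' + a' * c' * C')
       + (N' * of_int A' * of_int \<delta>') * r"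
    using conj2[OF K_inverse[OF \<zeta>(1)] cd' ab' D(2)] unfolding N'_def \<delta>'_def by (simp add: algebra_simps)
  hence 2: "of_int (A * B) = N' * of_int A' * of_int (b' * d' * A' + (b' * c' + a' * d') * B' + a' * c' * C')
      \<and> of_int A = N' * of_int A' * of_int \<delta>'"
    using N_rat by (intro rat_independent) auto
  \<comment> \<open>There and back again: \<open>A' = N * A * \<delta>\<close> and
    \<open>A = N' * A' * \<delta>'\<close>, with \<open>N * N' = 1\<close>.\<close>
  have "of_int A' = (N * N') * of_int A' * (of_int \<delta>' * of_int \<delta>)"
    using 1 2 by (metis mult.assoc mult.commute mult.left_commute)
  hence "of_int (\<delta>' * \<delta>) = (1::real)" using NN' nz by simp
  hence "\<delta>' * \<delta> = 1" by linarith
  moreover have "\<delta> > 0"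
  proof -
    have "(N * of_int A * of_int A') * of_int \<delta> = of_int A' * of_int A'"
      using 1 by (simp add: algebra_simps)
    also have "\<dots> > 0" using nz by (simp add: zero_less_mult_iff) linarith
    finally show ?thesis using N_pos by (simp add: zero_less_mult_iff)
  qed
  ultimately have \<delta>: "\<delta> = 1" by (metis pos_zmult_eq_1_iff mult.commute)
  have NA: "N * of_int A = of_int A'" using 1 \<delta> by simp
  have "of_int A' * of_int B' = of_int A' * real_of_int \<beta>" using 1 unfolding NA by simp
  hence B': "B' = \<beta>" using nz by simp
  \<comment> \<open>Pairing the relation for \<open>A'\<close> with itself evaluates the form at (d,
    c).\<close>
  have "real_of_int A' * of_int A' = of_int A' * of_int (d * d * A + (d * c + c * d) * B + c * c * C)"
    using conj2[OF \<zeta>(1) cd cd D(1)] unfolding N_def[symmetric] NA by (simp add: mult.commute)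
  hence "real_of_int A' = of_int (d * d * A + (d * c + c * d) * B + c * c * C)" using nz by simp
  hence A': "A' = d * d * A + (d * c + c * d) * B + c * c * C" by (simp only: of_int_eq_iff)
  have det: "a * d - b * c = 1" using \<delta> \<delta>_def by simp
  \<comment> \<open>The last coefficient need only be named: it is determined by the discriminant
    and the other two, as \<open>A'\<close> is nonzero.\<close>
  obtain C'' where act: "form_act a b c d Q = (A', B', C'')"
    unfolding A' B' \<beta>_def ABC by (simp add: form_act_def power2_eq_square algebra_simps)
  have "form_act a b c d Q \<in> primitive_forms D" using form_act_primitive[OF Q det] .
  hence "A' * C'' = A' * C'" using D(2) unfolding act by (auto simp: primitive_forms_def)
  hence "Q' = form_act a b c d Q" using nz act ABC' by simp
  thus ?thesis unfolding form_equiv_def using det by blast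
qed

lemma narrow_ideal_class_form_ideal_iff:
  "Q \<in> primitive_forms D \<Longrightarrow> Q' \<in> primitive_forms D \<Longrightarrow>
    narrow_ideal_class D (form_ideal D Q) = narrow_ideal_class D (form_ideal D Q') \<longleftrightarrow> form_equiv Q Q'"
  using narrow_ideal_class_eq_imp_form_equiv form_equiv_imp_narrow_ideal_class_eq by metis

text \<open>Every invertible ideal is \<kappa> times the lattice of a primitive form with
  \<open>A > 0\<close>. If \<kappa> has negative norm, the form \<open>(- A, B, - C)\<close> is
  taken instead: it has the same lattice, and its factor \<surd>D turns the norm positive.\<close>

lemma narrow_ideal_classes_eq:
  "narrow_ideal_class D ` {I. invertible_ideal D I}
    = (\<lambda>Q. narrow_ideal_class D (form_ideal D Q)) ` primitive_forms D"
proof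
  show "(\<lambda>Q. narrow_ideal_class D (form_ideal D Q)) ` primitive_forms D
      \<subseteq> narrow_ideal_class D ` {I. invertible_ideal D I}"
  proof clarify
    fix A B C assume "(A, B, C) \<in> primitive_forms D"
    hence "invertible_ideal D (form_ideal D (A, B, C))"
      unfolding form_ideal_eq
      by (intro invertible_ideal_image_mult form_lattice_invertible orientation_factor_K orientation_factor_nz)
    thus "narrow_ideal_class D (form_ideal D (A, B, C)) \<in> narrow_ideal_class D ` {I. invertible_ideal D I}"
      by blast
  qed
  show "narrow_ideal_class D ` {I. invertible_ideal D I}
      \<subseteq> (\<lambda>Q. narrow_ideal_class D (form_ideal D Q)) ` primitive_forms D"
  proof clarify
    fix I assume inv: "invertible_ideal D I"
    hence I: "fractional_ideal D I" unfolding invertible_ideal_def by blast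
    obtain \<kappa> A B C where \<kappa>: "\<kappa> \<in> K" "\<kappa> \<noteq> 0" and A: "A > 0" and D: "B\<^sup>2 - A * C = D"
      and I_eq: "I = (*) \<kappa> ` form_lattice D A B"
      using fractional_ideal_eq_form_lattice[OF I] .
    have "invertible_ideal D (form_lattice D A B)"
      using invertible_ideal_image_mult[OF inv K_inverse[OF \<kappa>(1)]] \<kappa>(2)
      unfolding I_eq image_mult_image_mult by simp
    hence Q: "(A, B, C) \<in> primitive_forms D" using invertible_form_lattice_primitive D by blast
    have N_nz: "\<kappa> * qconj \<kappa> \<noteq> 0" using \<kappa> qconj_nz by simp
    have "\<exists>Q\<in>primitive_forms D. \<exists>\<eta>\<in>K. \<eta> * qconj \<eta> > 0 \<and> I = (*) \<eta> ` form_ideal D Q"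
    proof (cases "\<kappa> * qconj \<kappa> > 0")
      case True
      have "I = (*) \<kappa> ` form_ideal D (A, B, C)" unfolding I_eq form_ideal_eq using A by simp
      thus ?thesis using True Q \<kappa> by blast
    next
      case False
      have Q': "(- A, B, - C) \<in> primitive_forms D" using Q by (simp add: primitive_forms_def)
      have sub: "form_lattice D A B \<subseteq> form_lattice D (- A) B" for A
      proof
        fix z assume "z \<in> form_lattice D A B"
        then obtain x y where "z = of_int x * of_int A + of_int y * (of_int B + r)"
          unfolding mem_form_lattice_iff by blast
        hence "z = of_int (- x) * of_int (- A) + of_int y * (of_int B + r)" by simp
        thus "z \<in> form_lattice D (- A) B" unfolding mem_form_lattice_iff by blast
      qed
      have lat: "form_lattice D (- A) B = form_lattice D A B" using sub[of A] sub[of "- A"] by simp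
      have "I = (*) (\<kappa> / r) ` form_ideal D (- A, B, - C)"
        unfolding I_eq form_ideal_eq lat image_mult_image_mult using A r_pos by simp
      moreover have "\<kappa> / r \<in> K" using \<kappa> K_divide K_r by blast
      moreover have "(\<kappa> / r) * qconj (\<kappa> / r) = - (\<kappa> * qconj \<kappa>) / (r * r)"
        using \<kappa> r_pos by (simp add: qconj_divide)
      moreover have "\<kappa> * qconj \<kappa> < 0" using False N_nz by linarith
      hence "- (\<kappa> * qconj \<kappa>) / (r * r) > 0" using r_pos by (intro divide_pos_pos) auto
      ultimately show ?thesis using Q' by metis
    qed
    then obtain Q \<eta> where Q: "Q \<in> primitive_forms D" and \<eta>: "\<eta> \<in> K" "\<eta> * qconj \<eta> > 0"
      and I_eq: "I = (*) \<eta> ` form_ideal D Q" by blast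
    have "fractional_ideal D (form_ideal D Q)"
      using Q by (cases Q) (simp add: primitive_forms_def form_ideal_fractional_ideal)
    then obtain \<xi> where "totally_positive D \<xi>" "I = (*) \<xi> ` form_ideal D Q"
      unfolding I_eq using totally_positive_image[OF \<eta>] fractional_ideal_uminus by metis
    hence "narrow_ideal_class D I = narrow_ideal_class D (form_ideal D Q)"
      using narrow_ideal_class_eq_iff by blast
    thus "narrow_ideal_class D I \<in> (\<lambda>Q. narrow_ideal_class D (form_ideal D Q)) ` primitive_forms D"
      using Q by blast
  qed
qed

lemma form_class_representatives:
  obtains q :: "nat \<Rightarrow> form" where "\<And>k. k \<in> {1..narrow_class_number D} \<Longrightarrow> q k \<in> primitive_forms D"
    "\<And>Q. Q \<in> primitive_forms D \<Longrightarrow> \<exists>!k. k \<in> {1..narrow_class_number D} \<and> form_equiv (q k) Q"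
proof -
  define \<Phi> where "\<Phi> Q = narrow_ideal_class D (form_ideal D Q)" for Q
  have \<Phi>_iff: "\<Phi> Q = \<Phi> Q' \<longleftrightarrow> form_equiv Q Q'"
    if "Q \<in> primitive_forms D" "Q' \<in> primitive_forms D" for Q Q'
    unfolding \<Phi>_def using narrow_ideal_class_form_ideal_iff that .
  have h: "narrow_class_number D = card (\<Phi> ` primitive_forms D)"
    unfolding narrow_class_number_eq narrow_ideal_classes_eq \<Phi>_def ..
  \<comment> \<open>Finiteness is essential for the numbering by \<open>{1..h}\<close>, as an
    infinite set has \<open>card\<close> 0.\<close>
  have "\<Phi> ` primitive_forms D \<subseteq> \<Phi> ` ({-D..D} \<times> {-D..D} \<times> {-D..D})"
  proof clarify
    fix A B C assume Q: "(A, B, C) \<in> primitive_forms D"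
    then obtain Q' where Q': "Q' \<in> {-D..D} \<times> {-D..D} \<times> {-D..D}" "form_equiv (A, B, C) Q'"
      using form_equiv_reduced by blast
    hence "\<Phi> (A, B, C) = \<Phi> Q'" using \<Phi>_iff[OF Q form_equiv_primitive[OF Q'(2) Q]] by blast
    thus "\<Phi> (A, B, C) \<in> \<Phi> ` ({-D..D} \<times> {-D..D} \<times> {-D..D})" using Q'(1) by blast
  qed
  hence "finite (\<Phi> ` primitive_forms D)" by (rule finite_subset) auto
  then obtain e where e: "bij_betw e {1..narrow_class_number D} (\<Phi> ` primitive_forms D)"
    unfolding h using ex_bij_betw_nat_finite_1 by blast
  define q where "q k = (SOME Q. Q \<in> primitive_forms D \<and> \<Phi> Q = e k)" for k
  have q: "q k \<in> primitive_forms D \<and> \<Phi> (q k) = e k" if "k \<in> {1..narrow_class_number D}" for k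
  proof -
    have "e k \<in> \<Phi> ` primitive_forms D" using bij_betwE[OF e] that by blast
    hence "\<exists>Q. Q \<in> primitive_forms D \<and> \<Phi> Q = e k" by auto
    thus ?thesis unfolding q_def by (rule someI_ex)
  qed
  have "\<exists>!k. k \<in> {1..narrow_class_number D} \<and> form_equiv (q k) Q" if Q: "Q \<in> primitive_forms D" for Q
  proof -
    have "form_equiv (q k) Q \<longleftrightarrow> e k = \<Phi> Q" if "k \<in> {1..narrow_class_number D}" for k
      using q[OF that] \<Phi>_iff[of "q k" Q] Q by auto
    moreover have "\<exists>!k. k \<in> {1..narrow_class_number D} \<and> e k = \<Phi> Q"
      using e Q unfolding bij_betw_def inj_on_def by (metis (no_types, lifting) imageE imageI)
    ultimately show ?thesis by blast
  qed
  thus ?thesis using that q by blast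
qed

lemma level_form_class_representatives:
  assumes n: "n \<ge> 1" and \<nu>: "[\<nu>\<^sup>2 = D] (mod n)"
  obtains q :: "nat \<Rightarrow> form" where "\<And>k. k \<in> {1..narrow_class_number D} \<Longrightarrow> q k \<in> level_forms D n \<nu>"
    "\<And>Q. Q \<in> primitive_forms D \<Longrightarrow> \<exists>!k. k \<in> {1..narrow_class_number D} \<and> form_equiv (q k) Q"
proof -
  obtain q :: "nat \<Rightarrow> form" where q: "\<And>k. k \<in> {1..narrow_class_number D} \<Longrightarrow> q k \<in> primitive_forms D"
    "\<And>Q. Q \<in> primitive_forms D \<Longrightarrow> \<exists>!k. k \<in> {1..narrow_class_number D} \<and> form_equiv (q k) Q"
    using form_class_representatives by blast
  obtain q' where q': "\<And>k. k \<in> {1..narrow_class_number D} \<Longrightarrow> q' k \<in> level_forms D n \<nu> \<and> form_equiv (q k) (q' k)"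
    using form_equiv_level_form[OF q(1) n \<nu>] by metis
  have "form_equiv (q' k) Q \<longleftrightarrow> form_equiv (q k) Q" if "k \<in> {1..narrow_class_number D}" for k Q
    using q'[OF that] form_equiv_trans form_equiv_sym by blast
  hence "\<exists>!k. k \<in> {1..narrow_class_number D} \<and> form_equiv (q' k) Q" if "Q \<in> primitive_forms D" for Q
    using q(2)[OF that] by (metis (no_types, lifting))
  thus ?thesis using that q' by blast
qed

end

section \<open>Geodesics and Moebius transformations\<close>

lemma mat2_nth [simp]:
  "mat2 a b c d $ 1 $ 1 = a" "mat2 a b c d $ 1 $ 2 = b"
  "mat2 a b c d $ 2 $ 1 = c" "mat2 a b c d $ 2 $ 2 = d"
  by (simp_all add: mat2_def)

lemma mat2_eqI:
  fixes A B :: "real^2^2"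
  assumes "A $ 1 $ 1 = B $ 1 $ 1" "A $ 1 $ 2 = B $ 1 $ 2" "A $ 2 $ 1 = B $ 2 $ 1" "A $ 2 $ 2 = B $ 2 $ 2"
  shows "A = B"
  using assms by (simp add: vec_eq_iff forall_2)

lemma mat2_eq_iff [simp]: "mat2 a b c d = mat2 a' b' c' d' \<longleftrightarrow> a = a' \<and> b = b' \<and> c = c' \<and> d = d'"
  by (metis mat2_nth)

lemma mat2_exhaust:
  fixes A :: "real^2^2"
  obtains a b c d where "A = mat2 a b c d"
  using mat2_eqI[of A "mat2 (A$1$1) (A$1$2) (A$2$1) (A$2$2)"] by (simp add: that)

lemma mat2_mult [simp]:
  "mat2 a b c d ** mat2 a' b' c' d' = mat2 (a * a' + b * c') (a * b' + b * d') (c * a' + d * c') (c * b' + d * d')"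
  by (rule mat2_eqI) (simp_all add: matrix_matrix_mult_def sum_2)

lemma mat2_uminus [simp]: "- mat2 a b c d = mat2 (- a) (- b) (- c) (- d)"
  by (rule mat2_eqI) simp_all

lemma mat_1_eq_mat2: "mat 1 = mat2 1 0 0 1"
  by (rule mat2_eqI) (simp_all add: mat_def)

lemma det_mat2 [simp]: "det (mat2 a b c d) = a * d - b * c"
  by (simp add: det_2)

lemma matrix_inv_mat2:
  assumes "a * d - b * c = 1"
  shows "matrix_inv (mat2 a b c d) = mat2 d (- b) (- c) a"
  unfolding matrix_inv_def
proof (rule some_equality)
  show "mat2 a b c d ** mat2 d (- b) (- c) a = mat 1 \<and> mat2 d (- b) (- c) a ** mat2 a b c d = mat 1"
    using assms by (simp add: mat_1_eq_mat2 algebra_simps)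
  thus "A = mat2 d (- b) (- c) a"
    if "mat2 a b c d ** A = mat 1 \<and> A ** mat2 a b c d = mat 1" for A
    using that by (metis matrix_mul_assoc matrix_mul_lid matrix_mul_rid)
qed

lemma matrix_inv_det_1:
  fixes g :: "real^2^2"
  assumes "det g = 1"
  shows "g ** matrix_inv g = mat 1" "matrix_inv g ** g = mat 1" "det (matrix_inv g) = 1"
proof -
  obtain a b c d where g: "g = mat2 a b c d" by (rule mat2_exhaust)
  have "a * d - b * c = 1" using assms g by simp
  from matrix_inv_mat2[OF this] this
  show "g ** matrix_inv g = mat 1" "matrix_inv g ** g = mat 1" "det (matrix_inv g) = 1"
    unfolding g by (simp_all add: mat_1_eq_mat2 algebra_simps)
qed

abbreviation dilation :: "real \<Rightarrow> real^2^2" where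
  "dilation s \<equiv> mat2 s 0 0 (inverse s)"

lemma moebius_denominator_nz:
  fixes A :: "real^2^2"
  assumes "Im z > 0" "det A = 1"
  shows "of_real (A $ 2 $ 1) * z + of_real (A $ 2 $ 2) \<noteq> 0"
proof
  assume e: "of_real (A $ 2 $ 1) * z + of_real (A $ 2 $ 2) = 0"
  have "A $ 2 $ 1 * Im z = 0" using arg_cong[OF e, of Im] by simp
  hence "A $ 2 $ 1 = 0" using assms by simp
  moreover from this have "A $ 2 $ 2 = 0" using arg_cong[OF e, of Re] by simp
  ultimately show False using assms(2) by (simp add: det_2)
qed

lemma moebius_mult:
  assumes "Im z > 0" "det B = 1"
  shows "moebius (A ** B) z = moebius A (moebius B z)"
proof -
  obtain a b c d where A: "A = mat2 a b c d" by (rule mat2_exhaust)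
  obtain a' b' c' d' where B: "B = mat2 a' b' c' d'" by (rule mat2_exhaust)
  define u where "u = of_real c' * z + of_real d'"
  have u: "u \<noteq> 0" using moebius_denominator_nz[OF assms] by (simp add: B u_def)
  define v where "v = of_real a' * z + of_real b'"
  have "moebius A (moebius B z) = (of_real a * (v / u) + of_real b) / (of_real c * (v / u) + of_real d)"
    by (simp add: moebius_def A B u_def v_def)
  also have "of_real a * (v / u) + of_real b = (of_real a * v + of_real b * u) / u"
    using u by (simp add: field_simps)
  also have "of_real c * (v / u) + of_real d = (of_real c * v + of_real d * u) / u"
    using u by (simp add: field_simps)
  also have "(of_real a * v + of_real b * u) / u / ((of_real c * v + of_real d * u) / u)
      = (of_real a * v + of_real b * u) / (of_real c * v + of_real d * u)"
    using u by simp
  also have "\<dots> = moebius (A ** B) z"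
    by (simp add: moebius_def A B u_def v_def algebra_simps)
  finally show ?thesis ..
qed

lemma moebius_mat_1 [simp]: "moebius (mat 1) z = z"
  by (simp add: moebius_def mat_1_eq_mat2)

lemma moebius_eq_Complex:
  assumes det: "a * d - b * c = 1"
  shows "moebius (mat2 a b c d) (Complex x y) = 
    Complex (((a * x + b) * (c * x + d) + a * c * y\<^sup>2) / ((c * x + d)\<^sup>2 + (c * y)\<^sup>2)) (y / ((c * x + d)\<^sup>2 + (c * y)\<^sup>2))"
proof -
  have "(a * y) * (c * x + d) - (a * x + b) * (c * y) = (a * d - b * c) * y" by (simp add: algebra_simps)
  thus ?thesis
    unfolding det by (simp add: moebius_def complex_eq_iff Re_divide Im_divide power2_eq_square algebra_simps)
qed

lemma Im_moebius_pos:
  assumes "Im z > 0" "det A = 1"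
  shows "Im (moebius A z) > 0"
proof -
  obtain a b c d where A: "A = mat2 a b c d" by (rule mat2_exhaust)
  have det: "a * d - b * c = 1" using assms A by simp
  have "c * Re z + d \<noteq> 0 \<or> c * Im z \<noteq> 0" using det assms(1) by auto
  hence "(c * Re z + d)\<^sup>2 + (c * Im z)\<^sup>2 > 0" by (simp add: sum_power2_gt_zero_iff)
  thus ?thesis using moebius_eq_Complex[OF det, of "Re z" "Im z"] assms(1) by (simp add: A)
qed

text \<open>Both points solve the same real quadratic equation. Dividing the difference of the two
  equations by \<open>z - w\<close> leaves a linear relation, whose imaginary part forces
  \<open>c = 0\<close>.\<close>

lemma moebius_fixes_two_points:
  assumes z: "Im z > 0" "Im w > 0" "z \<noteq> w" and fixed: "moebius A z = z" "moebius A w = w" and "det A = 1"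
  shows "A = mat 1 \<or> A = - mat 1"
proof -
  obtain a b c d where A: "A = mat2 a b c d" by (rule mat2_exhaust)
  have det: "a * d - b * c = 1" using assms A by simp
  have e: "of_real c * u * u + of_real (d - a) * u - of_real b = 0"
    if "Im u > 0" "moebius A u = u" for u
    using that moebius_denominator_nz[OF that(1) \<open>det A = 1\<close>]
    by (simp add: moebius_def A field_simps)
  have "(z - w) * (of_real c * (z + w) + of_real (d - a))
      = (of_real c * z * z + of_real (d - a) * z - of_real b) - (of_real c * w * w + of_real (d - a) * w - of_real b)"
    by (simp add: algebra_simps)
  also have "\<dots> = 0" using e[OF z(1) fixed(1)] e[OF z(2) fixed(2)] by simp
  finally have s: "of_real c * (z + w) + of_real (d - a) = 0" using z(3) by simp
  have "c * (Im z + Im w) = 0" using arg_cong[OF s, of Im] by simp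
  hence c: "c = 0" using z by simp
  hence ad: "a = d" using arg_cong[OF s, of Re] by simp
  have b: "b = 0" using e[OF z(1) fixed(1)] c ad by simp
  have "a * a = 1" using det ad b by simp
  hence "a = 1 \<or> a = - 1" by (simp add: square_eq_1_iff)
  thus ?thesis using c ad b by (auto simp: A mat_1_eq_mat2)
qed

section \<open>Geodesics: parametrisation, end points, apex\<close>

lemma det_dilation [simp]: "s > 0 \<Longrightarrow> det (dilation s) = 1"
  by simp

lemma geodesic_point_mult:
  assumes "det g = 1" "s > 0"
  shows "geodesic_point (\<gamma> ** g) s = moebius \<gamma> (geodesic_point g s)"
proof -
  have "det (g ** dilation s) = 1" using assms by (simp add: det_mul)
  thus ?thesis unfolding geodesic_point_def
    using moebius_mult[of \<i> "g ** dilation s" \<gamma>] by (simp add: matrix_mul_assoc)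
qed

lemma geodesic_point_dilation:
  assumes "s > 0" "t > 0"
  shows "geodesic_point (g ** dilation t) s = geodesic_point g (t * s)"
  unfolding geodesic_point_def matrix_mul_assoc[symmetric] by simp

lemma geodesic_point_eq_Complex:
  assumes det: "a * d - b * c = 1" and s: "s > 0"
  shows "geodesic_point (mat2 a b c d) s =
     Complex ((a * c * s ^ 4 + b * d) / (c\<^sup>2 * s ^ 4 + d\<^sup>2)) (s\<^sup>2 / (c\<^sup>2 * s ^ 4 + d\<^sup>2))"
proof -
  have "moebius (dilation s) \<i> = Complex 0 (s\<^sup>2)"
    using s by (simp add: moebius_def complex_eq_iff power2_eq_square Re_divide Im_divide field_simps)
  hence "geodesic_point (mat2 a b c d) s = moebius (mat2 a b c d) (Complex 0 (s\<^sup>2))"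
    unfolding geodesic_point_def using s by (simp add: moebius_mult del: mat2_mult)
  also have "\<dots> = Complex ((a * c * s ^ 4 + b * d) / (c\<^sup>2 * s ^ 4 + d\<^sup>2)) (s\<^sup>2 / (c\<^sup>2 * s ^ 4 + d\<^sup>2))"
    by (subst moebius_eq_Complex[OF det]) (simp add: power_mult_distrib power2_eq_square power4_eq_xxxx algebra_simps)
  finally show ?thesis .
qed

lemma Im_geodesic_point_pos:
  assumes "det g = 1" "s > 0"
  shows "Im (geodesic_point g s) > 0"
  unfolding geodesic_point_def using assms by (intro Im_moebius_pos) (simp_all add: det_mul)

lemma geodesic_point_inj:
  assumes g: "det g = 1" and st: "s > 0" "t > 0" and eq: "geodesic_point g s = geodesic_point g t"
  shows "s = t"
proof -
  have "moebius (matrix_inv g) (geodesic_point g u) = Complex 0 (u\<^sup>2)" if u: "u > 0" for u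
  proof -
    have "moebius (matrix_inv g) (geodesic_point g u) = geodesic_point (mat 1) u"
      using geodesic_point_mult[OF g u, of "matrix_inv g"] matrix_inv_det_1[OF g] by simp
    thus ?thesis using u by (simp add: mat_1_eq_mat2 geodesic_point_eq_Complex)
  qed
  hence "s\<^sup>2 = t\<^sup>2" using eq st by (metis complex.inject)
  thus ?thesis using st by (simp add: power2_eq_iff_nonneg)
qed

text \<open>The end points are \<open>b / d\<close> for \<open>s\<close> tending to 0 and
  \<open>a / c\<close> for \<open>s\<close> tending to \<infinity>, and
  \<open>a / c - b / d = 1 / (c * d)\<close>. If \<open>d\<close> or \<open>c\<close> vanishes, the
  imaginary part stays away from 0 at that end, so there is no real limit.\<close>

lemma positively_oriented_iff:
  assumes det: "a * d - b * c = 1"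
  shows "positively_oriented (mat2 a b c d) \<longleftrightarrow> c * d > 0"
proof -
  let ?p = "geodesic_point (mat2 a b c d)"
  have ev0: "eventually (\<lambda>s::real. s > 0) (at_right 0)" "eventually (\<lambda>s::real. s < 1) (at_right 0)"
    using eventually_at_right_less[of "0::real"] eventually_at_right_real[of 0 "1::real"]
    by (auto elim: eventually_mono)
  have lim0: "(?p \<longlongrightarrow> of_real (b / d)) (at_right 0)" if d: "d \<noteq> 0"
  proof (rule Lim_transform_eventually)
    show "((\<lambda>s. Complex ((a * c * s ^ 4 + b * d) / (c\<^sup>2 * s ^ 4 + d\<^sup>2)) (s\<^sup>2 / (c\<^sup>2 * s ^ 4 + d\<^sup>2)))
       \<longlongrightarrow> of_real (b / d)) (at_right 0)"
      using d by (auto intro!: tendsto_eq_intros simp: complex_eq_iff power2_eq_square)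
    show "\<forall>\<^sub>F s in at_right 0. Complex ((a * c * s ^ 4 + b * d) / (c\<^sup>2 * s ^ 4 + d\<^sup>2)) (s\<^sup>2 / (c\<^sup>2 * s ^ 4 + d\<^sup>2)) = ?p s"
      using ev0(1) by eventually_elim (simp add: geodesic_point_eq_Complex[OF det])
  qed
  have lim1: "(?p \<longlongrightarrow> of_real (a / c)) at_top" if c: "c \<noteq> 0"
  proof (rule Lim_transform_eventually)
    \<comment> \<open>The substitution \<open>u = 1 / s\<close> turns the limit at infinity into a
      limit at 0.\<close>
    have "((\<lambda>u. Complex ((a * c + b * d * u ^ 4) / (c\<^sup>2 + d\<^sup>2 * u ^ 4)) (u\<^sup>2 / (c\<^sup>2 + d\<^sup>2 * u ^ 4)))
       \<longlongrightarrow> of_real (a / c)) (at_right 0)"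
      using c by (auto intro!: tendsto_eq_intros simp: complex_eq_iff power2_eq_square)
    from filterlim_compose[OF this filterlim_inverse_at_right_top]
    show "((\<lambda>s. Complex ((a * c + b * d * inverse s ^ 4) / (c\<^sup>2 + d\<^sup>2 * inverse s ^ 4))
        (inverse s ^ 2 / (c\<^sup>2 + d\<^sup>2 * inverse s ^ 4))) \<longlongrightarrow> of_real (a / c)) at_top" .
    show "\<forall>\<^sub>F s in at_top. Complex ((a * c + b * d * inverse s ^ 4) / (c\<^sup>2 + d\<^sup>2 * inverse s ^ 4))
        (inverse s ^ 2 / (c\<^sup>2 + d\<^sup>2 * inverse s ^ 4)) = ?p s"
      using eventually_gt_at_top[of 0]
    proof eventually_elim
      case (elim s)
      have e: "c\<^sup>2 + d\<^sup>2 * inverse s ^ 4 = (c\<^sup>2 * s ^ 4 + d\<^sup>2) / s ^ 4"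
        "a * c + b * d * inverse s ^ 4 = (a * c * s ^ 4 + b * d) / s ^ 4"
        "inverse s ^ 2 = s ^ 2 / s ^ 4"
        using elim by (simp_all add: field_simps power_inverse power2_eq_square power4_eq_xxxx)
      have "(x / s ^ 4) / (y / s ^ 4) = x / y" for x y :: real using elim by simp
      thus ?case unfolding e geodesic_point_eq_Complex[OF det elim] by (simp only:)
    qed
  qed
  show ?thesis
  proof
    assume cd: "c * d > 0"
    hence nz: "c \<noteq> 0" "d \<noteq> 0" by auto
    have "a / c - b / d = (a * d - b * c) / (c * d)" using nz by (simp add: field_simps)
    hence "a / c - b / d > 0" using cd det by simp
    thus "positively_oriented (mat2 a b c d)"
      unfolding positively_oriented_def using lim0[OF nz(2)] lim1[OF nz(1)] by (metis diff_gt_0_iff_gt)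
  next
    assume "positively_oriented (mat2 a b c d)"
    then obtain x y :: real where x: "(?p \<longlongrightarrow> of_real x) (at_right 0)" and y: "(?p \<longlongrightarrow> of_real y) at_top"
      and "x < y" unfolding positively_oriented_def by blast
    have d: "d \<noteq> 0"
    proof
      assume d: "d = 0"
      hence c: "c \<noteq> 0" using det by auto
      have "((\<lambda>s. Im (?p s)) \<longlongrightarrow> 0) (at_right 0)" using tendsto_Im[OF x] by simp
      moreover have "\<forall>\<^sub>F s in at_right 0. 1 / c\<^sup>2 \<le> Im (?p s)"
        using ev0
      proof eventually_elim
        case (elim s)
        have "s\<^sup>2 \<le> 1" using elim by (simp add: power_le_one)
        hence "1 / c\<^sup>2 \<le> 1 / (c\<^sup>2 * s\<^sup>2)"
          using elim c by (intro divide_left_mono) (auto simp: mult_left_le)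
        also have "\<dots> = s\<^sup>2 / (c\<^sup>2 * s ^ 4)"
          using elim c by (simp add: field_simps power2_eq_square power4_eq_xxxx)
        also have "\<dots> = Im (?p s)"
          unfolding geodesic_point_eq_Complex[OF det \<open>0 < s\<close>] by (simp add: d)
        finally show ?case .
      qed
      ultimately have "1 / c\<^sup>2 \<le> 0" by (rule tendsto_lowerbound) simp
      thus False using c by simp
    qed
    have c: "c \<noteq> 0"
    proof
      assume c: "c = 0"
      have "((\<lambda>s. Im (?p s)) \<longlongrightarrow> 0) at_top" using tendsto_Im[OF y] by simp
      moreover have "\<forall>\<^sub>F s in at_top. 1 / d\<^sup>2 \<le> Im (?p s)"
        using eventually_ge_at_top[of 1]
      proof eventually_elim
        case (elim s)
        hence s: "s > 0" and "1 \<le> s\<^sup>2" by simp_all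
        hence "1 / d\<^sup>2 \<le> s\<^sup>2 / d\<^sup>2" by (simp add: divide_right_mono)
        thus ?case unfolding geodesic_point_eq_Complex[OF det s] by (simp add: c)
      qed
      ultimately have "1 / d\<^sup>2 \<le> 0" by (rule tendsto_lowerbound) simp
      thus False using d by simp
    qed
    have "x = b / d" using tendsto_unique[OF _ x lim0[OF d]] by (simp flip: of_real_divide)
    moreover have "y = a / c" using tendsto_unique[OF _ y lim1[OF c]] by (simp flip: of_real_divide)
    ultimately have "a / c - b / d > 0" using \<open>x < y\<close> by simp
    moreover have "a / c - b / d = (a * d - b * c) / (c * d)" using c d by (simp add: field_simps)
    ultimately show "c * d > 0" using det by simp
  qed
qed

text \<open>The defect of the imaginary part from \<open>1 / (2 * c * d)\<close> is a positive
  multiple of \<open>(c * s^2 - d)^2\<close>. The maximum is thus attained at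
  \<open>s^2 = d / c\<close> only, which identifies the point chosen by
  \<open>arg_max_on\<close>.\<close>

lemma apex_eq:
  assumes det: "a * d - b * c = 1" and cd: "c * d > 0"
  shows "apex (mat2 a b c d) = Complex ((a * d + b * c) / (2 * c * d)) (1 / (2 * c * d))"
proof -
  let ?p = "geodesic_point (mat2 a b c d)" and ?z = "Complex ((a * d + b * c) / (2 * c * d)) (1 / (2 * c * d))"
  have nz: "c \<noteq> 0" "d \<noteq> 0" using cd by auto
  have dc: "d / c > 0" using cd by (auto simp: zero_less_divide_iff zero_less_mult_iff)
  have pos: "c\<^sup>2 * s ^ 4 + d\<^sup>2 > 0" for s
    using nz by (simp add: add_nonneg_pos)
  have top: "?p s = ?z" if s: "s > 0" "c * s\<^sup>2 = d" for s
  proof -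
    have "c\<^sup>2 * s ^ 4 = d\<^sup>2" "c * s ^ 4 = d * s\<^sup>2"
      unfolding s(2)[symmetric] by (simp_all add: power2_eq_square power4_eq_xxxx)
    moreover have s2: "s\<^sup>2 = d / c" using s nz by (simp add: field_simps)
    ultimately show ?thesis
      unfolding geodesic_point_eq_Complex[OF det s(1)]
      using nz by (simp add: mult.assoc s2) (simp add: field_simps power2_eq_square)
  qed
  have bound: "1 / (2 * c * d) - Im (?p s) = (c * s\<^sup>2 - d)\<^sup>2 / (2 * c * d * (c\<^sup>2 * s ^ 4 + d\<^sup>2))" if "s > 0" for s
    unfolding geodesic_point_eq_Complex[OF det that] using nz pos[of s] less_imp_neq[OF pos[of s]]
    by (simp add: field_simps power2_eq_square power4_eq_xxxx)
  have le: "Im (?p s) \<le> 1 / (2 * c * d)" if "s > 0" for s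
  proof -
    have "(c * s\<^sup>2 - d)\<^sup>2 / (2 * c * d * (c\<^sup>2 * s ^ 4 + d\<^sup>2)) \<ge> 0"
      using cd pos[of s] by (intro divide_nonneg_pos mult_pos_pos[of "2 * c * d"]) (auto simp: mult.assoc)
    thus ?thesis using bound[OF that] by linarith
  qed
  define s0 where "s0 = sqrt (d / c)"
  have s0: "s0 > 0" "c * s0\<^sup>2 = d" using dc nz by (simp_all add: s0_def)
  have mem: "?z \<in> geodesic (mat2 a b c d)"
    unfolding geodesic_def using top[OF s0] s0(1) by (metis greaterThan_iff imageI)
  show ?thesis
    unfolding apex_def arg_max_on_def arg_max_def
  proof (rule some_equality)
    show "is_arg_max Im (\<lambda>x. x \<in> geodesic (mat2 a b c d)) ?z"
      unfolding is_arg_max_linorder using mem le by (auto simp: geodesic_def)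
    fix z assume z: "is_arg_max Im (\<lambda>x. x \<in> geodesic (mat2 a b c d)) z"
    then obtain s where s: "s > 0" "z = ?p s" unfolding is_arg_max_def geodesic_def by auto
    have "Im z \<ge> 1 / (2 * c * d)" using z mem unfolding is_arg_max_linorder by (metis complex.sel(2))
    hence "Im (?p s) = 1 / (2 * c * d)" using le[OF s(1)] s(2) by simp
    hence "(c * s\<^sup>2 - d)\<^sup>2 = 0" using bound[OF s(1)] nz pos[of s] by simp
    thus "z = ?z" using top[OF s(1)] s(2) by simp
  qed
qed

section \<open>The group \<open>\<Gamma>\<^sub>0(n)\<close> and periods of projected
  geodesics\<close>

lemma Gamma0I: "a * d - b * c = 1 \<Longrightarrow> n dvd c \<Longrightarrow> mat2 (of_int a) (of_int b) (of_int c) (of_int d) \<in> Gamma0 n"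
  unfolding Gamma0_def by blast

lemma Gamma0E:
  assumes "\<gamma> \<in> Gamma0 n"
  obtains a b c d where "\<gamma> = mat2 (of_int a) (of_int b) (of_int c) (of_int d)" "a * d - b * c = 1" "n dvd c"
  using assms unfolding Gamma0_def by blast

lemma det_Gamma0: "\<gamma> \<in> Gamma0 n \<Longrightarrow> det \<gamma> = 1"
  by (elim Gamma0E) (simp flip: of_int_mult of_int_diff)

lemma Gamma0_mult:
  assumes "\<gamma> \<in> Gamma0 n" "\<gamma>' \<in> Gamma0 n"
  shows "\<gamma> ** \<gamma>' \<in> Gamma0 n"
proof -
  obtain a b c d where g: "\<gamma> = mat2 (of_int a) (of_int b) (of_int c) (of_int d)" "a * d - b * c = 1" "n dvd c"
    using Gamma0E[OF assms(1)] .
  obtain a' b' c' d' where g': "\<gamma>' = mat2 (of_int a') (of_int b') (of_int c') (of_int d')" "a' * d' - b' * c' = 1" "n dvd c'"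
    using Gamma0E[OF assms(2)] .
  have "(a * a' + b * c') * (c * b' + d * d') - (a * b' + b * d') * (c * a' + d * c')
     = (a * d - b * c) * (a' * d' - b' * c')" by (simp add: algebra_simps)
  hence "mat2 (of_int (a * a' + b * c')) (of_int (a * b' + b * d')) (of_int (c * a' + d * c')) (of_int (c * b' + d * d')) \<in> Gamma0 n"
    using g g' by (intro Gamma0I) auto
  thus ?thesis unfolding g(1) g'(1) by simp
qed

lemma Gamma0_inv: "\<gamma> \<in> Gamma0 n \<Longrightarrow> matrix_inv \<gamma> \<in> Gamma0 n"
proof (elim Gamma0E)
  fix a b c d assume g: "\<gamma> = mat2 (of_int a) (of_int b) (of_int c) (of_int d)" "a * d - b * c = 1" "n dvd c"
  have "mat2 (of_int d) (of_int (- b)) (of_int (- c)) (of_int a) \<in> Gamma0 n"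
    using g by (intro Gamma0I) (auto simp: mult.commute)
  moreover have "real_of_int a * of_int d - of_int b * of_int c = 1"
    using g(2) by (simp flip: of_int_mult of_int_diff)
  ultimately show ?thesis unfolding g(1) by (simp add: matrix_inv_mat2)
qed

lemma Gamma0_mat_1: "mat 1 \<in> Gamma0 n"
  using Gamma0I[of 1 1 0 0 n] by (simp add: mat_1_eq_mat2)

lemma Gamma0_uminus:
  assumes "\<gamma> \<in> Gamma0 n"
  shows "- \<gamma> \<in> Gamma0 n"
proof -
  have "- (mat 1) \<in> Gamma0 n" using Gamma0I[of "-1" "-1" 0 0 n] by (simp add: mat_1_eq_mat2)
  moreover have "- \<gamma> = - (mat 1) ** \<gamma>"
    using assms by (elim Gamma0E) (simp add: mat_1_eq_mat2)
  ultimately show ?thesis using Gamma0_mult assms by metis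
qed

lemma countable_Gamma0: "countable (Gamma0 n)"
proof -
  have "Gamma0 n \<subseteq> (\<lambda>(a, b, c, d). mat2 (of_int a) (of_int b) (of_int c) (of_int d)) ` (UNIV :: (int \<times> int \<times> int \<times> int) set)"
  proof
    fix \<gamma> assume "\<gamma> \<in> Gamma0 n"
    then obtain a b c d where "\<gamma> = mat2 (of_int a) (of_int b) (of_int c) (of_int d)" by (rule Gamma0E)
    thus "\<gamma> \<in> (\<lambda>(a, b, c, d). mat2 (of_int a) (of_int b) (of_int c) (of_int d)) ` (UNIV :: (int \<times> int \<times> int \<times> int) set)"
      by (intro image_eqI[of _ _ "(a, b, c, d)"]) auto
  qed
  thus ?thesis by (rule countable_subset) simp
qed

lemma orbit_Gamma0:
  assumes "\<gamma> \<in> Gamma0 n" "Im z > 0"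
  shows "orbit (Gamma0 n) (moebius \<gamma> z) = orbit (Gamma0 n) z"
proof -
  have "orbit (Gamma0 n) (moebius \<gamma> z) = (\<lambda>A. moebius A z) ` (\<lambda>A. A ** \<gamma>) ` Gamma0 n"
    unfolding orbit_def image_image using moebius_mult[OF assms(2) det_Gamma0[OF assms(1)]] by simp
  also have "(\<lambda>A. A ** \<gamma>) ` Gamma0 n = Gamma0 n"
  proof
    show "(\<lambda>A. A ** \<gamma>) ` Gamma0 n \<subseteq> Gamma0 n" using Gamma0_mult assms(1) by blast
    have "A = (A ** matrix_inv \<gamma>) ** \<gamma>" for A
      using matrix_inv_det_1[OF det_Gamma0[OF assms(1)]] by (simp add: matrix_mul_assoc[symmetric])
    thus "Gamma0 n \<subseteq> (\<lambda>A. A ** \<gamma>) ` Gamma0 n"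
      using Gamma0_mult Gamma0_inv[OF assms(1)] by blast
  qed
  finally show ?thesis unfolding orbit_def .
qed

text \<open>
  The element of \<open>\<Gamma>\<^sub>0(n)\<close> moving the geodesic point at time \<open>t\<close> to that at time \<open>t + T\<close> may depend on \<open>t\<close>;
  since \<open>\<Gamma>\<^sub>0(n)\<close> is countable, two different times share the same element, which is then determined
  up to sign.
\<close>

lemma projection_period_iff:
  assumes g: "det g = 1"
  shows "projection_period (Gamma0 n) g T \<longleftrightarrow>
    T > 0 \<and> g ** dilation (exp (T / 2)) ** matrix_inv g \<in> Gamma0 n"
proof -
  \<comment> \<open>\<open>h\<close> translates by hyperbolic length \<open>T\<close> along the
    geodesic.\<close>
  define h where "h = g ** dilation (exp (T / 2)) ** matrix_inv g"
  note g_inv = matrix_inv_det_1[OF g]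
  have hg: "h ** g = g ** dilation (exp (T / 2))"
    unfolding h_def using g_inv by (simp add: matrix_mul_assoc[symmetric] del: mat2_mult)
  have det_h: "det h = 1" unfolding h_def using g g_inv by (simp add: det_mul)
  have h_move: "moebius h (geodesic_point g (exp (t / 2))) = geodesic_point g (exp ((t + T) / 2))" for t
  proof -
    have "moebius h (geodesic_point g (exp (t / 2))) = geodesic_point (h ** g) (exp (t / 2))"
      using geodesic_point_mult[OF g] by simp
    also have "\<dots> = geodesic_point g (exp (T / 2) * exp (t / 2))"
      unfolding hg by (rule geodesic_point_dilation) auto
    also have "exp (T / 2) * exp (t / 2) = exp ((t + T) / 2)"
      by (simp add: exp_add[symmetric] add_divide_distrib add.commute)
    finally show ?thesis .
  qed
  have pos: "Im (geodesic_point g (exp (t / 2))) > 0" for t :: real using Im_geodesic_point_pos[OF g] by simp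
  show ?thesis
  proof
    assume "T > 0 \<and> g ** dilation (exp (T / 2)) ** matrix_inv g \<in> Gamma0 n"
    hence "T > 0" "h \<in> Gamma0 n" by (auto simp: h_def)
    thus "projection_period (Gamma0 n) g T"
      unfolding projection_period_def h_move[symmetric] using orbit_Gamma0 pos by blast
  next
    assume per: "projection_period (Gamma0 n) g T"
    have "\<exists>\<gamma>\<in>Gamma0 n. moebius \<gamma> (geodesic_point g (exp (t / 2))) = geodesic_point g (exp ((t + T) / 2))" for t
    proof -
      have "moebius (mat 1) (geodesic_point g (exp ((t + T) / 2))) \<in> orbit (Gamma0 n) (geodesic_point g (exp ((t + T) / 2)))"
        unfolding orbit_def using Gamma0_mat_1 by blast
      hence "geodesic_point g (exp ((t + T) / 2)) \<in> orbit (Gamma0 n) (geodesic_point g (exp (t / 2)))"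
        using per unfolding projection_period_def by simp
      thus ?thesis unfolding orbit_def by auto
    qed
    then obtain \<gamma> where \<gamma>: "\<And>t. \<gamma> t \<in> Gamma0 n"
      "\<And>t. moebius (\<gamma> t) (geodesic_point g (exp (t / 2))) = geodesic_point g (exp ((t + T) / 2))"
      by metis
    have "\<not> inj \<gamma>"
    proof
      assume "inj \<gamma>"
      moreover have "countable (range \<gamma>)"
        using \<gamma>(1) by (intro countable_subset[OF _ countable_Gamma0[of n]]) auto
      ultimately have "countable (UNIV :: real set)" using countable_image_inj_on by blast
      thus False using uncountable_UNIV_real by blast
    qed
    then obtain t u where tu: "\<gamma> t = \<gamma> u" "t \<noteq> u" unfolding inj_def by blast
    note h_inv = matrix_inv_det_1[OF det_h]
    have move_back: "moebius (matrix_inv h) (geodesic_point g (exp ((v + T) / 2))) = geodesic_point g (exp (v / 2))" for v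
      unfolding h_move[symmetric] using moebius_mult[OF pos det_h, of "matrix_inv h" v] h_inv by simp
    have fixed: "moebius (matrix_inv h ** \<gamma> v) (geodesic_point g (exp (v / 2))) = geodesic_point g (exp (v / 2))" for v
      using moebius_mult[OF pos det_Gamma0[OF \<gamma>(1)]] \<gamma>(2) move_back by simp
    have "geodesic_point g (exp (t / 2)) \<noteq> geodesic_point g (exp (u / 2))"
      using geodesic_point_inj[OF g, of "exp (t / 2)" "exp (u / 2)"] tu(2) by auto
    moreover have "det (matrix_inv h ** \<gamma> t) = 1" using h_inv det_Gamma0[OF \<gamma>(1)] by (simp add: det_mul)
    ultimately have "matrix_inv h ** \<gamma> t = mat 1 \<or> matrix_inv h ** \<gamma> t = - mat 1"
      using moebius_fixes_two_points[OF pos pos _ fixed[of t]] fixed[of u] tu(1) by metis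
    moreover have "\<gamma> t = h ** (matrix_inv h ** \<gamma> t)" using h_inv by (simp add: matrix_mul_assoc)
    moreover have "h ** - mat 1 = - h" by (cases h rule: mat2_exhaust) (simp add: mat_1_eq_mat2)
    ultimately have "h = \<gamma> t \<or> h = - \<gamma> t" by (metis matrix_mul_rid minus_minus)
    hence "h \<in> Gamma0 n" using \<gamma>(1) Gamma0_uminus by metis
    thus "T > 0 \<and> g ** dilation (exp (T / 2)) ** matrix_inv g \<in> Gamma0 n"
      using per by (simp add: h_def projection_period_def)
  qed
qed

text \<open>The three equations say \<open>g diag(\<surd>D, -\<surd>D) g\<^sup>-\<^sup>1 = (B, -C; A, -B)\<close>.\<close>

definition represents :: "int \<Rightarrow> real^2^2 \<Rightarrow> form \<Rightarrow> bool" where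
  "represents D g = (\<lambda>(A, B, C). det g = 1 \<and>
     of_int A = 2 * (g $ 2 $ 1) * (g $ 2 $ 2) * sqrt (of_int D) \<and>
     of_int B = (g $ 1 $ 1 * g $ 2 $ 2 + g $ 1 $ 2 * g $ 2 $ 1) * sqrt (of_int D) \<and>
     of_int C = 2 * (g $ 1 $ 1) * (g $ 1 $ 2) * sqrt (of_int D))"

lemma represents_det: "represents D g Q \<Longrightarrow> det g = 1"
  by (cases Q) (simp add: represents_def)

lemma represents_unique_form: "represents D g Q \<Longrightarrow> represents D g Q' \<Longrightarrow> Q = Q'"
  by (cases Q, cases Q') (auto simp: represents_def)

lemma represents_act:
  assumes Q: "represents D g Q" and det: "a * d - b * c = 1"
  shows "represents D (mat2 (of_int a) (of_int b) (of_int c) (of_int d) ** g) (form_act a b c d Q)"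
proof -
  obtain A B C where ABC: "Q = (A, B, C)" by (cases Q)
  obtain x y z w where g: "g = mat2 x y z w" by (rule mat2_exhaust)
  have r: "of_int A = 2 * z * w * sqrt (of_int D)" "of_int B = (x * w + y * z) * sqrt (of_int D)"
    "of_int C = 2 * x * y * sqrt (of_int D)"
    using Q unfolding ABC g by (simp_all add: represents_def)
  have "det (mat2 (of_int a) (of_int b) (of_int c) (of_int d) ** g) = (of_int (a * d - b * c) :: real)"
    using represents_det[OF Q] by (simp add: det_mul del: mat2_mult)
  hence "det (mat2 (of_int a) (of_int b) (of_int c) (of_int d) ** g) = (1 :: real)" using det by simp
  thus ?thesis unfolding ABC form_act_def represents_def g
    by (simp add: r power2_eq_square algebra_simps)
qed

text \<open>The columns are eigenvectors of the matrix of the form for \<surd>D and -\<surd>D,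
  namely (B + \<surd>D, A) and (B - \<surd>D, A); the second is divided by 2A\<surd>D to get
  determinant 1.\<close>

lemma represents_exists:
  assumes "B\<^sup>2 - A * C = D" "A \<noteq> 0" "D > 0"
  shows "\<exists>g. represents D g (A, B, C)"
proof -
  define w where "w = sqrt (of_int D)"
  have w: "w > 0" using assms by (simp add: w_def)
  have "w * w = of_int D" using assms by (simp add: w_def)
  hence ww: "w * w = of_int B * of_int B - of_int A * of_int C"
    using assms(1)[symmetric] by (simp add: power2_eq_square)
  have "2 * (of_int B + w) * ((of_int B - w) / (2 * of_int A * w)) * w = (of_int B * of_int B - w * w) / of_int A"
    using w assms by (simp add: field_simps)
  also have "\<dots> = of_int C" unfolding ww using assms by simp
  finally have "represents D (mat2 (of_int B + w) ((of_int B - w) / (2 * of_int A * w)) (of_int A) (1 / (2 * w))) (A, B, C)"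
    unfolding represents_def w_def[symmetric] using w assms by (simp add: field_simps)
  thus ?thesis by blast
qed

text \<open>Both matrices conjugate diag(1, -1) to the same matrix, so their quotient commutes with
  diag(1, -1) and is diagonal.\<close>

lemma represents_unique:
  assumes g: "represents D g Q" and g': "represents D g' Q" and D: "D > 0"
  obtains s where "s > 0" "g' = g ** dilation s \<or> g' = - (g ** dilation s)"
proof -
  obtain A B C where ABC: "Q = (A, B, C)" by (cases Q)
  obtain a b c d where ge: "g = mat2 a b c d" by (rule mat2_exhaust)
  obtain a' b' c' d' where ge': "g' = mat2 a' b' c' d'" by (rule mat2_exhaust)
  have "sqrt (of_int D) > (0 :: real)" using D by simp
  hence e: "c' * d' = c * d" "a' * d' + b' * c' = a * d + b * c" "a' * b' = a * b"
    using g g' unfolding ABC ge ge' represents_def by (simp_all add: mult.assoc)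
  have det: "a * d - b * c = 1" "a' * d' - b' * c' = 1"
    using represents_det[OF g] represents_det[OF g'] by (simp_all add: ge ge')
  \<comment> \<open>(p, q; t, u) is the inverse of \<open>g\<close> times \<open>g'\<close>.\<close>
  define p q t u where "p = d * a' - b * c'" and "q = d * b' - b * d'"
    and "t = a * c' - c * a'" and "u = a * d' - c * b'"
  have "p * q = d\<^sup>2 * (a' * b') - b * d * (a' * d' + b' * c') + b\<^sup>2 * (c' * d')"
    unfolding p_def q_def by (simp add: power2_eq_square algebra_simps)
  also have "\<dots> = 0" unfolding e by (simp add: power2_eq_square algebra_simps)
  finally have pq: "p * q = 0" .
  have "t * u = a\<^sup>2 * (c' * d') - a * c * (a' * d' + b' * c') + c\<^sup>2 * (a' * b')"
    unfolding t_def u_def by (simp add: power2_eq_square algebra_simps)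
  also have "\<dots> = 0" unfolding e by (simp add: power2_eq_square algebra_simps)
  finally have tu: "t * u = 0" .
  have "p * u - q * t = (a * d - b * c) * (a' * d' - b' * c')"
    unfolding p_def q_def t_def u_def by (simp add: algebra_simps)
  hence 1: "p * u - q * t = 1" using det by simp
  have "p * u + q * t = (a * d + b * c) * (a' * d' + b' * c') - 2 * c * d * (a' * b') - 2 * a * b * (c' * d')"
    unfolding p_def q_def t_def u_def by (simp add: algebra_simps)
  also have "\<dots> = (a * d - b * c)\<^sup>2" unfolding e by (simp add: power2_eq_square algebra_simps)
  finally have "p * u + q * t = 1" using det by simp
  hence "p * u = 1" using 1 by simp
  hence nz: "p \<noteq> 0" "u = inverse p" by (auto simp: inverse_unique)
  have "u \<noteq> 0" using nz by simp
  hence qt: "q = 0" "t = 0" using pq tu nz by auto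
  have "a * p = (a * d - b * c) * a' - b * t" "b * u = (a * d - b * c) * b' - a * q"
    "c * p = (a * d - b * c) * c' - d * t" "d * u = (a * d - b * c) * d' - c * q"
    unfolding p_def q_def t_def u_def by (simp_all add: algebra_simps)
  hence g'p: "g' = g ** mat2 p 0 0 (inverse p)" using det qt nz by (simp add: ge ge')
  show ?thesis
  proof (cases "p > 0")
    case True
    thus ?thesis using that g'p by blast
  next
    case False
    hence "- p > 0" "g' = - (g ** dilation (- p))" using nz g'p by (simp_all add: ge)
    thus ?thesis using that by blast
  qed
qed

lemma represents_dilation:
  assumes "represents D g Q" "s > 0"
  shows "represents D (g ** dilation s) Q" "represents D (- (g ** dilation s)) Q"
proof -
  obtain a b c d where g: "g = mat2 a b c d" by (rule mat2_exhaust)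
  obtain A B C where Q: "Q = (A, B, C)" by (cases Q)
  have "g ** dilation s = mat2 (a * s) (b / s) (c * s) (d / s)" by (simp add: g divide_inverse)
  moreover have "- \<dots> = mat2 (- (a * s)) (- (b / s)) (- (c * s)) (- (d / s))" by simp
  moreover have e: "(z * s) * (x / s) = z * x" "(x / s) * (z * s) = x * z" for x z :: real
    using assms(2) by simp_all
  ultimately show "represents D (g ** dilation s) Q" "represents D (- (g ** dilation s)) Q"
    using assms(1) unfolding Q g represents_def
    by (simp_all only: prod.case det_mat2 mat2_nth mult.assoc[of 2] e minus_mult_minus)
qed

text \<open>As a form determines \<open>g\<close> up to dilation and sign, stabilizing the oriented
  geodesic is the same as fixing the form.\<close>

lemma geodesic_stabilizer_eq:
  assumes g: "represents D g Q" and D: "D > 0"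
  shows "geodesic_stabilizer n g = {\<gamma> \<in> Gamma0 n. represents D (\<gamma> ** g) Q}"
proof -
  note g_inv = matrix_inv_det_1[OF represents_det[OF g]]
  have "\<gamma> = g ** M ** matrix_inv g \<longleftrightarrow> \<gamma> ** g = g ** M" for \<gamma> M
    using g_inv by (metis matrix_mul_assoc matrix_mul_rid)
  moreover have "\<gamma> = - (g ** M ** matrix_inv g) \<longleftrightarrow> \<gamma> ** g = - (g ** M)" for \<gamma> M
  proof -
    have neg: "(- A) ** B = - (A ** B)" for A B :: "real^2^2"
      by (cases A rule: mat2_exhaust, cases B rule: mat2_exhaust) simp
    show ?thesis using g_inv neg by (metis matrix_mul_assoc matrix_mul_rid)
  qed
  ultimately have "geodesic_stabilizer n g
     = {\<gamma> \<in> Gamma0 n. \<exists>s>0. \<gamma> ** g = g ** dilation s \<or> \<gamma> ** g = - (g ** dilation s)}"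
    unfolding geodesic_stabilizer_def by blast
  also have "\<dots> = {\<gamma> \<in> Gamma0 n. represents D (\<gamma> ** g) Q}"
    using represents_dilation[OF g] represents_unique[OF g _ D] by (metis (no_types, lifting))
  finally show ?thesis .
qed

lemma represents_positively_oriented_iff:
  assumes "represents D g (A, B, C)" "D > 0"
  shows "positively_oriented g \<longleftrightarrow> A > 0"
proof -
  obtain a b c d where g: "g = mat2 a b c d" by (rule mat2_exhaust)
  have det: "a * d - b * c = 1" using represents_det[OF assms(1)] by (simp add: g)
  have "of_int A = 2 * sqrt (of_int D) * (c * d)" using assms(1) by (simp add: represents_def g)
  moreover have "2 * sqrt (of_int D) > (0::real)" using assms(2) by simp
  ultimately have "real_of_int A > 0 \<longleftrightarrow> c * d > 0" using zero_less_mult_iff by (metis not_less_iff_gr_or_eq)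
  thus ?thesis unfolding g positively_oriented_iff[OF det] by simp
qed

lemma represents_apex:
  assumes "represents D g (A, B, C)" "D > 0" "A > 0"
  shows "apex g = root_point D A B"
proof -
  obtain a b c d where g: "g = mat2 a b c d" by (rule mat2_exhaust)
  have det: "a * d - b * c = 1" using represents_det[OF assms(1)] by (simp add: g)
  define w where "w = sqrt (of_int D)"
  have w: "w > 0" using assms by (simp add: w_def)
  have e: "of_int A = 2 * c * d * w" "of_int B = (a * d + b * c) * w"
    using assms(1) by (simp_all add: represents_def g w_def)
  have "positively_oriented g" using represents_positively_oriented_iff assms by blast
  hence cd: "c * d > 0" unfolding g positively_oriented_iff[OF det] .
  have "root_point D A B = Complex (of_int B / of_int A) (w / of_int A)"
    unfolding root_point_def w_def by (simp add: complex_eq_iff)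
  also have "\<dots> = Complex ((a * d + b * c) / (2 * c * d)) (1 / (2 * c * d))"
    unfolding e using w by simp
  finally show ?thesis unfolding g apex_eq[OF det cd] ..
qed

text \<open>The imaginary part determines the modulus, and integral translation of the real part
  changes \<mu> by a multiple of it.\<close>

lemma root_point_cong_iff:
  assumes "D > 0" "m > 0" "m' > 0"
  shows "cong_Gamma_inf (root_point D m \<mu>) (root_point D m' \<mu>') \<longleftrightarrow> m' = m \<and> [\<mu>' = \<mu>] (mod m)"
proof -
  define w where "w = sqrt (of_int D)"
  have w: "w > 0" using assms by (simp add: w_def)
  have p: "root_point D m \<mu> = Complex (of_int \<mu> / of_int m) (w / of_int m)" for m \<mu>
    unfolding root_point_def w_def by (simp add: complex_eq_iff)
  show ?thesis
  proof
    assume "cong_Gamma_inf (root_point D m \<mu>) (root_point D m' \<mu>')"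
    then obtain k :: int where k: "root_point D m' \<mu>' - root_point D m \<mu> = of_int k"
      unfolding cong_Gamma_inf_def by (elim Ints_cases)
    have "w / of_int m' = w / of_int m" using arg_cong[OF k, of Im] by (simp add: p)
    hence m: "m' = m" using w assms by (simp add: field_simps)
    have "of_int \<mu>' / of_int m - of_int \<mu> / of_int m = (of_int k :: real)"
      using arg_cong[OF k, of Re] m by (simp add: p)
    hence "of_int (\<mu>' - \<mu>) = (of_int (m * k) :: real)" using assms by (simp add: field_simps)
    hence "\<mu>' - \<mu> = m * k" by (simp only: of_int_eq_iff)
    thus "m' = m \<and> [\<mu>' = \<mu>] (mod m)" using m by (simp add: cong_iff_dvd_diff)
  next
    assume h: "m' = m \<and> [\<mu>' = \<mu>] (mod m)"
    then obtain k where k: "\<mu>' = \<mu> + m * k" by (metis cong_iff_lin cong_sym)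
    have "root_point D m' \<mu>' - root_point D m \<mu> = of_int k"
      using h k assms by (simp add: p complex_eq_iff field_simps)
    thus "cong_Gamma_inf (root_point D m \<mu>) (root_point D m' \<mu>')"
      unfolding cong_Gamma_inf_def by simp
  qed
qed

lemma double_coset_eqI:
  assumes H: "\<And>x y. x \<in> H \<Longrightarrow> y \<in> H \<Longrightarrow> x ** y \<in> H" and K: "\<And>x y. x \<in> K \<Longrightarrow> y \<in> K \<Longrightarrow> x ** y \<in> K"
    and h: "h \<in> H" "h' \<in> H" "h' ** h = mat 1" and k: "k \<in> K" "k' \<in> K" "k ** k' = mat 1"
    and \<gamma>: "\<gamma>' = h ** \<gamma> ** k"
  shows "double_coset H \<gamma>' K = double_coset H \<gamma> K"
proof -
  have sub: "double_coset H (h ** \<gamma> ** k) K \<subseteq> double_coset H \<gamma> K" if "h \<in> H" "k \<in> K" for h k \<gamma>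
  proof
    fix z assume "z \<in> double_coset H (h ** \<gamma> ** k) K"
    then obtain A B where AB: "A \<in> H" "B \<in> K" "z = A ** (h ** \<gamma> ** k) ** B"
      unfolding double_coset_def by blast
    have "z = (A ** h) ** \<gamma> ** (k ** B)" unfolding AB(3) by (simp add: matrix_mul_assoc)
    thus "z \<in> double_coset H \<gamma> K" unfolding double_coset_def using H K AB that by blast
  qed
  have "h' ** \<gamma>' ** k' = (h' ** h) ** \<gamma> ** (k ** k')" unfolding \<gamma> by (simp add: matrix_mul_assoc)
  hence "\<gamma> = h' ** \<gamma>' ** k'" using h k by simp
  thus ?thesis using sub[OF h(2) k(2), of \<gamma>'] sub[OF h(1) k(1), of \<gamma>] \<gamma> by auto
qed

lemma Gamma_infI: "mat2 1 (of_int k) 0 1 \<in> Gamma_inf"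
  unfolding Gamma_inf_def by blast

lemma Gamma_inf_mult:
  assumes "A \<in> Gamma_inf" "B \<in> Gamma_inf"
  shows "A ** B \<in> Gamma_inf"
proof -
  obtain j where "A = mat2 1 (of_int j) 0 1 \<or> A = - mat2 1 (of_int j) 0 1"
    using assms(1) unfolding Gamma_inf_def by blast
  moreover obtain k where "B = mat2 1 (of_int k) 0 1 \<or> B = - mat2 1 (of_int k) 0 1"
    using assms(2) unfolding Gamma_inf_def by blast
  ultimately have "A ** B = mat2 1 (of_int (j + k)) 0 1 \<or> A ** B = - mat2 1 (of_int (j + k)) 0 1"
    by auto
  thus ?thesis unfolding Gamma_inf_def by blast
qed


section \<open>Closed geodesics attached to forms\<close>

context squarefree_1_mod_4
begin

text \<open>The infinitely many good rational approximations p/q of \<surd>D have p + q\<surd>D of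
  bounded norm. Two of them share their norm v and their residues modulo v; their quotient is
  integral of norm 1.\<close>

lemma pell_solution: "\<exists>x y :: int. x > 0 \<and> y > 0 \<and> x\<^sup>2 - D * y\<^sup>2 = 1"
proof -
  define M :: int where "M = \<lceil>2 * r + 1\<rceil>"
  have "r \<notin> \<rat>" using rat_independent[of 0 1 r 0] by auto
  hence inf: "infinite (approx_set r)" using rational_iff_finite_approx_set by blast
  \<comment> \<open>The pigeonhole key: the norm together with both residues modulo the
    norm.\<close>
  define f where "f = (\<lambda>(p, q). (p\<^sup>2 - D * q\<^sup>2, p mod (p\<^sup>2 - D * q\<^sup>2), q mod (p\<^sup>2 - D * q\<^sup>2)))"
  have bound: "\<bar>p\<^sup>2 - D * q\<^sup>2\<bar> \<le> M" if "(p, q) \<in> approx_set r" for p q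
  proof -
    have q: "q > 0" and a: "\<bar>r - of_int p / of_int q\<bar> < 1 / (of_int q)\<^sup>2"
      using that unfolding approx_set_def by auto
    have q1: "real_of_int q \<ge> 1" using q by simp
    have "\<bar>r * of_int q - of_int p\<bar> = of_int q * \<bar>r - of_int p / of_int q\<bar>"
      using q by (simp add: abs_mult_pos' right_diff_distrib mult.commute)
    also have "\<dots> < of_int q * (1 / (of_int q)\<^sup>2)" using q a by (intro mult_strict_left_mono) auto
    also have "\<dots> = 1 / of_int q" using q by (simp add: power2_eq_square)
    finally have 1: "\<bar>r * of_int q - of_int p\<bar> < 1 / of_int q" .
    have "1 / real_of_int q \<le> of_int q" using q1 by (simp add: field_simps mult_mono' order_trans[OF q1])
    moreover have "\<bar>r * of_int q + of_int p\<bar> \<le> 2 * (r * of_int q) + \<bar>r * of_int q - of_int p\<bar>"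
    proof -
      have "r * of_int q > 0" using r_pos q by simp
      thus ?thesis by linarith
    qed
    ultimately have "\<bar>r * of_int q + of_int p\<bar> \<le> 2 * (r * of_int q) + of_int q" using 1 by linarith
    hence "\<bar>r * of_int q + of_int p\<bar> \<le> (2 * r + 1) * of_int q" by (simp add: algebra_simps)
    hence "\<bar>r * of_int q - of_int p\<bar> * \<bar>r * of_int q + of_int p\<bar> \<le> (1 / of_int q) * ((2 * r + 1) * of_int q)"
      using 1 q r_pos by (intro mult_mono) auto
    also have "\<dots> = 2 * r + 1" using q by simp
    also have "\<bar>r * of_int q - of_int p\<bar> * \<bar>r * of_int q + of_int p\<bar> = \<bar>of_int (p\<^sup>2 - D * q\<^sup>2)\<bar>"
    proof -
      have "(r * of_int q - of_int p) * (r * of_int q + of_int p) = - of_int (p\<^sup>2 - D * q\<^sup>2)"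
        by (simp add: r_sq[symmetric] power2_eq_square algebra_simps)
      thus ?thesis by (metis abs_minus_cancel abs_mult)
    qed
    finally have "real_of_int \<bar>p\<^sup>2 - D * q\<^sup>2\<bar> \<le> 2 * r + 1" by simp
    also have "\<dots> \<le> of_int M" unfolding M_def by simp
    finally show ?thesis by (simp only: of_int_le_iff)
  qed
  have nz: "p\<^sup>2 - D * q\<^sup>2 \<noteq> 0" if "(p, q) \<in> approx_set r" for p q
    using that square_eq_D_mult_square[of p q] unfolding approx_set_def by auto
  have "f ` approx_set r \<subseteq> {-M..M} \<times> {-M..M} \<times> {-M..M}"
  proof (rule image_subsetI)
    fix z assume z: "z \<in> approx_set r"
    obtain p q where pq_eq: "z = (p, q)" by (cases z)
    have pq: "(p, q) \<in> approx_set r" using z pq_eq by simp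
    have "\<bar>x mod (p\<^sup>2 - D * q\<^sup>2)\<bar> \<le> \<bar>p\<^sup>2 - D * q\<^sup>2\<bar>" for x
      using abs_mod_less[OF nz[OF pq], of x] by simp
    hence "\<bar>x mod (p\<^sup>2 - D * q\<^sup>2)\<bar> \<le> M" for x using bound[OF pq] order_trans by blast
    thus "f z \<in> {-M..M} \<times> {-M..M} \<times> {-M..M}"
      unfolding f_def pq_eq using bound[OF pq] by (auto simp: abs_le_iff minus_le_iff)
  qed
  hence "finite (f ` approx_set r)" by (rule finite_subset) auto
  hence "\<not> inj_on f (approx_set r)" using inf finite_imageD by blast
  then obtain p q p' q' where pq: "(p, q) \<in> approx_set r" "(p', q') \<in> approx_set r"
    and ne: "(p, q) \<noteq> (p', q')" and eq: "f (p, q) = f (p', q')" unfolding inj_on_def by (metis prod.exhaust)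
  define v where "v = p\<^sup>2 - D * q\<^sup>2"
  have v: "v \<noteq> 0" unfolding v_def using nz[OF pq(1)] .
  have v': "p'\<^sup>2 - D * q'\<^sup>2 = v" and c: "[p = p'] (mod v)" "[q = q'] (mod v)"
    using eq unfolding f_def v_def cong_def by auto
  have "[p * p - D * q * q = p * p' - D * q * q'] (mod v)"
    using c by (intro cong_diff cong_mult cong_refl)
  moreover have "p * p - D * q * q = v" by (simp add: v_def power2_eq_square)
  ultimately have "v dvd p * p' - D * q * q'" by (metis cong_dvd_iff dvd_refl)
  then obtain X where X: "p * p' - D * q * q' = v * X" by blast
  have "[q * p' - p * q' = q' * p' - p' * q'] (mod v)"
    using c by (intro cong_diff cong_mult cong_refl)
  hence "v dvd q * p' - p * q'" by (simp add: cong_0_iff mult.commute)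
  then obtain Y where Y: "q * p' - p * q' = v * Y" by blast
  \<comment> \<open>\<open>X + Y * r\<close> is the quotient of \<open>p + q * r\<close> by
    \<open>p' + q' * r\<close>: the product with the conjugate is
    \<open>v * (X + Y * r)\<close>.\<close>
  have "(v * X)\<^sup>2 - D * (v * Y)\<^sup>2 = (p\<^sup>2 - D * q\<^sup>2) * (p'\<^sup>2 - D * q'\<^sup>2)"
    unfolding X[symmetric] Y[symmetric] by (simp add: power2_eq_square algebra_simps)
  hence "v\<^sup>2 * (X\<^sup>2 - D * Y\<^sup>2) = v\<^sup>2 * 1"
    unfolding v' v_def[symmetric] by (simp add: power2_eq_square algebra_simps)
  hence XY: "X\<^sup>2 - D * Y\<^sup>2 = 1" using v by simp
  \<comment> \<open>Otherwise the two pairs are proportional; equal norms and positive denominators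
    make them equal.\<close>
  have "Y \<noteq> 0"
  proof
    assume "Y = 0"
    hence e: "q * p' = p * q'" using Y by simp
    have qq: "q > 0" "q' > 0" using pq unfolding approx_set_def by auto
    have "q'\<^sup>2 * v = (p * q')\<^sup>2 - D * q\<^sup>2 * q'\<^sup>2"
      unfolding v_def by (simp add: power_mult_distrib algebra_simps)
    also have "\<dots> = q\<^sup>2 * v" unfolding e[symmetric] v'[symmetric] by (simp add: power_mult_distrib algebra_simps)
    finally have "q'\<^sup>2 = q\<^sup>2" using v by simp
    hence "q = q'" using qq by (simp add: power2_eq_iff_nonneg)
    thus False using e qq ne by simp
  qed
  moreover have "D * Y\<^sup>2 \<ge> 0" using D_pos by simp
  hence "X \<noteq> 0" using XY by force
  ultimately show ?thesis using XY by (intro exI[of _ "\<bar>X\<bar>"] exI[of _ "\<bar>Y\<bar>"]) auto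
qed

text \<open>The matrix is x + y M, with M the matrix of the form and \<open>x\<close>,
  \<open>y\<close> the two displayed quotients. Since \<open>n\<close> divides \<open>A\<close>,
  integral \<open>x\<close> and \<open>y\<close> suffice, and primitivity makes them necessary. The
  criterion involves \<open>s\<close> and \<open>D\<close> alone.\<close>

lemma geodesic_dilation_Gamma0_iff:
  assumes g: "represents D g Q" and Q: "Q \<in> level_forms D n \<nu>" and s: "s > 0"
  shows "g ** dilation s ** matrix_inv g \<in> Gamma0 n \<longleftrightarrow>
    (s + inverse s) / 2 \<in> \<int> \<and> (s - inverse s) / (2 * r) \<in> \<int>"
proof -
  obtain A B C where ABC: "Q = (A, B, C)" by (cases Q)
  have P: "(A, B, C) \<in> primitive_forms D" and n: "n dvd A" using Q unfolding ABC level_forms_def by auto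
  obtain a b c d where ge: "g = mat2 a b c d" by (rule mat2_exhaust)
  have det: "a * d - b * c = 1" using represents_det[OF g] by (simp add: ge)
  have e: "of_int A = 2 * c * d * r" "of_int B = (a * d + b * c) * r" "of_int C = 2 * a * b * r"
    using g unfolding ABC ge by (simp_all add: represents_def r_def)
  define x y where "x = (s + inverse s) / 2" and "y = (s - inverse s) / (2 * r)"
  have yr: "y * r = (s - inverse s) / 2" using r_pos by (simp add: y_def)
  have h: "g ** dilation s ** matrix_inv g = mat2 (x + y * of_int B) (- (y * of_int C)) (y * of_int A) (x - y * of_int B)"
  proof -
    have yA: "y * of_int A = 2 * c * d * (y * r)" "y * of_int B = (a * d + b * c) * (y * r)"
      "y * of_int C = 2 * a * b * (y * r)"
      unfolding e by (simp_all add: algebra_simps)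
    have ad: "a * d = 1 + b * c" using det by simp
    have "g ** dilation s ** matrix_inv g = mat2 (a * d * s - b * c * inverse s) (a * b * inverse s - a * b * s)
        (c * d * s - c * d * inverse s) (a * d * inverse s - b * c * s)"
      unfolding ge matrix_inv_mat2[OF det] by (simp add: algebra_simps)
    moreover define i where "i = inverse s"
    ultimately show ?thesis unfolding yA yr x_def ad i_def[symmetric] by (simp add: field_simps)
  qed
  have norm: "x\<^sup>2 - of_int D * y\<^sup>2 = 1"
  proof -
    have "x\<^sup>2 - of_int D * y\<^sup>2 = x\<^sup>2 - (y * r)\<^sup>2" by (simp add: r_sq[symmetric] power2_eq_square algebra_simps)
    also have "\<dots> = s * inverse s" unfolding x_def yr by (simp add: power2_eq_square field_simps)
    finally show ?thesis using s by simp
  qed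
  show ?thesis unfolding h x_def[symmetric] y_def[symmetric]
  proof
    assume "mat2 (x + y * of_int B) (- (y * of_int C)) (y * of_int A) (x - y * of_int B) \<in> Gamma0 n"
    then obtain a b c d where i: "x + y * of_int B = of_int a" "- (y * of_int C) = of_int b"
      "y * of_int A = of_int c" "x - y * of_int B = of_int d"
      by (elim Gamma0E) simp
    obtain u v w where uvw: "u * A + v * (2 * B) + w * C = 1" using primitive_form_bezout[OF P] .
    \<comment> \<open>The entries of x + y M yield \<open>y * A\<close>, \<open>2 * y * B\<close>
      and \<open>y * C\<close>; the Bezout relation recovers \<open>y\<close>.\<close>
    have "y = y * of_int (u * A + v * (2 * B) + w * C)" unfolding uvw by simp
    also have "\<dots> = of_int u * (y * of_int A) + of_int v * ((x + y * of_int B) - (x - y * of_int B)) - of_int w * (- (y * of_int C))"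
      by (simp add: algebra_simps)
    also have "\<dots> = of_int (u * c + v * (a - d) - w * b)" unfolding i by simp
    finally have y: "y \<in> \<int>" by (metis Ints_of_int)
    have "x = of_int a - y * of_int B" using i(1) by simp
    also have "\<dots> \<in> \<int>" using y by simp
    finally show "x \<in> \<int> \<and> y \<in> \<int>" using y by simp
  next
    assume "x \<in> \<int> \<and> y \<in> \<int>"
    then obtain X Y where XY: "x = of_int X" "y = of_int Y" by (elim conjE Ints_cases)
    have "of_int (X\<^sup>2 - D * Y\<^sup>2) = (of_int 1 :: real)" using norm unfolding XY by simp
    hence "X\<^sup>2 - D * Y\<^sup>2 = 1" by (simp only: of_int_eq_iff)
    moreover have "D = B\<^sup>2 - A * C" using P by (auto simp: primitive_forms_def)
    ultimately have "(X + Y * B) * (X - Y * B) - (- (Y * C)) * (Y * A) = 1"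
      by (simp add: power2_eq_square algebra_simps)
    from Gamma0I[OF this, of n] n
    show "mat2 (x + y * of_int B) (- (y * of_int C)) (y * of_int A) (x - y * of_int B) \<in> Gamma0 n"
      unfolding XY by simp
  qed
qed

lemma projection_period_level_form_iff:
  assumes "represents D g Q" "Q \<in> level_forms D n \<nu>"
  shows "projection_period (Gamma0 n) g T \<longleftrightarrow> T > 0 \<and>
    (exp (T / 2) + inverse (exp (T / 2))) / 2 \<in> \<int> \<and> (exp (T / 2) - inverse (exp (T / 2))) / (2 * r) \<in> \<int>"
  using projection_period_iff[OF represents_det[OF assms(1)]] geodesic_dilation_Gamma0_iff[OF assms] by simp

lemma projects_to_closed_geodesic_level_form:
  assumes "represents D g Q" "Q \<in> level_forms D n \<nu>"
  shows "projects_to_closed_geodesic (Gamma0 n) g"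
proof -
  obtain x y :: int where xy: "x > 0" "y > 0" "x\<^sup>2 - D * y\<^sup>2 = 1" using pell_solution by blast
  \<comment> \<open>A Pell solution gives \<open>s\<close> whose inverse is its conjugate. The
    period is \<open>2 * ln s\<close> because unit speed corresponds to the parameter
    \<open>exp (t / 2)\<close>.\<close>
  define s where "s = of_int x + of_int y * r"
  have "of_int y * r > 0" using xy r_pos by simp
  moreover have "real_of_int x \<ge> 1" using xy by simp
  ultimately have s: "s > 1" unfolding s_def by linarith
  have "s * (of_int x - of_int y * r) = of_int (x\<^sup>2 - D * y\<^sup>2)"
    unfolding s_def by (simp add: r_sq[symmetric] power2_eq_square algebra_simps)
  hence inv: "inverse s = of_int x - of_int y * r" using xy(3) by (intro inverse_unique) simp
  have "exp (2 * ln s / 2) = s" using s by simp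
  moreover have "(s + inverse s) / 2 = of_int x" "(s - inverse s) / (2 * r) = of_int y"
    unfolding inv using r_pos by (simp_all add: s_def)
  ultimately have "projection_period (Gamma0 n) g (2 * ln s)"
    unfolding projection_period_level_form_iff[OF assms] using s by simp
  thus ?thesis unfolding projects_to_closed_geodesic_def by blast
qed

text \<open>The sets of periods coincide, because the criterion for periods no longer mentions the
  form.\<close>

lemma closed_geodesic_length_level_forms:
  assumes "represents D g Q" "Q \<in> level_forms D n \<nu>" "represents D g' Q'" "Q' \<in> level_forms D n \<nu>"
  shows "closed_geodesic_length (Gamma0 n) g = closed_geodesic_length (Gamma0 n) g'"
  unfolding closed_geodesic_length_def projection_period_level_form_iff[OF assms(1,2)]
    projection_period_level_form_iff[OF assms(3,4)] ..

text \<open>The exact quotient is \<open>- C\<close>, so the parity condition on the root is the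
  primitivity of the form.\<close>

lemma admissible_root_iff:
  assumes "\<mu>\<^sup>2 - m * C = D" "m > 0"
  shows "admissible_root D n \<nu> m \<mu> \<longleftrightarrow> (m, \<mu>, C) \<in> level_forms D n \<nu>"
proof -
  have D: "D - \<mu>\<^sup>2 = m * (- C)" using assms by simp
  have "(D - \<mu>\<^sup>2) div m = - C"
    unfolding D by (rule nonzero_mult_div_cancel_left) (use assms(2) in simp)
  moreover have "[\<mu>\<^sup>2 = D] (mod m)" using assms by (auto simp: cong_iff_dvd_diff)
  ultimately show ?thesis
    using assms unfolding admissible_root_def level_forms_def primitive_forms_def
    by (auto simp: cong_0_iff)
qed

lemma admissible_rootE:
  assumes "admissible_root D n \<nu> m \<mu>"
  obtains C where "(m, \<mu>, C) \<in> level_forms D n \<nu>" "m > 0"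
proof -
  have m: "m > 0" "[\<mu>\<^sup>2 = D] (mod m)" using assms by (auto simp: admissible_root_def)
  then obtain C where "\<mu>\<^sup>2 - D = m * C" unfolding cong_iff_dvd_diff by blast
  hence "\<mu>\<^sup>2 - m * C = D" by simp
  thus ?thesis using that m admissible_root_iff assms by blast
qed

lemma represents_Gamma0:
  assumes g: "represents D g Q" and Q: "Q \<in> level_forms D n \<nu>" and \<gamma>: "\<gamma> \<in> Gamma0 n"
  obtains Q' where "represents D (\<gamma> ** g) Q'" "Q' \<in> level_forms D n \<nu>" "form_equiv Q Q'"
proof -
  obtain a b c d where h: "\<gamma> = mat2 (of_int a) (of_int b) (of_int c) (of_int d)" "a * d - b * c = 1" "n dvd c"
    using Gamma0E[OF \<gamma>] .
  show ?thesis
  proof (rule that)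
    show "represents D (\<gamma> ** g) (form_act a b c d Q)" unfolding h(1) by (rule represents_act[OF g h(2)])
    show "form_act a b c d Q \<in> level_forms D n \<nu>" by (rule form_act_level[OF Q h(2,3)])
    show "form_equiv Q (form_act a b c d Q)" unfolding form_equiv_def using h(2) by blast
  qed
qed

lemma geodesic_stabilizer_mult:
  assumes g: "represents D g Q" and "\<gamma> \<in> geodesic_stabilizer n g" "\<gamma>' \<in> geodesic_stabilizer n g"
  shows "\<gamma> ** \<gamma>' \<in> geodesic_stabilizer n g"
proof -
  note st = geodesic_stabilizer_eq[OF _ D_pos]
  have h: "\<gamma> \<in> Gamma0 n" "represents D (\<gamma> ** g) Q" "\<gamma>' \<in> Gamma0 n" "represents D (\<gamma>' ** g) Q"
    using assms unfolding st[OF g] by auto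
  obtain a b c d where \<gamma>: "\<gamma> = mat2 (of_int a) (of_int b) (of_int c) (of_int d)" "a * d - b * c = 1"
    using Gamma0E[OF h(1)] by metis
  have "form_act a b c d Q = Q"
    using represents_unique_form[OF represents_act[OF g \<gamma>(2)]] h(2) \<gamma>(1) by blast
  hence "represents D (\<gamma> ** (\<gamma>' ** g)) Q" using represents_act[OF h(4) \<gamma>(2)] \<gamma>(1) by simp
  thus ?thesis unfolding st[OF g] using h Gamma0_mult by (simp add: matrix_mul_assoc)
qed

text \<open>Congruent middle coefficients differ by a translation \<open>T j\<close>. After this
  correction both group elements carry \<open>Q\<close> to the same form, so they differ by an
  element of the stabilizer of \<open>Q\<close>.\<close>

lemma double_coset_eq_if_same_form:
  assumes g: "represents D g Q" and \<gamma>: "\<gamma> \<in> Gamma0 n" "\<gamma>' \<in> Gamma0 n"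
    and rep: "represents D (\<gamma> ** g) (m, \<mu>, C)" "represents D (\<gamma>' ** g) (m, \<mu>', C')"
    and cong: "[\<mu>' = \<mu>] (mod m)" and m: "m > 0"
    and P: "(m, \<mu>, C) \<in> primitive_forms D" "(m, \<mu>', C') \<in> primitive_forms D"
  shows "double_coset Gamma_inf \<gamma>' (geodesic_stabilizer n g) = double_coset Gamma_inf \<gamma> (geodesic_stabilizer n g)"
proof -
  obtain j where j: "\<mu>' = \<mu> + m * j" using cong by (metis cong_iff_lin cong_sym)
  define T :: "int \<Rightarrow> real^2^2" where "T k = mat2 1 (of_int k) 0 1" for k
  have TG: "T k \<in> Gamma0 n" for k using Gamma0I[of 1 1 k 0 n] by (simp add: T_def)
  have TT: "T k ** T (- k) = mat 1" "T (- k) ** T k = mat 1" for k by (simp_all add: T_def mat_1_eq_mat2)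
  have "form_act 1 j 0 1 (m, \<mu>, C) \<in> primitive_forms D" by (rule form_act_primitive[OF P(1)]) simp
  moreover obtain C'' where act: "form_act 1 j 0 1 (m, \<mu>, C) = (m, \<mu>', C'')"
    by (simp add: form_act_def j add.commute)
  ultimately have "m * C'' = m * C'" using P(2) by (auto simp: primitive_forms_def)
  hence act: "form_act 1 j 0 1 (m, \<mu>, C) = (m, \<mu>', C')" using act m by simp
  have rT: "represents D (T j ** (\<gamma> ** g)) (m, \<mu>', C')"
    using represents_act[OF rep(1), of 1 1 j 0] act by (simp add: T_def)
  define k where "k = matrix_inv \<gamma> ** T (- j) ** \<gamma>'"
  define k' where "k' = matrix_inv \<gamma>' ** T j ** \<gamma>"
  note inv = matrix_inv_det_1[OF det_Gamma0[OF \<gamma>(1)]]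
  note inv' = matrix_inv_det_1[OF det_Gamma0[OF \<gamma>(2)]]
  have cancel: "X ** (Y ** Z) = Z" if "X ** Y = mat 1" for X Y Z :: "real^2^2"
    using that by (simp add: matrix_mul_assoc)
  have kG: "k \<in> Gamma0 n" "k' \<in> Gamma0 n"
    unfolding k_def k'_def by (intro Gamma0_mult Gamma0_inv \<gamma> TG)+
  have eq: "\<gamma>' = T j ** \<gamma> ** k"
    unfolding k_def by (simp add: matrix_mul_assoc[symmetric] cancel inv TT)
  have kk: "k ** k' = mat 1"
    unfolding k_def k'_def by (simp add: matrix_mul_assoc[symmetric] cancel inv inv' TT)
  \<comment> \<open>Group elements act injectively on forms: if \<beta> gives the same form for
    \<open>\<alpha> ** g\<close> as for \<open>g\<close>, then these two represent the same
    form.\<close>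
  have same: "represents D (\<alpha> ** g) Q"
    if \<alpha>: "\<alpha> \<in> Gamma0 n" and \<beta>_mem: "\<beta> \<in> Gamma0 n" and R: "represents D (\<beta> ** g) R" "represents D (\<beta> ** (\<alpha> ** g)) R" for \<alpha> \<beta> R
  proof -
    obtain Q1 where Q1: "represents D (\<alpha> ** g) Q1" using represents_act[OF g] Gamma0E[OF \<alpha>] by metis
    obtain a b c d where \<beta>: "\<beta> = mat2 (of_int a) (of_int b) (of_int c) (of_int d)" "a * d - b * c = 1"
      using Gamma0E[OF \<beta>_mem] by metis
    have "form_act a b c d Q1 = R" "form_act a b c d Q = R"
      using represents_unique_form[OF represents_act[OF Q1 \<beta>(2)]] represents_unique_form[OF represents_act[OF g \<beta>(2)]]
        R \<beta>(1) by blast+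
    hence "Q1 = Q" using form_act_inverse[OF \<beta>(2)] by metis
    thus ?thesis using Q1 by simp
  qed
  have "represents D (k ** g) Q"
  proof (rule same[OF kG(1) Gamma0_mult[OF TG[of j] \<gamma>(1)]])
    show "represents D (T j ** \<gamma> ** g) (m, \<mu>', C')" using rT by (simp add: matrix_mul_assoc)
    show "represents D (T j ** \<gamma> ** (k ** g)) (m, \<mu>', C')" using rep(2) eq by (simp add: matrix_mul_assoc)
  qed
  moreover have "represents D (k' ** g) Q"
  proof (rule same[OF kG(2) \<gamma>(2) rep(2)])
    have "\<gamma>' ** (k' ** g) = T j ** (\<gamma> ** g)"
      unfolding k'_def by (simp add: matrix_mul_assoc[symmetric] cancel inv')
    thus "represents D (\<gamma>' ** (k' ** g)) (m, \<mu>', C')" using rT by simp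
  qed
  ultimately have k: "k \<in> geodesic_stabilizer n g" "k' \<in> geodesic_stabilizer n g"
    unfolding geodesic_stabilizer_eq[OF g D_pos] using kG by auto
  have "T j \<in> Gamma_inf" "T (- j) \<in> Gamma_inf" unfolding T_def by (rule Gamma_infI)+
  thus ?thesis
    using double_coset_eqI[OF Gamma_inf_mult geodesic_stabilizer_mult[OF g] _ _ TT(2) k kk eq] by blast
qed

end

theorem theorem3p9:
  fixes D n \<nu> :: int
  assumes "D > 1" and "squarefree D" and "[D = 1] (mod 4)"
    and "n \<ge> 1" and "[\<nu>\<^sup>2 = D] (mod n)"
  shows "\<exists>g :: nat \<Rightarrow> real^2^2.
    (\<forall>k\<in>{1..narrow_class_number D}.
        det (g k) = 1 \<and> projects_to_closed_geodesic (Gamma0 n) (g k)) \<and>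
    (\<forall>k\<in>{1..narrow_class_number D}. \<forall>l\<in>{1..narrow_class_number D}.
        closed_geodesic_length (Gamma0 n) (g k) = closed_geodesic_length (Gamma0 n) (g l)) \<and>
    (\<forall>m \<mu>. admissible_root D n \<nu> m \<mu> \<longrightarrow>
        (\<exists>!p. case p of (k, C) \<Rightarrow>
            k \<in> {1..narrow_class_number D} \<and>
            (\<exists>\<gamma>\<in>Gamma0 n.
                C = double_coset Gamma_inf \<gamma> (geodesic_stabilizer n (g k)) \<and>
                positively_oriented (\<gamma> ** g k) \<and>
                cong_Gamma_inf (apex (\<gamma> ** g k)) (root_point D m \<mu>)))) \<and>
    (\<forall>k\<in>{1..narrow_class_number D}. \<forall>\<gamma>\<in>Gamma0 n.
        positively_oriented (\<gamma> ** g k) \<longrightarrow>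
        (\<exists>!p. case p of (m, M) \<Rightarrow>
            (\<exists>\<mu>. M = residue_class m \<mu> \<and> admissible_root D n \<nu> m \<mu> \<and>
                 cong_Gamma_inf (apex (\<gamma> ** g k)) (root_point D m \<mu>))))"
proof -
  interpret squarefree_1_mod_4 D by unfold_locales (use assms in auto)
  let ?h = "narrow_class_number D"
  obtain q :: "nat \<Rightarrow> form" where q: "\<And>k. k \<in> {1..?h} \<Longrightarrow> q k \<in> level_forms D n \<nu>"
    and q_unique: "\<And>Q. Q \<in> primitive_forms D \<Longrightarrow> \<exists>!k. k \<in> {1..?h} \<and> form_equiv (q k) Q"
    using level_form_class_representatives[OF assms(4,5)] by blast
  have level_primitive: "Q \<in> primitive_forms D" if "Q \<in> level_forms D n \<nu>" for Q
    using that unfolding level_forms_def by auto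
  have "\<exists>g. represents D g (q k)" if "k \<in> {1..?h}" for k
  proof -
    obtain A B C where ABC: "q k = (A, B, C)" by (cases "q k")
    have P: "(A, B, C) \<in> primitive_forms D" using level_primitive[OF q[OF that]] ABC by simp
    hence "B\<^sup>2 - A * C = D" by (auto simp: primitive_forms_def)
    thus ?thesis unfolding ABC using represents_exists primitive_form_nz(1)[OF P] D_pos by blast
  qed
  then obtain g where g: "\<And>k. k \<in> {1..?h} \<Longrightarrow> represents D (g k) (q k)" by metis
  have translate: "\<exists>A B C. represents D (\<gamma> ** g k) (A, B, C) \<and> (A, B, C) \<in> level_forms D n \<nu> \<and>
      form_equiv (q k) (A, B, C) \<and> (positively_oriented (\<gamma> ** g k) \<longrightarrow> A > 0 \<and> apex (\<gamma> ** g k) = root_point D A B)"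
    if k: "k \<in> {1..?h}" and \<gamma>: "\<gamma> \<in> Gamma0 n" for k \<gamma>
  proof -
    obtain Q' where Q': "represents D (\<gamma> ** g k) Q'" "Q' \<in> level_forms D n \<nu>" "form_equiv (q k) Q'"
      using represents_Gamma0[OF g[OF k] q[OF k] \<gamma>] .
    obtain A B C where "Q' = (A, B, C)" by (cases Q')
    thus ?thesis
      using Q' represents_positively_oriented_iff[OF _ D_pos] represents_apex[OF _ D_pos] by metis
  qed
  have i: "\<exists>!p. case p of (k, C) \<Rightarrow> k \<in> {1..?h} \<and> (\<exists>\<gamma>\<in>Gamma0 n.
        C = double_coset Gamma_inf \<gamma> (geodesic_stabilizer n (g k)) \<and> positively_oriented (\<gamma> ** g k) \<and>
        cong_Gamma_inf (apex (\<gamma> ** g k)) (root_point D m \<mu>))"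
    if adm: "admissible_root D n \<nu> m \<mu>" for m \<mu>
  proof -
    obtain C where Q: "(m, \<mu>, C) \<in> level_forms D n \<nu>" and m: "m > 0" using admissible_rootE[OF adm] .
    obtain k where k: "k \<in> {1..?h}" "form_equiv (q k) (m, \<mu>, C)"
      and k_unique: "\<And>k'. k' \<in> {1..?h} \<Longrightarrow> form_equiv (q k') (m, \<mu>, C) \<Longrightarrow> k' = k"
      using q_unique[OF level_primitive[OF Q]] by metis
    obtain a b c d where det: "a * d - b * c = 1" and act: "(m, \<mu>, C) = form_act a b c d (q k)"
      using k(2) unfolding form_equiv_def by blast
    define \<gamma> where "\<gamma> = mat2 (of_int a) (of_int b) (of_int c) (of_int d)"
    have "n dvd c" using level_forms_equiv_dvd[OF q[OF k(1)] _ det] Q act by simp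
    hence \<gamma>: "\<gamma> \<in> Gamma0 n" unfolding \<gamma>_def using Gamma0I det by blast
    have rep: "represents D (\<gamma> ** g k) (m, \<mu>, C)"
      unfolding act \<gamma>_def by (rule represents_act[OF g[OF k(1)] det])
    have pos: "positively_oriented (\<gamma> ** g k)"
      using represents_positively_oriented_iff[OF rep D_pos] m by simp
    have apex: "apex (\<gamma> ** g k) = root_point D m \<mu>" using represents_apex[OF rep D_pos m] .
    show ?thesis
    proof (rule ex1I[of _ "(k, double_coset Gamma_inf \<gamma> (geodesic_stabilizer n (g k)))"])
      show "case (k, double_coset Gamma_inf \<gamma> (geodesic_stabilizer n (g k))) of (k, C) \<Rightarrow> k \<in> {1..?h} \<and>
          (\<exists>\<gamma>\<in>Gamma0 n. C = double_coset Gamma_inf \<gamma> (geodesic_stabilizer n (g k)) \<and>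
          positively_oriented (\<gamma> ** g k) \<and> cong_Gamma_inf (apex (\<gamma> ** g k)) (root_point D m \<mu>))"
        using k(1) \<gamma> pos apex root_point_cong_iff[OF D_pos m m, of \<mu> \<mu>] by auto
    next
      fix p assume p: "case p of (k, C) \<Rightarrow> k \<in> {1..?h} \<and> (\<exists>\<gamma>\<in>Gamma0 n.
        C = double_coset Gamma_inf \<gamma> (geodesic_stabilizer n (g k)) \<and> positively_oriented (\<gamma> ** g k) \<and>
        cong_Gamma_inf (apex (\<gamma> ** g k)) (root_point D m \<mu>))"
      obtain k' S where kS: "p = (k', S)" by (cases p)
      obtain \<gamma>' where k': "k' \<in> {1..?h}" and \<gamma>': "\<gamma>' \<in> Gamma0 n"
        and S: "S = double_coset Gamma_inf \<gamma>' (geodesic_stabilizer n (g k'))"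
        and pos': "positively_oriented (\<gamma>' ** g k')"
        and cong': "cong_Gamma_inf (apex (\<gamma>' ** g k')) (root_point D m \<mu>)"
        using p unfolding kS by auto
      obtain A B E where rep': "represents D (\<gamma>' ** g k') (A, B, E)" and Q': "(A, B, E) \<in> level_forms D n \<nu>"
        and equiv': "form_equiv (q k') (A, B, E)" and A: "A > 0" "apex (\<gamma>' ** g k') = root_point D A B"
        using translate[OF k' \<gamma>'] pos' by blast
      have mA: "m = A" and B: "[\<mu> = B] (mod m)"
        using cong' root_point_cong_iff[OF D_pos A(1) m, of B \<mu>] unfolding A(2) by auto
      \<comment> \<open>The two forms differ by a translation, so they lie in the same class, and
        the uniqueness of representatives gives \<open>k' = k\<close>.\<close>
      obtain j where j: "B = \<mu> + m * j" using B by (metis cong_iff_lin)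
      have "form_equiv (m, \<mu>, C) (form_act 1 j 0 1 (m, \<mu>, C))" unfolding form_equiv_def by force
      moreover have "form_act 1 j 0 1 (m, \<mu>, C) = (A, B, E)"
      proof -
        obtain F where F: "form_act 1 j 0 1 (m, \<mu>, C) = (A, B, F)"
          by (simp add: form_act_def j mA add.commute)
        have "(A, B, F) \<in> primitive_forms D"
          unfolding F[symmetric] by (rule form_act_primitive[OF level_primitive[OF Q]]) simp
        hence "A * F = A * E" using level_primitive[OF Q'] by (auto simp: primitive_forms_def)
        thus ?thesis using F A(1) by simp
      qed
      ultimately have "form_equiv (q k') (m, \<mu>, C)"
        using equiv' form_equiv_trans form_equiv_sym by metis
      hence kk: "k' = k" using k_unique k' by blast
      have "S = double_coset Gamma_inf \<gamma> (geodesic_stabilizer n (g k))"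
        unfolding S kk using rep' Q' B cong_sym level_primitive Q unfolding kk mA[symmetric]
        by (intro double_coset_eq_if_same_form[OF g[OF k(1)] \<gamma> \<gamma>' rep, of B E]) (auto simp: m)
      thus "p = (k, double_coset Gamma_inf \<gamma> (geodesic_stabilizer n (g k)))" using kS kk by simp
    qed
  qed
  have ii: "\<exists>!p. case p of (m, M) \<Rightarrow> (\<exists>\<mu>. M = residue_class m \<mu> \<and> admissible_root D n \<nu> m \<mu> \<and>
        cong_Gamma_inf (apex (\<gamma> ** g k)) (root_point D m \<mu>))"
    if k: "k \<in> {1..?h}" and \<gamma>: "\<gamma> \<in> Gamma0 n" and pos: "positively_oriented (\<gamma> ** g k)" for k \<gamma>
  proof -
    obtain A B C where Q: "(A, B, C) \<in> level_forms D n \<nu>" and A: "A > 0" and apex: "apex (\<gamma> ** g k) = root_point D A B"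
      using translate[OF k \<gamma>] pos by blast
    have "B\<^sup>2 - A * C = D" using level_primitive[OF Q] by (auto simp: primitive_forms_def)
    hence adm: "admissible_root D n \<nu> A B" using admissible_root_iff A Q by blast
    show ?thesis
    proof (rule ex1I[of _ "(A, residue_class A B)"])
      show "case (A, residue_class A B) of (m, M) \<Rightarrow> (\<exists>\<mu>. M = residue_class m \<mu> \<and> admissible_root D n \<nu> m \<mu> \<and>
        cong_Gamma_inf (apex (\<gamma> ** g k)) (root_point D m \<mu>))"
        using adm apex root_point_cong_iff[OF D_pos A A, of B B] by auto
    next
      fix p assume "case p of (m, M) \<Rightarrow> (\<exists>\<mu>. M = residue_class m \<mu> \<and> admissible_root D n \<nu> m \<mu> \<and>
        cong_Gamma_inf (apex (\<gamma> ** g k)) (root_point D m \<mu>))"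
      then obtain m \<mu> where p: "p = (m, residue_class m \<mu>)" and adm': "admissible_root D n \<nu> m \<mu>"
        and cong': "cong_Gamma_inf (root_point D A B) (root_point D m \<mu>)"
        unfolding apex by (cases p) auto
      have m: "m > 0" using adm' by (simp add: admissible_root_def)
      have "m = A" "[\<mu> = B] (mod A)" using cong' root_point_cong_iff[OF D_pos A m] by auto
      thus "p = (A, residue_class A B)" unfolding p residue_class_def by (auto simp: cong_def)
    qed
  qed
  show ?thesis
  proof (intro exI[of _ g] conjI ballI allI impI)
    fix k l assume k: "k \<in> {1..?h}" and l: "l \<in> {1..?h}"
    show "det (g k) = 1" using represents_det[OF g[OF k]] .
    show "projects_to_closed_geodesic (Gamma0 n) (g k)"
      using projects_to_closed_geodesic_level_form[OF g[OF k] q[OF k]] .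
    show "closed_geodesic_length (Gamma0 n) (g k) = closed_geodesic_length (Gamma0 n) (g l)"
      using closed_geodesic_length_level_forms[OF g[OF k] q[OF k] g[OF l] q[OF l]] .
  qed (fact i ii)+
qed

end
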